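(* Let $d\ge1$ be a fixed integer, let $\lambda>0$ be a constant, and let $X_n\sim\mathrm{MRSC}_d(n;\boldsymbol p)$ with $\boldsymbol p=\boldsymbol p(n)=(p_1,\dots,p_d)\in[0,1]^d$ such that, as $n\to\infty$, $n^dq_d\to\infty$ and $nr_d\to\lambda$. Then, as $n\to\infty$, $X_n$ converges locally weakly in probability to $(X,\tau)$, where $(X,\tau)$ is a $(d-1)$-rooted Poisson tree with parameter $\lambda$.
   Context: A simplicial complex $X$ is a collection of finite nonempty sets (simplices) closed under taking nonempty subsets; $\sigma\in X$ has dimension $|\sigma|-1$. $S_k(X)$ is the set of $k$-simplices, $s_k(X)=|S_k(X)|$. $\mathrm{MRSC}_d(n;\boldsymbol p)$: vertex set $[n]$; recursively for $k=1,\dots,d$, given the $(k-1)$-skeleton, each $(k+1)$-subset of $[n]$ all of whose nonempty proper subsets are already simplices is included as a $k$-simplex with probability $p_k$, independently of everything else. Parameters: $q_d:=\prod_{k=1}^{d-1}p_k^{\binom d{k+1}}$, $r_d:=\prod_{k=1}^dp_k^{\binom dk}$. Rooted complexes: a $(d-1)$-rooted simplicial complex is a pair $(X,\sigma)$ with $X$ a simplicial complex of dimension at most $d$ and $\sigma\in S_{d-1}(X)$. Two such pairs $(X_1,\sigma_1),(X_2,\sigma_2)$ are isomorphic ($\cong$) if there is a bijection $S_0(X_1)\to S_0(X_2)$ which preserves simplices in both directions and maps $\sigma_1$ onto $\sigma_2$. $X$ is locally finite above dimension $d-1$ if every $(d-1)$-simplex lies in finitely many $d$-simplices. $\mathcal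 S_{d-1}$ is the set of isomorphism classes of $(d-1)$-rooted simplicial complexes that are locally finite above dimension $d-1$. Neighborhoods: $Q(\sigma)$ is the set of all nonempty subsets of $\sigma$. Put $B_X(\sigma;0)=Q(\sigma)$; given $B_X(\sigma;\ell)$, let $\mathcal J_\ell$ be the set of $d$-simplices of $X$ not in $B_X(\sigma;\ell)$ that contain at least one $(d-1)$-simplex belonging to $B_X(\sigma;\ell)$, let $\partial B_X(\sigma;\ell+1)=\bigcup_{\rho\in\mathcal J_\ell}\big(Q(\rho)\setminus B_X(\sigma;\ell)\big)$ and $B_X(\sigma;\ell+1)=B_X(\sigma;\ell)\cup\partial B_X(\sigma;\ell+1)$. $B_X(\sigma;r)$ is regarded as rooted at $\sigma$. Local-weak convergence in probability: a sequence of finite random simplicial complexes $(X_n)$ converges locally weakly in probability to a random rooted complex $(X,o)$ with law $\mu$ if for every integer $r\ge0$ and every $H_*\in\mathcal S_{d-1}$, $$\frac1{s_{d-1}(X_n)}\sum_{\sigma\in S_{d-1}(X_n)}\mathbf 1\{B_{X_n}(\sigma;r)\cong H_*\}\overset{\mathbb P}{\longrightarrow}\mu\big(B_X(o;r)\cong H_*\big).$$ $(d-1)$-rooted Poisson tree with parameter $\lambda$: the random rooted complex $(X,\tau)$ built as follows. Start with a root $(d-1)$-simplex $\tau$ (with all its faces). At each step $k=0,1,\dots$, to every $(d-1)$-simplex $\tau'$ at distance $k$ from $\tau$ (distance = the minimal number of steps in a chain of $(d-1)$-simplices, consecutive ones lying in a common $d$-simplex), attach $m\sim\mathrm{Poisson}(\lambda)$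 new vertices $v_1,\dots,v_m$ together with the $d$-simplices $\tau'\cup\{v_1\},\dots,\tau'\cup\{v_m\}$ and all their faces, independently across different $(d-1)$-simplices. *)

theory Defs
  imports "HOL-Probability.Probability" "HOL-Library.FSet"
begin

section \<open>Rooted simplicial complexes\<close>

definition abstract_simplicial_complex :: "'a set set \<Rightarrow> bool" where
  "abstract_simplicial_complex X \<longleftrightarrow>
     (\<forall>\<sigma>\<in>X. finite \<sigma> \<and> \<sigma> \<noteq> {} \<and> (\<forall>\<alpha>\<subseteq>\<sigma>. \<alpha> \<noteq> {} \<longrightarrow> \<alpha> \<in> X))"

definition simplices :: "nat \<Rightarrow> 'a set set \<Rightarrow> 'a set set" where
  "simplices k X = {\<sigma> \<in> X. card \<sigma> = k + 1}"

text \<open>A vertex \<open>v\<close> is identified with the 0-simplex \<open>{v}\<close>.\<close>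

definition vertices :: "'a set set \<Rightarrow> 'a set" where
  "vertices X = {v. {v} \<in> X}"

definition faces :: "'a set \<Rightarrow> 'a set set" where
  "faces \<sigma> = {\<alpha>. \<alpha> \<subseteq> \<sigma> \<and> \<alpha> \<noteq> {}}"

type_synonym 'a rooted = "'a set set \<times> 'a set"

definition rooted_iso :: "'a rooted \<Rightarrow> 'b rooted \<Rightarrow> bool" where
  "rooted_iso G H \<longleftrightarrow>
     (\<exists>f. bij_betw f (vertices (fst G)) (vertices (fst H)) \<and>
          (\<forall>\<alpha>\<subseteq>vertices (fst G). \<alpha> \<in> fst G \<longleftrightarrow> f ` \<alpha> \<in> fst H) \<and>
          f ` snd G = snd H)"

text \<open>The \<open>(d-1)\<close>-rooted complexes of dimension at most \<open>d\<close> that are locally finite above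
  dimension \<open>d-1\<close>. Isomorphism classes of these are handled through their representatives.\<close>

definition rooted_complexes :: "nat \<Rightarrow> 'a rooted set" where
  "rooted_complexes d =
     {(X, \<sigma>). abstract_simplicial_complex X \<and> (\<forall>\<rho>\<in>X. card \<rho> \<le> d + 1) \<and> \<sigma> \<in> simplices (d - 1) X \<and>
        (\<forall>\<alpha>\<in>simplices (d - 1) X. finite {\<rho> \<in> simplices d X. \<alpha> \<subseteq> \<rho>})}"

fun nbhd :: "nat \<Rightarrow> 'a set set \<Rightarrow> 'a set \<Rightarrow> nat \<Rightarrow> 'a set set" where
  "nbhd d X \<sigma> 0 = faces \<sigma>"
| "nbhd d X \<sigma> (Suc l) =
     (let B = nbhd d X \<sigma> l;
          J = {\<rho> \<in> simplices d X. \<rho> \<notin> B \<and> (\<exists>\<alpha>\<in>simplices (d - 1) B. \<alpha> \<subseteq> \<rho>)}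
      in B \<union> (\<Union>\<rho>\<in>J. faces \<rho> - B))"

definition rooted_nbhd :: "nat \<Rightarrow> 'a rooted \<Rightarrow> nat \<Rightarrow> 'a rooted" where
  "rooted_nbhd d G r = (nbhd d (fst G) (snd G) r, snd G)"


section \<open>Local weak convergence in probability\<close>

definition nbhd_frequency :: "nat \<Rightarrow> 'a set set \<Rightarrow> nat \<Rightarrow> 'v rooted \<Rightarrow> real" where
  "nbhd_frequency d X r H =
     (\<Sum>\<sigma>\<in>simplices (d - 1) X. if rooted_iso (rooted_nbhd d (X, \<sigma>) r) H then 1 else 0) /
     real (card (simplices (d - 1) X))"

text \<open>The random complex \<open>X n\<close> lives on the probability space \<open>M n\<close>, the random rooted complex
  \<open>G\<close> on \<open>P\<close>. The type argument is the vertex type of the test complexes \<open>H\<close>.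
  Measurability of the limiting events is part of the definition, because \<open>measure\<close> is \<open>0\<close> on
  non-measurable sets.\<close>

definition converges_locally_weakly_in_prob ::
    "'v itself \<Rightarrow> nat \<Rightarrow> (nat \<Rightarrow> 'w measure) \<Rightarrow> (nat \<Rightarrow> 'w \<Rightarrow> 'a set set) \<Rightarrow>
     'u measure \<Rightarrow> ('u \<Rightarrow> 'b rooted) \<Rightarrow> bool" where
  "converges_locally_weakly_in_prob _ d M X P G \<longleftrightarrow>
     (\<forall>r. \<forall>H \<in> (rooted_complexes d :: 'v rooted set).
        let E = {\<omega> \<in> space P. rooted_iso (rooted_nbhd d (G \<omega>) r) H}
        in E \<in> sets P \<and>
           (\<forall>\<epsilon>>0. (\<lambda>n. measure (M n)
              {\<omega> \<in> space (M n). \<bar>nbhd_frequency d (X n \<omega>) r H - measure P E\<bar> > \<epsilon>})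
            \<longlonglongrightarrow> 0))"


section \<open>The multi-parameter random simplicial complex\<close>

definition fillable :: "nat \<Rightarrow> nat \<Rightarrow> nat set set \<Rightarrow> nat set set" where
  "fillable n k X = {\<sigma>. \<sigma> \<subseteq> {1..n} \<and> card \<sigma> = k + 1 \<and> (\<forall>\<alpha>. \<alpha> \<subset> \<sigma> \<and> \<alpha> \<noteq> {} \<longrightarrow> \<alpha> \<in> X)}"

definition random_subset :: "'a set \<Rightarrow> real \<Rightarrow> 'a set pmf" where
  "random_subset A p = map_pmf (\<lambda>b. {a \<in> A. b a}) (Pi_pmf A False (\<lambda>_. bernoulli_pmf p))"

primrec mrsc :: "nat \<Rightarrow> nat \<Rightarrow> (nat \<Rightarrow> real) \<Rightarrow> nat set set pmf" where
  "mrsc 0 n p = return_pmf ((\<lambda>v. {v}) ` {1..n})"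
| "mrsc (Suc k) n p =
     bind_pmf (mrsc k n p) (\<lambda>X.
       map_pmf (\<lambda>S. X \<union> S) (random_subset (fillable n (Suc k) X) (p (Suc k))))"

definition q_param :: "nat \<Rightarrow> (nat \<Rightarrow> real) \<Rightarrow> real" where
  "q_param d p = (\<Prod>k=1..d-1. p k ^ (d choose (k + 1)))"

definition r_param :: "nat \<Rightarrow> (nat \<Rightarrow> real) \<Rightarrow> real" where
  "r_param d p = (\<Prod>k=1..d. p k ^ (d choose k))"


section \<open>The rooted Poisson tree\<close>

text \<open>The root simplex has the vertices \<open>Base 0, \<dots>, Base (d-1)\<close>, and \<open>Attached \<tau> i\<close> is the
  \<open>i\<close>-th of the new vertices attached to the \<open>(d-1)\<close>-simplex \<open>\<tau>\<close>. In particular vertices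
  attached to different simplices are different.\<close>

datatype tree_vertex = Base nat | Attached "tree_vertex fset" nat

definition tree_root :: "nat \<Rightarrow> tree_vertex set" where
  "tree_root d = Base ` {..<d}"

definition adjacency :: "nat \<Rightarrow> 'a set set \<Rightarrow> ('a set \<times> 'a set) set" where
  "adjacency d X = {(\<alpha>, \<beta>). \<alpha> \<in> simplices (d - 1) X \<and> \<beta> \<in> simplices (d - 1) X \<and>
     (\<exists>\<rho>\<in>simplices d X. \<alpha> \<subseteq> \<rho> \<and> \<beta> \<subseteq> \<rho>)}"

definition at_distance :: "nat \<Rightarrow> 'a set set \<Rightarrow> 'a set \<Rightarrow> nat \<Rightarrow> 'a set \<Rightarrow> bool" where
  "at_distance d X \<tau> k \<beta> \<longleftrightarrow>
     (\<tau>, \<beta>) \<in> adjacency d X ^^ k \<and> (\<forall>j<k. (\<tau>, \<beta>) \<notin> adjacency d X ^^ j)"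

text \<open>\<open>N \<tau>\<close> is the number of vertices attached to \<open>\<tau>\<close>. The distance of a \<open>(d-1)\<close>-simplex
  to the root is determined when that simplex is created, and is not changed by later steps.\<close>

primrec tree_steps :: "nat \<Rightarrow> (tree_vertex fset \<Rightarrow> nat) \<Rightarrow> nat \<Rightarrow> tree_vertex set set" where
  "tree_steps d N 0 = faces (tree_root d)"
| "tree_steps d N (Suc k) =
     tree_steps d N k \<union>
     (\<Union>\<tau> \<in> {\<tau>. fset \<tau> \<in> simplices (d - 1) (tree_steps d N k) \<and>
                at_distance d (tree_steps d N k) (tree_root d) k (fset \<tau>)}.
        \<Union>i<N \<tau>. faces (insert (Attached \<tau> i) (fset \<tau>)))"

definition poisson_tree :: "nat \<Rightarrow> (tree_vertex fset \<Rightarrow> nat) \<Rightarrow> tree_vertex rooted" where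
  "poisson_tree d N = (\<Union>k. tree_steps d N k, tree_root d)"

definition poisson_space :: "real \<Rightarrow> (tree_vertex fset \<Rightarrow> nat) measure" where
  "poisson_space c = PiM UNIV (\<lambda>_. measure_pmf (poisson_pmf c))"

end

theory Submission
  imports Defs "HOL-Real_Asymp.Real_Asymp"
begin

text \<open>
  Only the laws of balls matter, so the proof computes, for each finite ball \<open>T\<close> of a tree as it
  occurs in the limit, how many \<open>(d-1)\<close>-simplices of the random complex have a neighbourhood of
  this shape.

  Let \<open>T\<close> arise from the root by attaching \<open>j\<close> vertices altogether to \<open>m\<close> simplices \<open>t\<close>, with \<open>N t\<close>
  vertices for \<open>t\<close>. If independent coins are thrown for all vertex sets in advance
  (\<open>mrsc_eq_coins\<close>), then a given copy of \<open>T\<close> is contained in the complex with probability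
  \<open>q_param * r_param ^ j\<close>. Given this, each of the other vertices is independently attached to one of
  the \<open>m\<close> simplices with probability close to \<open>m * r_param\<close>, and the copy is exactly the ball if
  this happens to none of them and if its own vertices span no additional \<open>d\<close>-simplex. The latter
  requires a new edge (\<open>grow_missing_pair\<close>), which has vanishing probability. There are about
  \<open>n ^ (d + j) / (d! * (\<Prod>t. N t!))\<close> copies, provided that siblings are numbered in the order of their
  images. Since \<open>n * r_param\<close> tends to \<open>lam\<close>, the expected number of such balls is asymptotically
  \<open>(n ^ d * q_param / d!) * (\<Prod>t. exp (- lam) * lam ^ N t / N t!)\<close>. The first factor is the expected
  number of \<open>(d-1)\<close>-simplices, the second one is the probability that the Poisson tree has the
  ball \<open>T\<close>.

  The counts are concentrated by a second moment argument (\<open>hits_concentrate\<close>). Pairs of disjoint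
  copies are nearly independent. For pairs that meet in the image of a vertex set \<open>W\<close> the number of
  choices drops by \<open>n ^ card W\<close>, while the common faces are paid only once. As \<open>T\<close> can be taken apart
  vertex by vertex, each vertex having its remaining neighbours in a set of size at most \<open>d\<close>, the
  common faces have weight at least \<open>r_param ^ (card W - 1)\<close> (\<open>sub_weight_ge\<close>). So these pairs are
  negligible by a factor of order \<open>1 / n\<close>.

  Finally, a ball determines the tree and the ordered labelling (\<open>ordered_embedding_unique\<close>), so that
  the counts for different trees add up to at most the number of \<open>(d-1)\<close>-simplices. Finitely many
  trees carry almost all of the mass of the limit. Asymptotic lower bounds for their frequencies
  therefore leave no room for other balls, and for an arbitrary rooted complex \<open>H\<close> the limit follows by
  adding up the trees that are isomorphic to \<open>H\<close> (\<open>frequency_deterministic\<close>). The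
  normalisation is the case of radius \<open>0\<close>.
\<close>


section \<open>The Poisson tree and neighbourhoods in it\<close>

lemma simplices_pred:
  "d \<ge> 1 \<Longrightarrow> \<sigma> \<in> simplices (d - 1) X \<longleftrightarrow> \<sigma> \<in> X \<and> card \<sigma> = d"
  "d \<ge> 1 \<Longrightarrow> \<sigma> \<in> simplices (d - Suc 0) X \<longleftrightarrow> \<sigma> \<in> X \<and> card \<sigma> = d"
  by (auto simp: simplices_def)

lemma finite_faces: "finite \<sigma> \<Longrightarrow> finite (faces \<sigma>)"
  unfolding faces_def by (rule finite_subset[of _ "Pow \<sigma>"]) auto

lemma faces_image: "faces (f ` \<sigma>) = (`) f ` faces \<sigma>"
proof -
  have "\<exists>\<beta>\<subseteq>\<sigma>. \<beta> \<noteq> {} \<and> x = f ` \<beta>" if "x \<subseteq> f ` \<sigma>" "x \<noteq> {}" for x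
    using that by (metis image_is_empty subset_imageE)
  then show ?thesis by (auto simp: faces_def)
qed

lemma size_mem_Attached:
  assumes "v \<in> fset t"
  shows "size v < size (Attached t i)"
proof -
  have "size v < (\<Sum>u\<in>fset t. Suc (size u))"
    using member_le_sum[of v "fset t" "\<lambda>u. Suc (size u)"] assms by auto
  then show ?thesis by simp
qed

lemma Attached_notin [simp]: "Attached t i \<notin> fset t"
  using size_mem_Attached[of "Attached t i" t i] by auto

abbreviation cell :: "tree_vertex fset \<Rightarrow> nat \<Rightarrow> tree_vertex set" where
  "cell t i \<equiv> insert (Attached t i) (fset t)"

declare nbhd.simps(2) [simp del]

text \<open>The process that builds the tree attaches new vertices only to the simplices at distance exactly
\<open>k\<close>. Attaching at step \<open>k\<close> to every \<open>(d-1)\<close>-simplex present so far gives the same complexes,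
because the simplices that are closer to the root received the same vertices before. In this form
no distances occur, and membership unfolds to a single existential statement.\<close>

primrec grow :: "nat \<Rightarrow> (tree_vertex fset \<Rightarrow> nat) \<Rightarrow> nat \<Rightarrow> tree_vertex set set" where
  "grow d N 0 = faces (tree_root d)"
| "grow d N (Suc k) = grow d N k \<union>
     (\<Union>t\<in>{t. fset t \<in> simplices (d - 1) (grow d N k)}. \<Union>i<N t. faces (cell t i))"

declare grow.simps(2) [simp del]

text \<open>The \<open>(d-1)\<close>-simplices that receive their new vertices within the first \<open>r\<close> steps. The ball of
radius \<open>r\<close> depends on \<open>N\<close> only through its values on this finite set.\<close>

definition parents :: "nat \<Rightarrow> (tree_vertex fset \<Rightarrow> nat) \<Rightarrow> nat \<Rightarrow> tree_vertex fset set" where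
  "parents d N r = {t. \<exists>k<r. fset t \<in> simplices (d - 1) (grow d N k)}"

lemma grow_mono: "j \<le> k \<Longrightarrow> grow d N j \<subseteq> grow d N k"
  by (rule lift_Suc_mono_le[of "grow d N"]) (auto simp: grow.simps)

lemma parents_mono: "j \<le> k \<Longrightarrow> parents d N j \<subseteq> parents d N k"
  unfolding parents_def by (auto intro: less_le_trans)

lemma parents_Suc:
  "parents d N (Suc k) = {t. fset t \<in> simplices (d - 1) (grow d N k)}"
proof -
  have "simplices (d - 1) (grow d N j) \<subseteq> simplices (d - 1) (grow d N k)" if "j \<le> k" for j
    using grow_mono[OF that, of d N] by (auto simp: simplices_def)
  then show ?thesis unfolding parents_def by (auto simp: less_Suc_eq_le)
qed

lemma grow_iff:
  "\<alpha> \<in> grow d N r \<longleftrightarrow>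
     \<alpha> \<in> faces (tree_root d) \<or> (\<exists>t\<in>parents d N r. \<exists>i<N t. \<alpha> \<in> faces (cell t i))"
proof (induction r)
  case 0
  then show ?case by (simp add: parents_def)
next
  case (Suc r)
  have "parents d N r \<subseteq> parents d N (Suc r)" by (rule parents_mono) simp
  then show ?case using Suc by (auto simp: parents_Suc grow.simps)
qed

lemma parents_grow:
  assumes "d \<ge> 1" "t \<in> parents d N r"
  shows "fset t \<in> grow d N r" "card (fset t) = d"
proof -
  obtain k where "k < r" "fset t \<in> simplices (d - 1) (grow d N k)"
    using assms(2) by (auto simp: parents_def)
  then have "fset t \<in> grow d N k" "card (fset t) = d" "k \<le> r"
    using assms(1) by (simp_all add: simplices_pred)
  then show "fset t \<in> grow d N r" "card (fset t) = d"
    using grow_mono[of k r d N] by blast+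
qed

lemma finite_tree_root: "finite (tree_root d)" "card (tree_root d) = d"
  by (auto simp: tree_root_def card_image inj_on_def)

lemma grow_complex: "\<alpha> \<in> grow d N r \<Longrightarrow> finite \<alpha> \<and> \<alpha> \<noteq> {} \<and> (\<forall>\<beta>\<subseteq>\<alpha>. \<beta> \<noteq> {} \<longrightarrow> \<beta> \<in> grow d N r)"
proof -
  have face: "finite \<alpha> \<and> \<alpha> \<noteq> {} \<and> (\<forall>\<beta>\<subseteq>\<alpha>. \<beta> \<noteq> {} \<longrightarrow> \<beta> \<in> faces \<rho>)" if "\<alpha> \<in> faces \<rho>" "finite \<rho>"
    for \<alpha> \<rho> :: "tree_vertex set"
    using that by (auto simp: faces_def intro: finite_subset)
  show "\<alpha> \<in> grow d N r \<Longrightarrow> finite \<alpha> \<and> \<alpha> \<noteq> {} \<and> (\<forall>\<beta>\<subseteq>\<alpha>. \<beta> \<noteq> {} \<longrightarrow> \<beta> \<in> grow d N r)"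
    unfolding grow_iff using face[of \<alpha> "tree_root d"] face[of \<alpha> "cell t i" for t i] finite_tree_root(1)
    by (metis finite.insertI finite_fset)
qed

lemma finite_grow: "finite (grow d N r)"
proof (induction r)
  case 0
  then show ?case by (simp add: finite_faces finite_tree_root)
next
  case (Suc r)
  have "finite {t. fset t \<in> simplices (d - 1) (grow d N r)}"
    by (rule finite_subset[of _ "fset -` grow d N r"])
      (auto simp: simplices_def fset_inject intro!: finite_vimageI Suc injI)
  then show ?case using Suc by (auto simp: finite_faces grow.simps)
qed

lemma finite_parents: "finite (parents d N r)"
proof (cases r)
  case 0
  then show ?thesis by (simp add: parents_def)
next
  case (Suc k)
  show ?thesis unfolding Suc parents_Suc
    by (rule finite_subset[of _ "fset -` grow d N k"])
      (auto simp: simplices_def fset_inject intro!: finite_vimageI finite_grow injI)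
qed

lemma vertices_grow_sub: "\<alpha> \<in> grow d N r \<Longrightarrow> \<alpha> \<subseteq> vertices (grow d N r)"
  using grow_complex[of \<alpha> d N r] by (auto simp: vertices_def)

lemma vertices_grow:
  assumes "d \<ge> 1"
  shows "vertices (grow d N r) = tree_root d \<union> (\<Union>t\<in>parents d N r. Attached t ` {..<N t})"
proof (induction r rule: less_induct)
  case (less r)
  have "v \<in> tree_root d \<union> (\<Union>t\<in>parents d N r. Attached t ` {..<N t})" if v: "v \<in> vertices (grow d N r)" for v
  proof -
    have "{v} \<in> grow d N r" using v by (simp add: vertices_def)
    then consider "v \<in> tree_root d" | t i where "t \<in> parents d N r" "i < N t" "v = Attached t i"
      | t where "t \<in> parents d N r" "v \<in> fset t"
      unfolding grow_iff faces_def by blast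
    then show ?thesis
    proof cases
      case 3
      then obtain k where k: "k < r" "fset t \<in> grow d N k"
        using assms by (auto simp: parents_def simplices_pred)
      then have "v \<in> vertices (grow d N k)" using vertices_grow_sub 3(2) by blast
      then show ?thesis using less.IH[OF k(1)] parents_mono[of k r d N] k(1) by auto
    qed auto
  qed
  moreover have "{v} \<in> grow d N r" if "v \<in> tree_root d \<union> (\<Union>t\<in>parents d N r. Attached t ` {..<N t})" for v
    using that unfolding grow_iff faces_def by blast
  ultimately show ?case unfolding vertices_def by blast
qed

lemma finite_vertices_grow: "d \<ge> 1 \<Longrightarrow> finite (vertices (grow d N r))"
  unfolding vertices_grow by (auto simp: finite_parents finite_tree_root)

lemma Attached_vertex_iff:
  "d \<ge> 1 \<Longrightarrow> Attached t i \<in> vertices (grow d N r) \<longleftrightarrow> t \<in> parents d N r \<and> i < N t"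
  unfolding vertices_grow by (auto simp: tree_root_def)

lemma grow_card_Suc:
  assumes "d \<ge> 1" "\<rho> \<in> grow d N r" "card \<rho> = d + 1"
  obtains t i where "t \<in> parents d N r" "i < N t" "\<rho> = cell t i"
proof -
  have "\<rho> \<notin> faces (tree_root d)"
    using assms(3) card_mono[OF finite_tree_root(1), of \<rho> d] finite_tree_root(2) by (auto simp: faces_def)
  then obtain t i where ti: "t \<in> parents d N r" "i < N t" "\<rho> \<in> faces (cell t i)"
    using assms(2) grow_iff by blast
  have "card (cell t i) = d + 1"
    using parents_grow(2)[OF assms(1) ti(1)] by simp
  then have "\<rho> = cell t i"
    using ti(3) assms(3) by (intro card_subset_eq) (auto simp: faces_def)
  with ti show ?thesis using that by blast
qed

lemma cell_in_grow:
  "t \<in> parents d N r \<Longrightarrow> i < N t \<Longrightarrow> cell t i \<in> grow d N r"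
  unfolding grow_iff by (auto simp: faces_def)

lemma grow_card_le: "d \<ge> 1 \<Longrightarrow> \<alpha> \<in> grow d N r \<Longrightarrow> card \<alpha> \<le> d + 1"
  unfolding grow_iff
proof (elim disjE bexE exE conjE)
  assume "\<alpha> \<in> faces (tree_root d)"
  then show ?thesis using card_mono[OF finite_tree_root(1), of \<alpha> d] finite_tree_root(2) by (auto simp: faces_def)
next
  fix t i assume "d \<ge> 1" "t \<in> parents d N r" "\<alpha> \<in> faces (cell t i)"
  then show ?thesis using card_mono[of "cell t i" \<alpha>] parents_grow(2)[of d t N r] by (auto simp: faces_def)
qed

text \<open>Distances in the tree can be read off from the step of creation because of this property: a
\<open>d\<close>-simplex of the tree is the cell of some \<open>t\<close>, and a \<open>(d-1)\<close>-face of it either is \<open>t\<close> itself or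
contains the vertex that was attached to \<open>t\<close>. In the second case the face and the
cell are created together, in the first case the cell is created right after \<open>t\<close>.\<close>

lemma grow_closure:
  assumes d: "d \<ge> 1" and \<rho>: "\<rho> \<in> grow d N l" "card \<rho> = d + 1"
    and \<alpha>: "\<alpha> \<in> grow d N k" "card \<alpha> = d" "\<alpha> \<subseteq> \<rho>"
  shows "\<rho> \<in> grow d N (Suc k)"
proof -
  obtain t i where t: "t \<in> parents d N l" "i < N t" "\<rho> = cell t i"
    using grow_card_Suc[OF d \<rho>] .
  show ?thesis
  proof (cases "Attached t i \<in> \<alpha>")
    case True
    then have "t \<in> parents d N k"
      using vertices_grow_sub[OF \<alpha>(1)] Attached_vertex_iff[OF d, of t i N k] by auto
    then show ?thesis using cell_in_grow[of t d N k i] t grow_mono[of k "Suc k" d N] by auto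
  next
    case False
    then have "\<alpha> = fset t"
      using \<alpha> t parents_grow(2)[OF d t(1)] by (intro card_subset_eq) auto
    then have "t \<in> parents d N (Suc k)" using \<alpha> d by (simp add: parents_Suc simplices_pred)
    then show ?thesis using t cell_in_grow by blast
  qed
qed

text \<open>Adjacent \<open>(d-1)\<close>-simplices are created at most one step apart, so that a chain of \<open>j\<close> steps from
the root ends in a simplex which was created by step \<open>j\<close>.\<close>

lemma adjacency_path_grow:
  assumes d: "d \<ge> 1" and "(tree_root d, \<beta>) \<in> adjacency d (grow d N k) ^^ j"
  shows "\<beta> \<in> grow d N j"
  using assms(2)
proof (induction j arbitrary: \<beta>)
  case 0
  then show ?case using d finite_tree_root[of d] by (auto simp: faces_def)
next
  case (Suc j)
  then obtain \<alpha> where \<alpha>: "(tree_root d, \<alpha>) \<in> adjacency d (grow d N k) ^^ j"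
    "(\<alpha>, \<beta>) \<in> adjacency d (grow d N k)" by auto
  then obtain \<rho> where \<rho>: "\<rho> \<in> grow d N k" "card \<rho> = d + 1" "\<alpha> \<subseteq> \<rho>" "\<beta> \<subseteq> \<rho>"
    "card \<alpha> = d" "\<beta> \<in> grow d N k"
    using d by (auto simp: adjacency_def simplices_pred) (auto simp: simplices_def)
  then have "\<rho> \<in> grow d N (Suc j)" using grow_closure[OF d] Suc.IH[OF \<alpha>(1)] by blast
  moreover have "\<beta> \<noteq> {}" using grow_complex[OF \<rho>(6)] by blast
  ultimately show ?case using grow_complex[of \<rho> d N "Suc j"] \<rho>(4) by blast
qed

lemma adjacency_mono: "X \<subseteq> Y \<Longrightarrow> adjacency d X \<subseteq> adjacency d Y"
  unfolding adjacency_def simplices_def by blast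

lemma relpow_mono:
  fixes R S :: "('a \<times> 'a) set"
  shows "R \<subseteq> S \<Longrightarrow> R ^^ n \<subseteq> S ^^ n"
  by (induction n) (simp_all add: relcomp_mono)

lemma adjacency_path_exists:
  assumes d: "d \<ge> 1" and "\<beta> \<in> grow d N k" "card \<beta> = d" "\<forall>j<k. \<beta> \<notin> grow d N j"
  shows "(tree_root d, \<beta>) \<in> adjacency d (grow d N k) ^^ k"
  using assms(2-)
proof (induction k arbitrary: \<beta>)
  case 0
  then have "\<beta> = tree_root d"
    using finite_tree_root by (intro card_subset_eq) (auto simp: faces_def)
  then show ?case by simp
next
  case (Suc k)
  then obtain t i where t: "fset t \<in> grow d N k" "card (fset t) = d" "i < N t" "\<beta> \<in> faces (cell t i)"
    using d by (auto simp: simplices_pred grow.simps)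
  have new: "fset t \<notin> grow d N j" if "j < k" for j
  proof
    assume "fset t \<in> grow d N j"
    then have "\<beta> \<in> grow d N (Suc j)" using t(2-) d by (auto simp: simplices_pred grow.simps)
    with Suc.prems(3) that show False by auto
  qed
  have mono: "adjacency d (grow d N k) \<subseteq> adjacency d (grow d N (Suc k))"
    by (intro adjacency_mono grow_mono) simp
  have "(tree_root d, fset t) \<in> adjacency d (grow d N (Suc k)) ^^ k"
    using Suc.IH[OF t(1,2)] new relpow_mono[OF mono] by blast
  moreover have "(fset t, \<beta>) \<in> adjacency d (grow d N (Suc k))"
  proof -
    have "cell t i \<in> grow d N (Suc k)"
      using t d by (intro cell_in_grow) (simp_all add: parents_Suc simplices_pred)
    moreover have "card (cell t i) = d + 1" using t by simp
    moreover have "fset t \<in> grow d N (Suc k)" using t(1) grow_mono[of k "Suc k" d N] by auto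
    moreover have "\<beta> \<subseteq> cell t i" using t(4) by (simp add: faces_def)
    moreover have "\<exists>\<rho>\<in>simplices d (grow d N (Suc k)). fset t \<subseteq> \<rho> \<and> \<beta> \<subseteq> \<rho>"
      using calculation by (intro bexI[of _ "cell t i"]) (auto simp: simplices_def)
    ultimately show ?thesis using t(2) Suc.prems(1,2) d
      unfolding adjacency_def by (simp add: simplices_pred)
  qed
  ultimately show ?case by auto
qed

lemma tree_steps_eq_grow:
  assumes d: "d \<ge> 1"
  shows "tree_steps d N k = grow d N k"
proof (induction k)
  case 0
  then show ?case by simp
next
  case (Suc k)
  have "faces (cell t i) \<subseteq> grow d N k"
    if t: "fset t \<in> simplices (d - 1) (grow d N k)" "i < N t"
      "\<not> at_distance d (grow d N k) (tree_root d) k (fset t)" for t i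
  proof -
    have ft: "fset t \<in> grow d N k" "card (fset t) = d" using t(1) d by (simp_all add: simplices_pred)
    obtain j where j: "j < k" "fset t \<in> grow d N j"
    proof (rule ccontr)
      assume "\<not> thesis"
      then have new: "\<forall>j<k. fset t \<notin> grow d N j" using that by blast
      then have "\<forall>j<k. (tree_root d, fset t) \<notin> adjacency d (grow d N k) ^^ j"
        using adjacency_path_grow[OF d] by blast
      with adjacency_path_exists[OF d ft new] t(3) show False by (simp add: at_distance_def)
    qed
    then have "cell t i \<in> grow d N (Suc j)"
      using t ft(2) d by (intro cell_in_grow) (simp_all add: parents_Suc simplices_pred)
    then have "cell t i \<in> grow d N k" using grow_mono[of "Suc j" k d N] j by auto
    then show ?thesis using grow_complex unfolding faces_def by blast
  qed
  then have "(\<Union>i<N t. faces (cell t i)) \<subseteq> grow d N k \<union> (\<Union>t\<in>{t. fset t \<in> simplices (d - 1) (grow d N k) \<and>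
      at_distance d (grow d N k) (tree_root d) k (fset t)}. \<Union>i<N t. faces (cell t i))"
    if "fset t \<in> simplices (d - 1) (grow d N k)" for t
    using that by (cases "at_distance d (grow d N k) (tree_root d) k (fset t)") blast+
  then show ?case unfolding tree_steps.simps grow.simps Suc by blast
qed

lemma nbhd_Suc_iff:
  "d \<ge> 1 \<Longrightarrow> \<beta> \<in> nbhd d X \<sigma> (Suc k) \<longleftrightarrow> \<beta> \<in> nbhd d X \<sigma> k \<or>
     (\<exists>\<rho>\<in>simplices d X. \<rho> \<notin> nbhd d X \<sigma> k \<and>
        (\<exists>\<alpha>\<in>nbhd d X \<sigma> k. card \<alpha> = d \<and> \<alpha> \<subseteq> \<rho>) \<and> \<beta> \<in> faces \<rho>)"
  unfolding nbhd.simps Let_def Bex_def by (auto simp: simplices_pred)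

lemma nbhd_faces_closed:
  assumes d: "d \<ge> 1" and "\<alpha> \<in> nbhd d X \<sigma> k" "\<beta> \<subseteq> \<alpha>" "\<beta> \<noteq> {}"
  shows "\<beta> \<in> nbhd d X \<sigma> k"
  using assms(2-)
proof (induction k arbitrary: \<alpha>)
  case 0
  then show ?case by (auto simp: faces_def)
next
  case (Suc k)
  show ?case
  proof (cases "\<alpha> \<in> nbhd d X \<sigma> k")
    case True
    then have "\<beta> \<in> nbhd d X \<sigma> k" using Suc by blast
    then show ?thesis by (simp add: nbhd_Suc_iff[OF d])
  next
    case False
    have "\<beta> \<in> faces \<rho>" if "\<alpha> \<in> faces \<rho>" for \<rho> using that Suc.prems by (auto simp: faces_def)
    then show ?thesis using False Suc.prems(1) unfolding nbhd_Suc_iff[OF d] by blast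
  qed
qed

lemma nbhd_mono: "j \<le> k \<Longrightarrow> nbhd d X \<sigma> j \<subseteq> nbhd d X \<sigma> k"
  by (rule lift_Suc_mono_le[of "nbhd d X \<sigma>"]) (auto simp: nbhd.simps Let_def)

lemma nbhd_step:
  assumes d: "d \<ge> 1" and "\<alpha> \<in> nbhd d X \<sigma> k" "card \<alpha> = d" "\<alpha> \<subseteq> \<rho>" "\<rho> \<in> simplices d X" "\<beta> \<in> faces \<rho>"
  shows "\<beta> \<in> nbhd d X \<sigma> (Suc k)"
proof (cases "\<rho> \<in> nbhd d X \<sigma> k")
  case True
  then have "\<beta> \<in> nbhd d X \<sigma> k" using nbhd_faces_closed[OF d True, of \<beta>] assms(6) by (simp add: faces_def)
  then show ?thesis using nbhd_mono[of k "Suc k" d X \<sigma>] by auto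
next
  case False
  with assms show ?thesis unfolding nbhd_Suc_iff[OF d] by blast
qed

lemma grow_subset_nbhd:
  assumes d: "d \<ge> 1" and inj: "inj_on \<phi> (vertices (grow d N r))"
    and sub: "(`) \<phi> ` grow d N r \<subseteq> X" and k: "k \<le> r"
  shows "(`) \<phi> ` grow d N k \<subseteq> nbhd d X (\<phi> ` tree_root d) k"
  using k
proof (induction k)
  case 0
  then show ?case by (auto simp: faces_def)
next
  case (Suc k)
  then have IH: "(`) \<phi> ` grow d N k \<subseteq> nbhd d X (\<phi> ` tree_root d) k" by simp
  show ?case
  proof (rule image_subsetI)
    fix \<alpha> assume \<alpha>: "\<alpha> \<in> grow d N (Suc k)"
    show "\<phi> ` \<alpha> \<in> nbhd d X (\<phi> ` tree_root d) (Suc k)"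
    proof (cases "\<alpha> \<in> grow d N k")
      case True
      then have "\<phi> ` \<alpha> \<in> nbhd d X (\<phi> ` tree_root d) k" using IH by auto
      then show ?thesis using nbhd_mono[of k "Suc k" d X "\<phi> ` tree_root d"] by auto
    next
      case False
      then obtain t i where t: "fset t \<in> grow d N k" "card (fset t) = d" "i < N t" "\<alpha> \<in> faces (cell t i)"
        using \<alpha> d by (auto simp: simplices_pred grow.simps)
      have c: "cell t i \<in> grow d N r"
        using cell_in_grow[of t d N "Suc k" i] t d grow_mono[OF Suc.prems, of d N]
        by (auto simp: parents_Suc simplices_pred)
      have I: "inj_on \<phi> (cell t i)" by (rule inj_on_subset[OF inj vertices_grow_sub[OF c]])
      have "card (\<phi> ` cell t i) = d + 1" using card_image[OF I] t by simp
      moreover have "card (\<phi> ` fset t) = d" using card_image[OF inj_on_subset[OF I], of "fset t"] t by auto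
      moreover have "\<phi> ` \<alpha> \<in> faces (\<phi> ` cell t i)" using t(4) by (auto simp: faces_def)
      moreover have "\<phi> ` cell t i \<in> X" using c sub by blast
      moreover have "\<phi> ` fset t \<in> nbhd d X (\<phi> ` tree_root d) k" using IH t(1) by blast
      ultimately show ?thesis
        by (intro nbhd_step[OF d, of "\<phi> ` fset t" X _ k "\<phi> ` cell t i"])
          (simp_all add: simplices_def subset_insertI)
    qed
  qed
qed

text \<open>A copy of the tree is the whole neighbourhood as soon as no further \<open>d\<close>-simplex touches it along a
\<open>(d-1)\<close>-simplex that is not on the boundary. This is the event whose probability is computed below:
it consists of finitely many conditions on the presence and absence of faces, without any reference
to the exploration step by step.\<close>

lemma nbhd_eq_image_iff:
  assumes d: "d \<ge> 1" and inj: "inj_on \<phi> (vertices (grow d N r))"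
    and sub: "(`) \<phi> ` grow d N r \<subseteq> X"
  shows "nbhd d X (\<phi> ` tree_root d) r = (`) \<phi> ` grow d N r \<longleftrightarrow>
    (\<forall>\<rho>\<in>simplices d X. \<forall>t\<in>parents d N r. \<phi> ` fset t \<subseteq> \<rho> \<longrightarrow> \<rho> \<in> (`) \<phi> ` grow d N r)"
    (is "?L \<longleftrightarrow> ?R")
proof
  assume L: ?L
  show ?R
  proof (intro ballI impI)
    fix \<rho> t assume \<rho>: "\<rho> \<in> simplices d X" and t: "t \<in> parents d N r" and s: "\<phi> ` fset t \<subseteq> \<rho>"
    obtain k where k: "k < r" "fset t \<in> grow d N k" "card (fset t) = d"
      using t d by (auto simp: parents_def simplices_pred)
    have "\<phi> ` fset t \<in> nbhd d X (\<phi> ` tree_root d) k"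
      using grow_subset_nbhd[OF d inj sub, of k] k by (meson image_eqI less_imp_le subsetD)
    moreover have "inj_on \<phi> (fset t)"
      using inj_on_subset[OF inj] vertices_grow_sub parents_grow(1)[OF d t] by blast
    then have "card (\<phi> ` fset t) = d" using k by (simp add: card_image)
    moreover have "\<rho> \<in> faces \<rho>" using \<rho> by (auto simp: faces_def simplices_def)
    ultimately have "\<rho> \<in> nbhd d X (\<phi> ` tree_root d) (Suc k)"
      using nbhd_step[OF d _ _ s \<rho>] by blast
    moreover have "nbhd d X (\<phi> ` tree_root d) (Suc k) \<subseteq> nbhd d X (\<phi> ` tree_root d) r"
      using k(1) by (intro nbhd_mono) simp
    ultimately show "\<rho> \<in> (`) \<phi> ` grow d N r" using L by blast
  qed
next
  assume R: ?R
  have "nbhd d X (\<phi> ` tree_root d) k = (`) \<phi> ` grow d N k" if "k \<le> r" for k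
    using that
  proof (induction k)
    case 0
    show ?case by (simp add: faces_image)
  next
    case (Suc k)
    then have IH: "nbhd d X (\<phi> ` tree_root d) k = (`) \<phi> ` grow d N k" and kr: "k < r" by auto
    have "x \<in> (`) \<phi> ` grow d N (Suc k)" if x: "x \<in> nbhd d X (\<phi> ` tree_root d) (Suc k)" for x
    proof (cases "x \<in> (`) \<phi> ` grow d N k")
      case True
      then show ?thesis using grow_mono[of k "Suc k" d N] by auto
    next
      case False
      with x obtain \<rho> \<alpha> where \<rho>: "\<rho> \<in> simplices d X" "x \<in> faces \<rho>" "\<alpha> \<in> grow d N k"
        "card (\<phi> ` \<alpha>) = d" "\<phi> ` \<alpha> \<subseteq> \<rho>"
        unfolding nbhd_Suc_iff[OF d] IH by blast
      have \<alpha>V: "\<alpha> \<subseteq> vertices (grow d N r)"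
        using vertices_grow_sub \<rho>(3) grow_mono[of k r d N] kr by fastforce
      then have c\<alpha>: "card \<alpha> = d" using \<rho>(4) inj card_image inj_on_subset by metis
      have "finite \<alpha>" using \<rho>(3) grow_complex by blast
      then obtain t where t: "\<alpha> = fset t" by (metis Abs_fset_inverse CollectI)
      have "t \<in> parents d N r"
        using \<rho>(3) c\<alpha> kr t d by (auto simp: parents_def simplices_pred)
      then obtain \<rho>' where \<rho>': "\<rho>' \<in> grow d N r" "\<rho> = \<phi> ` \<rho>'" using R \<rho> t by blast
      have \<rho>'V: "\<rho>' \<subseteq> vertices (grow d N r)" using vertices_grow_sub \<rho>'(1) by blast
      have "card \<rho>' = d + 1" using \<rho>(1) \<rho>'(2) card_image inj_on_subset[OF inj \<rho>'V]
        by (fastforce simp: simplices_def)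
      moreover have "\<alpha> \<subseteq> \<rho>'" using \<rho>(5) \<rho>'(2) inj \<alpha>V \<rho>'V by (simp add: inj_on_image_subset_iff)
      ultimately have "\<rho>' \<in> grow d N (Suc k)" using grow_closure[OF d \<rho>'(1)] \<rho>(3) c\<alpha> by blast
      moreover obtain \<beta> where "\<beta> \<subseteq> \<rho>'" "x = \<phi> ` \<beta>" "\<beta> \<noteq> {}"
      proof -
        have "x \<subseteq> \<phi> ` \<rho>'" "x \<noteq> {}" using \<rho>(2) \<rho>'(2) by (simp_all add: faces_def)
        then show ?thesis using that by (metis image_is_empty subset_imageE)
      qed
      ultimately show ?thesis using grow_complex by blast
    qed
    then show ?case using grow_subset_nbhd[OF d inj sub, of "Suc k"] Suc.prems by blast
  qed
  then show ?L by simp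
qed

lemma rooted_nbhd_poisson_tree:
  assumes d: "d \<ge> 1"
  shows "rooted_nbhd d (poisson_tree d N) r = (grow d N r, tree_root d)"
proof -
  let ?X = "\<Union>k. grow d N k"
  have "\<rho> \<in> grow d N r"
    if h: "\<rho> \<in> simplices d ?X" "t \<in> parents d N r" "fset t \<subseteq> \<rho>" for \<rho> t
  proof -
    obtain k where k: "k < r" "fset t \<in> grow d N k" "card (fset t) = d"
      using h(2) d by (auto simp: parents_def simplices_pred)
    then have "\<rho> \<in> grow d N (Suc k)"
      using h(1,3) grow_closure[OF d] by (auto simp: simplices_def)
    then show ?thesis using grow_mono[of "Suc k" r d N] k by auto
  qed
  then have "nbhd d ?X (id ` tree_root d) r = (`) id ` grow d N r"
    by (subst nbhd_eq_image_iff[OF d]) auto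
  then show ?thesis by (simp add: rooted_nbhd_def poisson_tree_def tree_steps_eq_grow[OF d])
qed

section \<open>The shape of the trees\<close>

text \<open>Every simplex lies in the root or in a cell, and a cell without its new vertex was created at an
earlier step. So no edges arise except those between a new vertex and the simplex it is attached to.\<close>

lemma grow_pair:
  assumes d: "d \<ge> 1" and "\<alpha> \<in> grow d N r" "u \<in> \<alpha>" "x \<in> \<alpha>" "u \<noteq> x"
  shows "(u \<in> tree_root d \<and> x \<in> tree_root d) \<or> (\<exists>t i. u = Attached t i \<and> x \<in> fset t) \<or>
     (\<exists>t i. x = Attached t i \<and> u \<in> fset t)"
  using assms(2-)
proof (induction r arbitrary: \<alpha> rule: less_induct)
  case (less r)
  consider "\<alpha> \<subseteq> tree_root d" | t i where "t \<in> parents d N r" "\<alpha> \<subseteq> cell t i"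
    using less.prems(1) unfolding grow_iff faces_def by blast
  then show ?case
  proof cases
    case 2
    then obtain k where k: "k < r" "fset t \<in> grow d N k"
      using d by (auto simp: parents_def simplices_pred)
    show ?thesis
    proof (cases "u = Attached t i \<or> x = Attached t i")
      case True
      then show ?thesis using less.prems 2 by blast
    next
      case False
      then have "u \<in> fset t" "x \<in> fset t" using less.prems 2 by auto
      then show ?thesis using less.IH[OF k] less.prems(4) by blast
    qed
  qed (use less.prems in blast)
qed

text \<open>A set of vertices that leaves the root has a youngest vertex. By the previous lemma all its neighbours
within the set belong to the single simplex to which it was attached. Youngest is taken in the sense
of the size of the term, which is larger than the sizes of the members of that simplex.\<close>

lemma grow_top:
  assumes d: "d \<ge> 1" and W: "W \<subseteq> vertices (grow d N r)" "\<not> W \<subseteq> tree_root d"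
  obtains t i where "Attached t i \<in> W" "t \<in> parents d N r" "i < N t"
    "\<And>\<alpha>. \<alpha> \<in> grow d N r \<Longrightarrow> Attached t i \<in> \<alpha> \<Longrightarrow> \<alpha> \<subseteq> W \<Longrightarrow> \<alpha> - {Attached t i} \<subseteq> fset t"
proof -
  \<comment> \<open>For a member of the root, \<open>size\<close> says nothing about attachment; hence the root is removed first.\<close>
  let ?A = "W - tree_root d"
  have fin: "finite ?A" using finite_subset[OF W(1) finite_vertices_grow[OF d]] by simp
  have ne: "?A \<noteq> {}" using W(2) by blast
  define s where "s = Max (size ` ?A)"
  have "s \<in> size ` ?A" unfolding s_def by (intro Max_in) (use fin ne in auto)
  then obtain x where x: "x \<in> ?A" "size x = s" by blast
  have x_max: "size y \<le> size x" if "y \<in> ?A" for y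
    unfolding x(2) s_def by (rule Max_ge) (use fin that in auto)
  obtain t i where ti: "x = Attached t i" "t \<in> parents d N r" "i < N t"
    using x(1) W(1) vertices_grow[OF d, of N r] by blast
  have "u \<in> fset t" if h: "\<alpha> \<in> grow d N r" "Attached t i \<in> \<alpha>" "\<alpha> \<subseteq> W" "u \<in> \<alpha>" "u \<noteq> Attached t i" for \<alpha> u
  proof -
    consider "Attached t i \<in> tree_root d" | t' i' where "u = Attached t' i'" "Attached t i \<in> fset t'"
      | "u \<in> fset t"
      using grow_pair[OF d h(1,4,2,5)] by blast
    then show ?thesis
    proof cases
      case 2
      have "size x < size u" using size_mem_Attached[OF 2(2)] 2(1) ti(1) by simp
      moreover have "u \<in> ?A" using h(3,4) 2(1) by (auto simp: tree_root_def)
      ultimately show ?thesis using x_max[of u] by linarith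
    qed (auto simp: tree_root_def)
  qed
  then show ?thesis using that x(1) ti by blast
qed

text \<open>This is the \<open>d\<close>-degeneracy of the tree, witnessed by the youngest vertex of \<open>W\<close>, or by any vertex
if \<open>W\<close> lies in the root. Removing such vertices one after the other bounds the weight of every
part of the tree from below.\<close>

lemma grow_degenerate:
  assumes d: "d \<ge> 1" and W: "W \<subseteq> vertices (grow d N r)" "W \<noteq> {}"
  obtains x Y where "x \<in> W" "finite Y" "card Y \<le> d" "x \<notin> Y"
    "\<And>\<alpha>. \<alpha> \<in> grow d N r \<Longrightarrow> x \<in> \<alpha> \<Longrightarrow> \<alpha> \<subseteq> W \<Longrightarrow> \<alpha> - {x} \<subseteq> Y"
proof (cases "W \<subseteq> tree_root d")
  case True
  obtain x where "x \<in> W" using W(2) by blast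
  then show ?thesis
    using that[of x "tree_root d - {x}"] True finite_tree_root[of d] card_mono[of "tree_root d" "tree_root d - {x}"]
    by auto
next
  case False
  obtain t i where "Attached t i \<in> W" "t \<in> parents d N r"
    "\<And>\<alpha>. \<alpha> \<in> grow d N r \<Longrightarrow> Attached t i \<in> \<alpha> \<Longrightarrow> \<alpha> \<subseteq> W \<Longrightarrow> \<alpha> - {Attached t i} \<subseteq> fset t"
    using grow_top[OF d W(1) False] by metis
  then show ?thesis using that[of "Attached t i" "fset t"] parents_grow(2)[OF d, of t N r] by auto
qed

text \<open>An additional \<open>d\<close>-simplex on the vertices of the tree needs a new edge. The youngest vertex of the
simplex would otherwise be joined to \<open>d\<close> vertices of the simplex to which it was attached, and the
\<open>d\<close>-simplex would be its cell. So all faces over this edge have to be added, which is what makes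
additional simplices improbable.\<close>

lemma grow_missing_pair:
  assumes d: "d \<ge> 1" and \<rho>: "\<rho> \<subseteq> vertices (grow d N r)" "card \<rho> = d + 1" "\<rho> \<notin> grow d N r"
  obtains x u where "x \<in> \<rho>" "u \<in> \<rho>" "x \<noteq> u" "\<And>\<alpha>. \<alpha> \<in> grow d N r \<Longrightarrow> x \<in> \<alpha> \<Longrightarrow> u \<notin> \<alpha>"
proof -
  have "\<not> \<rho> \<subseteq> tree_root d"
    using card_mono[OF finite_tree_root(1), of \<rho> d] finite_tree_root(2)[of d] \<rho>(2) by auto
  then obtain t i where t: "Attached t i \<in> \<rho>" "t \<in> parents d N r" "i < N t"
    "\<And>\<alpha>. \<alpha> \<in> grow d N r \<Longrightarrow> Attached t i \<in> \<alpha> \<Longrightarrow> \<alpha> \<subseteq> \<rho> \<Longrightarrow> \<alpha> - {Attached t i} \<subseteq> fset t"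
    using grow_top[OF d \<rho>(1)] by metis
  have "\<not> \<rho> - {Attached t i} \<subseteq> fset t"
  proof
    assume "\<rho> - {Attached t i} \<subseteq> fset t"
    moreover have "card (\<rho> - {Attached t i}) = card (fset t)"
      using t(1) \<rho>(2) parents_grow(2)[OF d t(2)] by simp
    ultimately have "\<rho> - {Attached t i} = fset t" by (intro card_subset_eq) auto
    then have "\<rho> = cell t i" using t(1) by blast
    then show False using cell_in_grow[of t d N r i] t \<rho>(3) by simp
  qed
  then obtain u where u: "u \<in> \<rho>" "u \<noteq> Attached t i" "u \<notin> fset t" by blast
  have "u \<notin> \<alpha>" if h: "\<alpha> \<in> grow d N r" "Attached t i \<in> \<alpha>" for \<alpha>
  proof
    assume "u \<in> \<alpha>"
    then have "{u, Attached t i} \<subseteq> \<alpha>" using h(2) by simp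
    then have "{u, Attached t i} \<in> grow d N r" using grow_complex[OF h(1)] by blast
    then show False using t(4)[of "{u, Attached t i}"] u t(1) by auto
  qed
  then show ?thesis using that[of "Attached t i" u] t(1) u by auto
qed

lemma grow_decomp:
  assumes d: "d \<ge> 1"
  shows "grow d N r = faces (tree_root d) \<union>
    (\<Union>(t, i)\<in>Sigma (parents d N r) (\<lambda>t. {..<N t}). insert (Attached t i) ` Pow (fset t))" (is "_ = ?R")
proof (intro set_eqI iffI)
  fix \<alpha> assume \<alpha>: "\<alpha> \<in> grow d N r"
  show "\<alpha> \<in> ?R"
  proof (cases "\<alpha> \<subseteq> tree_root d")
    case True
    then show ?thesis using grow_complex[OF \<alpha>] by (simp add: faces_def)
  next
    case False
    obtain t i where t: "Attached t i \<in> \<alpha>" "t \<in> parents d N r" "i < N t"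
      "\<And>\<beta>. \<beta> \<in> grow d N r \<Longrightarrow> Attached t i \<in> \<beta> \<Longrightarrow> \<beta> \<subseteq> \<alpha> \<Longrightarrow> \<beta> - {Attached t i} \<subseteq> fset t"
      using grow_top[OF d vertices_grow_sub[OF \<alpha>] False] by metis
    have "\<alpha> = insert (Attached t i) (\<alpha> - {Attached t i})" using t(1) by blast
    moreover have "\<alpha> - {Attached t i} \<in> Pow (fset t)" using t(4)[OF \<alpha> t(1)] by simp
    ultimately show ?thesis using t(2,3) by blast
  qed
next
  fix \<alpha> assume "\<alpha> \<in> ?R"
  then show "\<alpha> \<in> grow d N r" unfolding grow_iff faces_def by fastforce
qed

text \<open>Each face outside the root contains a unique youngest vertex \<open>Attached t i\<close> and is determined by it
together with a subset of \<open>t\<close>.\<close>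

lemma prod_grow:
  fixes w :: "nat \<Rightarrow> real"
  assumes d: "d \<ge> 1"
  shows "(\<Prod>\<alpha>\<in>grow d N r. w (card \<alpha>)) = (\<Prod>\<alpha>\<in>faces (tree_root d). w (card \<alpha>)) *
    (\<Prod>t\<in>parents d N r. (\<Prod>\<beta>\<in>Pow (fset t). w (Suc (card \<beta>))) ^ N t)"
proof -
  let ?S = "Sigma (parents d N r) (\<lambda>t. {..<N t})"
  let ?B = "\<lambda>(t, i). insert (Attached t i) ` Pow (fset t)"
  have disj: "?B x \<inter> ?B y = {}" if "x \<noteq> y" for x y
  proof (rule ccontr)
    assume "?B x \<inter> ?B y \<noteq> {}"
    then obtain \<gamma> where \<gamma>: "\<gamma> \<in> ?B x" "\<gamma> \<in> ?B y" by blast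
    obtain t i t' i' where xy: "x = (t, i)" "y = (t', i')" by (cases x; cases y) blast
    have "Attached t i \<noteq> Attached t' i'" using that xy by auto
    then have "Attached t i \<in> fset t'" "Attached t' i' \<in> fset t" using \<gamma> unfolding xy by auto
    then show False using size_mem_Attached[of "Attached t i" t' i'] size_mem_Attached[of "Attached t' i'" t i] by simp
  qed
  have "(\<Prod>\<alpha>\<in>grow d N r. w (card \<alpha>)) =
     (\<Prod>\<alpha>\<in>faces (tree_root d). w (card \<alpha>)) * (\<Prod>\<alpha>\<in>(\<Union>x\<in>?S. ?B x). w (card \<alpha>))"
    unfolding grow_decomp[OF d]
    by (rule prod.union_disjoint)
      (auto simp: finite_faces finite_tree_root finite_parents faces_def tree_root_def intro!: finite_SigmaI)
  also have "(\<Prod>\<alpha>\<in>(\<Union>x\<in>?S. ?B x). w (card \<alpha>)) = (\<Prod>x\<in>?S. \<Prod>\<alpha>\<in>?B x. w (card \<alpha>))"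
    using disj by (intro prod.UNION_disjoint) (auto simp: finite_parents intro!: finite_SigmaI)
  also have "\<dots> = (\<Prod>x\<in>?S. \<Prod>\<beta>\<in>Pow (fset (fst x)). w (Suc (card \<beta>)))"
  proof (rule prod.cong[OF refl])
    fix x assume "x \<in> ?S"
    obtain t i where x: "x = (t, i)" by (cases x)
    have n: "Attached t i \<notin> \<beta>" if "\<beta> \<in> Pow (fset t)" for \<beta> using that Attached_notin by blast
    have "inj_on (insert (Attached t i)) (Pow (fset t))"
      by (rule inj_onI) (use n in \<open>metis insert_ident\<close>)
    then have "(\<Prod>\<alpha>\<in>?B x. w (card \<alpha>)) = (\<Prod>\<beta>\<in>Pow (fset t). w (card (insert (Attached t i) \<beta>)))"
      by (simp add: x prod.reindex)
    also have "\<dots> = (\<Prod>\<beta>\<in>Pow (fset t). w (Suc (card \<beta>)))"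
      by (intro prod.cong refl arg_cong[where f = w] card_insert_disjoint) (use n in \<open>auto intro: finite_subset\<close>)
    finally show "(\<Prod>\<alpha>\<in>?B x. w (card \<alpha>)) = (\<Prod>\<beta>\<in>Pow (fset (fst x)). w (Suc (card \<beta>)))"
      by (simp add: x)
  qed
  also have "\<dots> = (\<Prod>t\<in>parents d N r. \<Prod>i<N t. \<Prod>\<beta>\<in>Pow (fset t). w (Suc (card \<beta>)))"
    by (subst prod.Sigma) (auto simp: finite_parents case_prod_unfold)
  also have "\<dots> = (\<Prod>t\<in>parents d N r. (\<Prod>\<beta>\<in>Pow (fset t). w (Suc (card \<beta>))) ^ N t)"
    by simp
  finally show ?thesis .
qed

lemma card_vertices_grow:
  assumes d: "d \<ge> 1"
  shows "card (vertices (grow d N r)) = d + (\<Sum>t\<in>parents d N r. N t)"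
proof -
  have "card (vertices (grow d N r)) = card (tree_root d) + card (\<Union>t\<in>parents d N r. Attached t ` {..<N t})"
    unfolding vertices_grow[OF d]
    by (rule card_Un_disjoint) (auto simp: finite_tree_root finite_parents tree_root_def)
  also have "card (\<Union>t\<in>parents d N r. Attached t ` {..<N t}) = (\<Sum>t\<in>parents d N r. card (Attached t ` {..<N t}))"
    by (rule card_UN_disjoint) (auto simp: finite_parents)
  also have "\<dots> = (\<Sum>t\<in>parents d N r. N t)"
    by (intro sum.cong refl) (simp add: card_image inj_on_def)
  finally show ?thesis by (simp add: finite_tree_root)
qed

lemma grow_cong:
  assumes "\<And>t. t \<in> parents d N r \<Longrightarrow> M t = N t"
  shows "grow d M r = grow d N r" "parents d M r = parents d N r"
proof -
  have *: "grow d M k = grow d N k \<and> parents d M k = parents d N k" if "k \<le> r" for k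
    using that
  proof (induction k)
    case 0
    then show ?case by (simp add: parents_def)
  next
    case (Suc k)
    then have I: "parents d M (Suc k) = parents d N (Suc k)" by (simp add: parents_Suc)
    moreover have "M t = N t" if "t \<in> parents d N (Suc k)" for t
      using assms parents_mono[OF Suc.prems, of d N] that by blast
    ultimately have "grow d M (Suc k) = grow d N (Suc k)"
      by (intro set_eqI) (simp add: grow_iff cong: bex_cong)
    with I show ?case by simp
  qed
  from *[of r] show "grow d M r = grow d N r" "parents d M r = parents d N r" by simp_all
qed

lemma grow_eq_imp:
  assumes d: "d \<ge> 1" and eq: "grow d M r = grow d N r" and t: "t \<in> parents d N r"
  shows "M t = N t"
proof -
  have N: "M t = N t" if "t \<in> parents d N r" "t \<in> parents d M r" for t
  proof -
    have "i < M t \<longleftrightarrow> i < N t" for i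
      using Attached_vertex_iff[OF d, of t i M r] Attached_vertex_iff[OF d, of t i N r] that eq by simp
    then show ?thesis by (meson linorder_neqE_nat less_irrefl)
  qed
  have "parents d M k = parents d N k" if "k \<le> r" for k
    using that
  proof (induction k)
    case 0
    then show ?case by (simp add: parents_def)
  next
    case (Suc k)
    then have I: "parents d M k = parents d N k" by simp
    have "M t = N t" if "t \<in> parents d N k" for t
      using N parents_mono[of k r d N] parents_mono[of k r d M] that I Suc.prems by auto
    from grow_cong(1)[OF this] show ?case by (simp add: parents_Suc)
  qed
  then show ?thesis using N t by blast
qed

lemma strict_mono_enum_unique:
  fixes f g :: "nat \<Rightarrow> nat"
  assumes "\<And>i j. i < j \<Longrightarrow> j < m \<Longrightarrow> f i < f j" "\<And>i j. i < j \<Longrightarrow> j < m' \<Longrightarrow> g i < g j"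
    and "f ` {..<m} = g ` {..<m'}"
  shows "m = m'" "\<And>i. i < m \<Longrightarrow> f i = g i"
proof -
  have "sorted_wrt (<) (map f [0..<m])" "sorted_wrt (<) (map g [0..<m'])"
    using assms(1,2) by (auto simp: sorted_wrt_iff_nth_less)
  moreover have "set (map f [0..<m]) = set (map g [0..<m'])"
    using assms(3) by (simp add: atLeast0LessThan)
  ultimately have eq: "map f [0..<m] = map g [0..<m']"
    by (metis strict_sorted_equal)
  then have "length (map f [0..<m]) = length (map g [0..<m'])" by (rule arg_cong)
  then show m: "m = m'" by simp
  show "f i = g i" if "i < m" for i
    using arg_cong[OF eq, of "\<lambda>xs. xs ! i"] that m by simp
qed

text \<open>The orderings fix one labelling of each tree-like ball: the vertices of the root, and the vertices
attached to a common simplex, are numbered in the order of their images. The number of such maps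
then carries the factor \<open>1 / N t!\<close> of the Poisson weight for every \<open>t\<close>.\<close>

definition ordered_embedding :: "nat \<Rightarrow> (tree_vertex fset \<Rightarrow> nat) \<Rightarrow> nat \<Rightarrow> (tree_vertex \<Rightarrow> nat) \<Rightarrow> bool" where
  "ordered_embedding d N r \<phi> \<longleftrightarrow> inj_on \<phi> (vertices (grow d N r)) \<and>
     (\<forall>i j. i < j \<and> j < d \<longrightarrow> \<phi> (Base i) < \<phi> (Base j)) \<and>
     (\<forall>t\<in>parents d N r. \<forall>i j. i < j \<and> j < N t \<longrightarrow> \<phi> (Attached t i) < \<phi> (Attached t j))"

text \<open>A cell around \<open>t\<close> whose new vertex was not attached to \<open>t\<close> has this vertex in \<open>t\<close>, and is
therefore not younger than \<open>t\<close>. So the vertices attached to \<open>t\<close> are recognisable from the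
image of the tree, without knowledge of the labelling.\<close>

lemma new_vertices_image:
  assumes d: "d \<ge> 1" and inj: "inj_on \<phi> (vertices (grow d N r))" and k: "k < r"
    and t: "t \<in> parents d N (Suc k)" "t \<notin> parents d N k"
  shows "\<phi> ` Attached t ` {..<N t} =
    {w. w \<notin> \<phi> ` vertices (grow d N k) \<and> insert w (\<phi> ` fset t) \<in> (`) \<phi> ` grow d N r}"
proof (intro set_eqI iffI)
  have Vk: "vertices (grow d N k) \<subseteq> vertices (grow d N r)"
    using grow_mono[of k r d N] k by (auto simp: vertices_def)
  have tr: "t \<in> parents d N r" using t(1) parents_mono[of "Suc k" r d N] k by auto
  have tk: "fset t \<in> grow d N k" "card (fset t) = d" using t(1) d by (simp_all add: parents_Suc simplices_pred)
  {
    fix w assume "w \<in> \<phi> ` Attached t ` {..<N t}"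
    then obtain i where i: "i < N t" "w = \<phi> (Attached t i)" by blast
    have "Attached t i \<notin> vertices (grow d N k)" "Attached t i \<in> vertices (grow d N r)"
      using Attached_vertex_iff[OF d] t(2) tr i(1) by blast+
    then have "w \<notin> \<phi> ` vertices (grow d N k)" using inj Vk i(2) by (auto simp: inj_on_def)
    moreover have "insert w (\<phi> ` fset t) = \<phi> ` cell t i" using i(2) by simp
    ultimately show "w \<in> {w. w \<notin> \<phi> ` vertices (grow d N k) \<and> insert w (\<phi> ` fset t) \<in> (`) \<phi> ` grow d N r}"
      using cell_in_grow[of t d N r i, OF tr i(1)] by blast
  next
    fix w assume "w \<in> {w. w \<notin> \<phi> ` vertices (grow d N k) \<and> insert w (\<phi> ` fset t) \<in> (`) \<phi> ` grow d N r}"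
    then obtain \<rho> where \<rho>: "w \<notin> \<phi> ` vertices (grow d N k)" "\<rho> \<in> grow d N r" "insert w (\<phi> ` fset t) = \<phi> ` \<rho>" by blast
    then obtain v where v: "v \<in> \<rho>" "w = \<phi> v" by blast
    have \<rho>V: "\<rho> \<subseteq> vertices (grow d N r)" using vertices_grow_sub \<rho>(2) by blast
    have tV: "fset t \<subseteq> vertices (grow d N k)" using vertices_grow_sub tk(1) by blast
    have "\<phi> ` (insert v (fset t)) = \<phi> ` \<rho>" using \<rho>(3) v(2) by simp
    then have \<rho>_eq: "\<rho> = insert v (fset t)"
      using inj_on_image_eq_iff[OF inj, of "insert v (fset t)" \<rho>] \<rho>V tV Vk v(1) by blast
    have "v \<notin> vertices (grow d N k)" using \<rho>(1) v(2) by blast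
    then have "v \<notin> fset t" using tV by blast
    then have "card \<rho> = d + 1" using \<rho>_eq tk(2) by simp
    then obtain t0 i where t0: "t0 \<in> parents d N r" "i < N t0" "\<rho> = cell t0 i"
      using grow_card_Suc[OF d \<rho>(2)] by blast
    have "v = Attached t0 i"
    proof (rule ccontr)
      assume "v \<noteq> Attached t0 i"
      moreover have "v \<in> cell t0 i" "Attached t0 i \<in> insert v (fset t)" using \<rho>_eq t0(3) by blast+
      ultimately have "v \<in> fset t0" "Attached t0 i \<in> fset t" by auto
      then have "t0 \<in> parents d N k" using tV Attached_vertex_iff[OF d] by blast
      then have "fset t0 \<subseteq> vertices (grow d N k)" using parents_grow(1)[OF d] vertices_grow_sub by blast
      then show False using \<open>v \<in> fset t0\<close> \<open>v \<notin> vertices (grow d N k)\<close> by blast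
    qed
    moreover have "fset t = fset t0"
      using \<open>v = Attached t0 i\<close> \<rho>_eq t0(3) \<open>v \<notin> fset t\<close> Attached_notin[of t0 i]
      by (metis insert_ident)
    ultimately show "w \<in> \<phi> ` Attached t ` {..<N t}" using v(2) t0(2) by (auto simp: fset_inject)
  }
qed

text \<open>A ball determines its tree and its labelling. By induction on the step, the image of each simplex is
known, hence by the preceding lemma also the set of images of its attached vertices, and an
increasing enumeration is determined by its range. Consequently different trees, and different
labellings of one tree, are counted at different root simplices.\<close>

lemma ordered_embedding_unique:
  assumes d: "d \<ge> 1" and \<phi>: "ordered_embedding d N r \<phi>" and \<psi>: "ordered_embedding d M r \<psi>"
    and eq: "(`) \<phi> ` grow d N r = (`) \<psi> ` grow d M r" and root: "\<phi> ` tree_root d = \<psi> ` tree_root d"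
  shows "grow d N r = grow d M r" "\<And>v. v \<in> vertices (grow d N r) \<Longrightarrow> \<phi> v = \<psi> v"
proof -
  have inj: "inj_on \<phi> (vertices (grow d N r))" "inj_on \<psi> (vertices (grow d M r))"
    using \<phi> \<psi> by (simp_all add: ordered_embedding_def)
  have base: "\<phi> (Base i) = \<psi> (Base i)" if "i < d" for i
    using strict_mono_enum_unique(2)[of d "\<lambda>i. \<phi> (Base i)" d "\<lambda>i. \<psi> (Base i)" i] root that \<phi> \<psi>
    by (auto simp: ordered_embedding_def tree_root_def image_image)
  have *: "grow d N k = grow d M k \<and> parents d N k = parents d M k \<and>
      (\<forall>v\<in>vertices (grow d N k). \<phi> v = \<psi> v) \<and> (\<forall>t\<in>parents d N k. N t = M t)" if "k \<le> r" for k
    using that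
  proof (induction k)
    case 0
    then show ?case using base by (auto simp: parents_def vertices_def faces_def tree_root_def)
  next
    case (Suc k)
    then have k: "k < r" and IH: "grow d N k = grow d M k" "parents d N k = parents d M k"
      "\<And>v. v\<in>vertices (grow d N k) \<Longrightarrow> \<phi> v = \<psi> v" "\<And>t. t\<in>parents d N k \<Longrightarrow> N t = M t" by auto
    have I: "parents d N (Suc k) = parents d M (Suc k)" by (simp add: parents_Suc IH(1))
    have kids: "N t = M t \<and> (\<forall>i<N t. \<phi> (Attached t i) = \<psi> (Attached t i))" if t: "t \<in> parents d N (Suc k)" for t
    proof (cases "t \<in> parents d N k")
      case True
      then show ?thesis using IH Attached_vertex_iff[OF d] by blast
    next
      case False
      have tr: "t \<in> parents d N r" "t \<in> parents d M r"
        using t I parents_mono[of "Suc k" r d N] parents_mono[of "Suc k" r d M] k by auto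
      have "fset t \<subseteq> vertices (grow d N k)"
        using t vertices_grow_sub d by (simp add: parents_Suc simplices_pred)
      then have "\<phi> ` fset t = \<psi> ` fset t" "\<phi> ` vertices (grow d N k) = \<psi> ` vertices (grow d M k)"
        using IH(1,3) by (auto intro!: image_cong)
      then have "\<phi> ` Attached t ` {..<N t} = \<psi> ` Attached t ` {..<M t}"
        using new_vertices_image[OF d inj(1) k t False] new_vertices_image[OF d inj(2) k, of t] t False I IH(2) eq
        by simp
      then show ?thesis
        using strict_mono_enum_unique[of "N t" "\<lambda>i. \<phi> (Attached t i)" "M t" "\<lambda>i. \<psi> (Attached t i)"] \<phi> \<psi> tr
        unfolding ordered_embedding_def image_image by metis
    qed
    have "grow d N (Suc k) = grow d M (Suc k)"
      using I kids by (intro set_eqI) (simp add: grow_iff cong: bex_cong)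
    moreover have "\<phi> v = \<psi> v" if "v \<in> vertices (grow d N (Suc k))" for v
      using that kids base unfolding vertices_grow[OF d] by (auto simp: tree_root_def)
    ultimately show ?case using I kids by blast
  qed
  from *[of r] show "grow d N r = grow d M r" "\<And>v. v \<in> vertices (grow d N r) \<Longrightarrow> \<phi> v = \<psi> v" by auto
qed

lemma vertices_image:
  assumes "inj_on \<phi> (vertices T)" "\<And>\<alpha>. \<alpha> \<in> T \<Longrightarrow> \<alpha> \<subseteq> vertices T \<and> \<alpha> \<noteq> {}"
  shows "vertices ((`) \<phi> ` T) = \<phi> ` vertices T"
proof (intro set_eqI iffI)
  fix w assume "w \<in> vertices ((`) \<phi> ` T)"
  then obtain \<alpha> where \<alpha>: "\<alpha> \<in> T" "{w} = \<phi> ` \<alpha>" by (auto simp: vertices_def)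
  then obtain v where "v \<in> \<alpha>" "w = \<phi> v" by blast
  then show "w \<in> \<phi> ` vertices T" using assms(2)[OF \<alpha>(1)] by blast
next
  fix w assume "w \<in> \<phi> ` vertices T"
  then obtain v where "{v} \<in> T" "w = \<phi> v" by (auto simp: vertices_def)
  moreover have "\<phi> ` {v} = {\<phi> v}" by simp
  ultimately show "w \<in> vertices ((`) \<phi> ` T)" unfolding vertices_def by (metis (mono_tags) image_eqI mem_Collect_eq)
qed

lemma rooted_iso_image:
  assumes inj: "inj_on \<phi> (vertices T)" and T: "\<And>\<alpha>. \<alpha> \<in> T \<Longrightarrow> \<alpha> \<subseteq> vertices T \<and> \<alpha> \<noteq> {}"
    and \<tau>: "\<tau> \<subseteq> vertices T"
  shows "rooted_iso ((`) \<phi> ` T, \<phi> ` \<tau>) H \<longleftrightarrow> rooted_iso (T, \<tau>) H"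
proof -
  note V = vertices_image[OF inj T]
  have mem: "\<phi> ` \<alpha> \<in> (`) \<phi> ` T \<longleftrightarrow> \<alpha> \<in> T" if "\<alpha> \<subseteq> vertices T" for \<alpha>
  proof
    assume "\<phi> ` \<alpha> \<in> (`) \<phi> ` T"
    then obtain \<beta> where "\<beta> \<in> T" "\<phi> ` \<alpha> = \<phi> ` \<beta>" by blast
    then show "\<alpha> \<in> T" using inj_on_image_eq_iff[OF inj that, of \<beta>] T by simp
  qed simp
  have b: "bij_betw \<phi> (vertices T) (\<phi> ` vertices T)" using inj by (simp add: inj_on_imp_bij_betw)
  show ?thesis
  proof
    assume "rooted_iso ((`) \<phi> ` T, \<phi> ` \<tau>) H"
    then obtain f where f: "bij_betw f (\<phi> ` vertices T) (vertices (fst H))"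
      "\<And>\<alpha>. \<alpha> \<subseteq> \<phi> ` vertices T \<Longrightarrow> \<alpha> \<in> (`) \<phi> ` T \<longleftrightarrow> f ` \<alpha> \<in> fst H" "f ` \<phi> ` \<tau> = snd H"
      by (auto simp: rooted_iso_def V)
    show "rooted_iso (T, \<tau>) H" unfolding rooted_iso_def fst_conv snd_conv
    proof (intro exI[of _ "f \<circ> \<phi>"] conjI allI impI)
      show "bij_betw (f \<circ> \<phi>) (vertices T) (vertices (fst H))" using bij_betw_trans[OF b f(1)] .
      show "\<alpha> \<in> T \<longleftrightarrow> (f \<circ> \<phi>) ` \<alpha> \<in> fst H" if "\<alpha> \<subseteq> vertices T" for \<alpha>
        using mem[OF that] f(2)[OF image_mono[OF that]] by (simp add: image_comp)
      show "(f \<circ> \<phi>) ` \<tau> = snd H" using f(3) by (simp add: image_comp)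
    qed
  next
    assume "rooted_iso (T, \<tau>) H"
    then obtain f where f: "bij_betw f (vertices T) (vertices (fst H))"
      "\<And>\<alpha>. \<alpha> \<subseteq> vertices T \<Longrightarrow> \<alpha> \<in> T \<longleftrightarrow> f ` \<alpha> \<in> fst H" "f ` \<tau> = snd H"
      by (auto simp: rooted_iso_def)
    let ?g = "inv_into (vertices T) \<phi>"
    have g: "?g ` \<phi> ` \<alpha> = \<alpha>" if "\<alpha> \<subseteq> vertices T" for \<alpha>
      using inj that by (metis inv_into_image_cancel)
    have "bij_betw (f \<circ> ?g) (\<phi> ` vertices T) (vertices (fst H))"
      using b f(1) bij_betw_inv_into bij_betw_trans by blast
    moreover have "(f \<circ> ?g) ` \<phi> ` \<tau> = snd H" using g[OF \<tau>] f(3) by (simp only: image_comp[symmetric])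
    moreover have "\<beta> \<in> (`) \<phi> ` T \<longleftrightarrow> (f \<circ> ?g) ` \<beta> \<in> fst H" if h: "\<beta> \<subseteq> \<phi> ` vertices T" for \<beta>
    proof -
      obtain \<alpha> where \<alpha>: "\<alpha> \<subseteq> vertices T" "\<beta> = \<phi> ` \<alpha>" using h by (auto simp: subset_image_iff)
      show ?thesis
        using mem[OF \<alpha>(1)] f(2)[OF \<alpha>(1)] g[OF \<alpha>(1)] unfolding \<alpha>(2) by (simp only: image_comp[symmetric])
    qed
    ultimately show "rooted_iso ((`) \<phi> ` T, \<phi> ` \<tau>) H"
      unfolding rooted_iso_def by (intro exI[of _ "f \<circ> ?g"]) (simp add: V del: o_apply)
  qed
qed

section \<open>Counting maps that increase on blocks\<close>

definition block_maps ::
    "'k set \<Rightarrow> ('k \<Rightarrow> nat) \<Rightarrow> ('k \<Rightarrow> nat \<Rightarrow> 'v) \<Rightarrow> nat \<Rightarrow> ('v \<Rightarrow> nat) set" where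
  "block_maps K b e n = {\<phi> \<in> (\<Union>k\<in>K. e k ` {..<b k}) \<rightarrow>\<^sub>E {1..n}.
     inj_on \<phi> (\<Union>k\<in>K. e k ` {..<b k}) \<and> (\<forall>k\<in>K. \<forall>i j. i < j \<and> j < b k \<longrightarrow> \<phi> (e k i) < \<phi> (e k j))}"

lemma strict_enum_exists:
  fixes B :: "nat set"
  assumes "finite B"
  obtains f where "\<And>i j. i < j \<Longrightarrow> j < card B \<Longrightarrow> f i < f j" "f ` {..<card B} = B"
proof
  let ?f = "\<lambda>i. sorted_list_of_set B ! i"
  have s: "sorted_wrt (<) (sorted_list_of_set B)" by simp
  show "?f i < ?f j" if "i < j" "j < card B" for i j
    using s that unfolding sorted_wrt_iff_nth_less by (simp add: assms)
  have "?f ` {..<card B} = set (sorted_list_of_set B)"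
    by (auto simp: set_conv_nth image_def)
  then show "?f ` {..<card B} = B" using assms by simp
qed

text \<open>Given the values on the other blocks, an increasing injection of one more block is the same as the
choice of its range among the unused values.\<close>

lemma card_block_maps_insert:
  fixes e :: "'k \<Rightarrow> nat \<Rightarrow> 'v"
  assumes fin: "finite K" and k: "k \<notin> K"
    and inj: "inj_on (e k) {..<b k}"
    and disj: "\<And>k'. k' \<in> K \<Longrightarrow> e k ` {..<b k} \<inter> e k' ` {..<b k'} = {}"
  shows "card (block_maps (insert k K) b e n) =
    card (block_maps K b e n) * ((n - card (\<Union>k\<in>K. e k ` {..<b k})) choose b k)"
proof -
  define V where "V = (\<Union>k\<in>K. e k ` {..<b k})"
  define A where "A = e k ` {..<b k}"
  have VA: "V \<inter> A = {}" "finite V" "finite A" using disj fin by (auto simp: V_def A_def)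
  have U: "(\<Union>k\<in>insert k K. e k ` {..<b k}) = A \<union> V" by (simp add: A_def V_def)
  have eA: "e k i \<in> A" if "i < b k" for i using that by (auto simp: A_def)
  have eV: "e k' i \<in> V" if "k' \<in> K" "i < b k'" for k' i using that by (auto simp: V_def)
  let ?S = "SIGMA \<phi>:block_maps K b e n. {B. B \<subseteq> {1..n} - \<phi> ` V \<and> card B = b k}"
  let ?F = "\<lambda>\<phi>. (restrict \<phi> V, \<phi> ` A)"
  have mem: "\<phi> \<in> block_maps (insert k K) b e n \<longleftrightarrow> \<phi> \<in> (A \<union> V) \<rightarrow>\<^sub>E {1..n} \<and> inj_on \<phi> (A \<union> V) \<and>
     (\<forall>i j. i < j \<and> j < b k \<longrightarrow> \<phi> (e k i) < \<phi> (e k j)) \<and>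
     (\<forall>k'\<in>K. \<forall>i j. i < j \<and> j < b k' \<longrightarrow> \<phi> (e k' i) < \<phi> (e k' j))" for \<phi>
    unfolding block_maps_def U by auto
  have mem': "\<phi> \<in> block_maps K b e n \<longleftrightarrow> \<phi> \<in> V \<rightarrow>\<^sub>E {1..n} \<and> inj_on \<phi> V \<and>
     (\<forall>k'\<in>K. \<forall>i j. i < j \<and> j < b k' \<longrightarrow> \<phi> (e k' i) < \<phi> (e k' j))" for \<phi>
    unfolding block_maps_def V_def by auto
  have "bij_betw ?F (block_maps (insert k K) b e n) ?S"
  proof (rule bij_betwI')
    fix \<phi> \<psi> assume \<phi>: "\<phi> \<in> block_maps (insert k K) b e n" and \<psi>: "\<psi> \<in> block_maps (insert k K) b e n"
    show "?F \<phi> = ?F \<psi> \<longleftrightarrow> \<phi> = \<psi>"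
    proof
      assume eq: "?F \<phi> = ?F \<psi>"
      have "\<phi> v = \<psi> v" for v
      proof -
        consider "v \<in> V" | i where "i < b k" "v = e k i" | "v \<notin> A \<union> V" by (auto simp: A_def)
        then show ?thesis
        proof cases
          case 1
          then show ?thesis using eq by (metis Pair_inject restrict_apply')
        next
          case 2
          have img: "(\<lambda>i. \<phi> (e k i)) ` {..<b k} = (\<lambda>i. \<psi> (e k i)) ` {..<b k}"
            using eq by (simp add: A_def image_image)
          have M: "\<And>i j. i < j \<Longrightarrow> j < b k \<Longrightarrow> \<eta> (e k i) < \<eta> (e k j)"
            if "\<eta> \<in> block_maps (insert k K) b e n" for \<eta>
            using that unfolding block_maps_def by simp
          have "\<phi> (e k i) = \<psi> (e k i)"
            by (rule strict_mono_enum_unique(2)[of "b k" "\<lambda>i. \<phi> (e k i)" "b k" "\<lambda>i. \<psi> (e k i)"])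
              (use M[OF \<phi>] M[OF \<psi>] img 2(1) in auto)
          then show ?thesis using 2(2) by simp
        next
          case 3
          have und: "\<eta> v = undefined" if "\<eta> \<in> block_maps (insert k K) b e n" for \<eta>
          proof (rule PiE_arb[OF _ 3])
            show "\<eta> \<in> (A \<union> V) \<rightarrow>\<^sub>E {1..n}" using that unfolding mem by (elim conjE)
          qed
          show ?thesis using und[OF \<phi>] und[OF \<psi>] by (rule trans[OF _ sym])
        qed
      qed
      then show "\<phi> = \<psi>" by blast
    qed simp
  next
    fix \<phi> assume \<phi>: "\<phi> \<in> block_maps (insert k K) b e n"
    have P: "\<phi> \<in> (A \<union> V) \<rightarrow>\<^sub>E {1..n}" and I: "inj_on \<phi> (A \<union> V)"
      and M: "\<forall>k'\<in>K. \<forall>i j. i < j \<and> j < b k' \<longrightarrow> \<phi> (e k' i) < \<phi> (e k' j)"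
      using \<phi> unfolding mem by blast+
    have "restrict \<phi> V \<in> block_maps K b e n"
      unfolding mem'
    proof (intro conjI ballI allI impI)
      show "restrict \<phi> V \<in> V \<rightarrow>\<^sub>E {1..n}" using P by (auto simp: PiE_def Pi_def)
      show "inj_on (restrict \<phi> V) V" using I by (auto simp: inj_on_def)
      fix k' i j assume "k' \<in> K" "i < j \<and> j < b k'"
      then show "restrict \<phi> V (e k' i) < restrict \<phi> V (e k' j)"
        using eV[of k' i] eV[of k' j] M by auto
    qed
    moreover have "\<phi> ` A \<subseteq> {1..n} - restrict \<phi> V ` V"
    proof -
      have "\<phi> ` A \<inter> \<phi> ` V = {}" using I VA(1) unfolding inj_on_def by blast
      moreover have "\<phi> ` A \<subseteq> {1..n}" using P by (auto simp: PiE_def Pi_def)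
      ultimately show ?thesis by auto
    qed
    moreover have "card (\<phi> ` A) = b k"
      using card_image[OF inj_on_subset[OF I], of A] card_image[OF inj] by (simp add: A_def)
    ultimately show "?F \<phi> \<in> ?S" by simp
  next
    fix y assume "y \<in> ?S"
    then obtain \<psi> B where y: "y = (\<psi>, B)" "\<psi> \<in> block_maps K b e n" "B \<subseteq> {1..n} - \<psi> ` V" "card B = b k" by auto
    have "finite B" using y(3) by (rule finite_subset) simp
    then obtain f where f: "\<And>i j. i < j \<Longrightarrow> j < b k \<Longrightarrow> f i < f j" "f ` {..<b k} = B"
      using strict_enum_exists[of B] y(4) by metis
    have P: "\<psi> \<in> V \<rightarrow>\<^sub>E {1..n}" "inj_on \<psi> V"
      and M: "\<And>k' i j. k' \<in> K \<Longrightarrow> i < j \<Longrightarrow> j < b k' \<Longrightarrow> \<psi> (e k' i) < \<psi> (e k' j)"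
      using y(2) unfolding mem' by blast+
    define \<phi> where "\<phi> v = (if v \<in> A then f (inv_into {..<b k} (e k) v) else \<psi> v)" for v
    have \<phi>e: "\<phi> (e k i) = f i" if "i < b k" for i
      using that inj by (simp add: \<phi>_def eA inv_into_f_f)
    have \<phi>V: "\<phi> v = \<psi> v" if "v \<in> V" for v using that VA(1) by (auto simp: \<phi>_def)
    have \<phi>A: "\<phi> ` A = B"
      using f(2) \<phi>e by (auto simp: A_def image_image)
    have fi: "inj_on f {..<b k}" using f(2) y(4) by (intro eq_card_imp_inj_on) auto
    have "\<phi> \<in> block_maps (insert k K) b e n"
      unfolding mem
    proof (intro conjI ballI allI impI)
      show "\<phi> \<in> (A \<union> V) \<rightarrow>\<^sub>E {1..n}"
      proof (rule PiE_I)
        fix v assume v: "v \<in> A \<union> V"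
        show "\<phi> v \<in> {1..n}"
        proof (cases "v \<in> A")
          case True
          then show ?thesis using \<phi>A y(3) by blast
        next
          case False
          then show ?thesis using v \<phi>V P(1) by (auto simp: PiE_def Pi_def)
        qed
      next
        fix v assume "v \<notin> A \<union> V"
        then show "\<phi> v = undefined" using PiE_arb[OF P(1), of v] by (simp add: \<phi>_def)
      qed
      have "inj_on \<phi> A"
        unfolding A_def by (rule inj_on_imageI) (use fi \<phi>e in \<open>auto simp: inj_on_def\<close>)
      moreover have "inj_on \<phi> V" using P(2) \<phi>V by (simp add: inj_on_def)
      moreover have "\<phi> ` A \<inter> \<phi> ` V = {}" using \<phi>A \<phi>V y(3) by auto
      ultimately show "inj_on \<phi> (A \<union> V)" by (auto simp: inj_on_Un)
      show "\<phi> (e k i) < \<phi> (e k j)" if "i < j \<and> j < b k" for i j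
        using that f(1) \<phi>e by simp
      show "\<phi> (e k' i) < \<phi> (e k' j)" if "k' \<in> K" "i < j \<and> j < b k'" for k' i j
        using that M eV[of k' i] eV[of k' j] \<phi>V by simp
    qed
    moreover have "restrict \<phi> V = \<psi>"
      using \<phi>V PiE_restrict[OF P(1)] by (metis restrict_ext)
    ultimately show "\<exists>\<phi>\<in>block_maps (insert k K) b e n. y = ?F \<phi>" using y(1) \<phi>A by blast
  qed
  then have "card (block_maps (insert k K) b e n) = card ?S" by (rule bij_betw_same_card)
  also have "\<dots> = (\<Sum>\<phi>\<in>block_maps K b e n. card {B. B \<subseteq> {1..n} - \<phi> ` V \<and> card B = b k})"
  proof (rule card_SigmaI)
    show "finite (block_maps K b e n)"
      by (rule finite_subset[of _ "V \<rightarrow>\<^sub>E {1..n}"]) (use VA mem' in \<open>blast intro: finite_PiE\<close>)+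
  qed auto
  also have "\<dots> = (\<Sum>\<phi>\<in>block_maps K b e n. (n - card V) choose b k)"
  proof (rule sum.cong[OF refl])
    fix \<phi> assume "\<phi> \<in> block_maps K b e n"
    then have "inj_on \<phi> V" "\<phi> ` V \<subseteq> {1..n}" unfolding mem' by (auto simp: PiE_def Pi_def)
    then have "card ({1..n} - \<phi> ` V) = n - card V" by (simp add: card_Diff_subset VA(2) card_image)
    then show "card {B. B \<subseteq> {1..n} - \<phi> ` V \<and> card B = b k} = (n - card V) choose b k"
      using n_subsets[of "{1..n} - \<phi> ` V" "b k"] by simp
  qed
  finally show ?thesis by (simp add: V_def)
qed

lemma choose_asymp: "(\<lambda>n. real ((n - c) choose b) / real n ^ b) \<longlonglongrightarrow> 1 / fact b"
proof -
  have "(\<lambda>n. (\<Prod>i<b. (real n - real c - real i) / real n) / fact b) \<longlonglongrightarrow> (\<Prod>i<b. 1) / fact b"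
  proof (intro tendsto_intros)
    fix i
    show "(\<lambda>n. (real n - real c - real i) / real n) \<longlonglongrightarrow> 1" by real_asymp
  qed auto
  moreover have "\<forall>\<^sub>F n in sequentially.
      (\<Prod>i<b. (real n - real c - real i) / real n) / fact b = real ((n - c) choose b) / real n ^ b"
    using eventually_ge_at_top[of c]
  proof eventually_elim
    case (elim n)
    have "real ((n - c) choose b) = (\<Prod>i<b. real n - real c - real i) / fact b"
      using elim by (simp add: binomial_gbinomial gbinomial_prod_rev of_nat_diff atLeast0LessThan)
    then show ?case by (simp add: prod_dividef)
  qed
  ultimately show ?thesis by (simp add: tendsto_cong)
qed

lemma card_block_maps_asymp:
  fixes e :: "'k \<Rightarrow> nat \<Rightarrow> 'v"
  assumes "finite K" and "\<And>k. k \<in> K \<Longrightarrow> inj_on (e k) {..<b k}"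
    and "\<And>k k'. k \<in> K \<Longrightarrow> k' \<in> K \<Longrightarrow> k \<noteq> k' \<Longrightarrow> e k ` {..<b k} \<inter> e k' ` {..<b k'} = {}"
  shows "(\<lambda>n. real (card (block_maps K b e n)) / real n ^ (\<Sum>k\<in>K. b k)) \<longlonglongrightarrow> (\<Prod>k\<in>K. 1 / fact (b k))"
  using assms
proof (induction K rule: finite_induct)
  case empty
  have "block_maps {} b e n = {\<lambda>_. undefined}" for n by (auto simp: block_maps_def)
  then show ?case by simp
next
  case (insert k K)
  let ?c = "card (\<Union>k\<in>K. e k ` {..<b k})"
  have "(\<lambda>n. real (card (block_maps K b e n)) / real n ^ (\<Sum>k\<in>K. b k) * (real ((n - ?c) choose b k) / real n ^ b k))
     \<longlonglongrightarrow> (\<Prod>k\<in>K. 1 / fact (b k)) * (1 / fact (b k))"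
    by (intro tendsto_mult choose_asymp insert.IH) (use insert.prems in auto)
  moreover have "card (block_maps (insert k K) b e n) = card (block_maps K b e n) * ((n - ?c) choose b k)" for n
  proof (rule card_block_maps_insert)
    show "e k ` {..<b k} \<inter> e k' ` {..<b k'} = {}" if "k' \<in> K" for k'
      using insert.prems(2)[of k k'] insert.hyps(2) that by auto
  qed (use insert in auto)
  ultimately show ?case using insert.hyps by (simp add: power_add mult.commute divide_simps)
qed

section \<open>The random complex from independent coins\<close>

text \<open>The probability of a face of cardinality \<open>k\<close>, given its boundary. Vertices are always present, and
the empty set gets weight \<open>1\<close> so that products over all subsets can be used.\<close>

definition face_weight :: "(nat \<Rightarrow> real) \<Rightarrow> nat \<Rightarrow> real" where
  "face_weight p k = (if k \<le> 1 then 1 else p (k - 1))"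

definition slots :: "nat \<Rightarrow> nat \<Rightarrow> nat set set" where
  "slots d n = {\<alpha>. \<alpha> \<subseteq> {1..n} \<and> 2 \<le> card \<alpha> \<and> card \<alpha> \<le> d + 1}"

definition coins :: "nat \<Rightarrow> nat \<Rightarrow> (nat \<Rightarrow> real) \<Rightarrow> (nat set \<Rightarrow> bool) pmf" where
  "coins d n p = Pi_pmf (slots d n) False (\<lambda>\<alpha>. bernoulli_pmf (p (card \<alpha> - 1)))"

definition is_open :: "(nat set \<Rightarrow> bool) \<Rightarrow> nat set \<Rightarrow> bool" where
  "is_open b \<alpha> \<longleftrightarrow> (2 \<le> card \<alpha> \<longrightarrow> b \<alpha>)"

text \<open>All coins are thrown in advance, also those of the sets whose boundary is incomplete. A set is a
simplex if the coins of all its subsets with at least two elements show success.\<close>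

definition coin_complex :: "nat \<Rightarrow> nat \<Rightarrow> (nat set \<Rightarrow> bool) \<Rightarrow> nat set set" where
  "coin_complex d n b = {\<sigma>. \<sigma> \<subseteq> {1..n} \<and> \<sigma> \<noteq> {} \<and> card \<sigma> \<le> d + 1 \<and> (\<forall>\<alpha>\<subseteq>\<sigma>. is_open b \<alpha>)}"

lemma finite_slots: "finite (slots d n)"
  unfolding slots_def by (rule finite_subset[of _ "Pow {1..n}"]) auto

text \<open>Adding the coins of one further dimension, \<open>g\<close>, keeps the complex of the coins \<open>f\<close> and adds
those fillable sets whose coin in \<open>g\<close> is a success, which is a step of the recursive model.\<close>

lemma coin_complex_Suc:
  assumes g: "\<And>\<sigma>. \<sigma> \<subseteq> {1..n} \<Longrightarrow> card \<sigma> = k + 2 \<Longrightarrow> \<sigma> \<notin> slots k n"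
  shows "coin_complex (Suc k) n (\<lambda>\<alpha>. if \<alpha> \<in> slots k n then f \<alpha> else g \<alpha>) =
    coin_complex k n f \<union> {\<sigma> \<in> fillable n (Suc k) (coin_complex k n f). g \<sigma>}" (is "coin_complex _ _ ?h = _")
proof -
  have op: "is_open ?h \<alpha> \<longleftrightarrow> is_open f \<alpha>" if "\<alpha> \<subseteq> {1..n}" "card \<alpha> \<le> k + 1" for \<alpha>
    using that by (auto simp: is_open_def slots_def)
  have small: "\<sigma> \<in> coin_complex (Suc k) n ?h \<longleftrightarrow> \<sigma> \<in> coin_complex k n f" if c: "card \<sigma> \<le> k + 1" for \<sigma>
  proof (cases "\<sigma> \<subseteq> {1..n}")
    case True
    then have "finite \<sigma>" by (rule finite_subset) simp
    then have "is_open ?h \<alpha> \<longleftrightarrow> is_open f \<alpha>" if "\<alpha> \<subseteq> \<sigma>" for \<alpha>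
      using op[of \<alpha>] that True c card_mono[of \<sigma> \<alpha>] by auto
    then show ?thesis using c by (auto simp: coin_complex_def)
  qed (simp add: coin_complex_def)
  have big: "\<sigma> \<in> coin_complex (Suc k) n ?h \<longleftrightarrow> \<sigma> \<in> fillable n (Suc k) (coin_complex k n f) \<and> g \<sigma>" if c: "card \<sigma> = k + 2" for \<sigma>
  proof (cases "\<sigma> \<subseteq> {1..n}")
    case True
    then have fin: "finite \<sigma>" by (rule finite_subset) simp
    have ne: "\<sigma> \<noteq> {}" using c by auto
    have self: "is_open ?h \<sigma> \<longleftrightarrow> g \<sigma>" using g[OF True c] c by (simp add: is_open_def)
    have sub: "\<alpha> \<subseteq> {1..n} \<and> card \<alpha> \<le> k + 1" if "\<alpha> \<subset> \<sigma>" for \<alpha>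
      using psubset_card_mono[OF fin that] c that True by auto
    have "(\<forall>\<alpha>\<subseteq>\<sigma>. is_open ?h \<alpha>) \<longleftrightarrow> g \<sigma> \<and> (\<forall>\<alpha>\<subset>\<sigma>. is_open f \<alpha>)"
    proof -
      have "(\<forall>\<alpha>\<subseteq>\<sigma>. P \<alpha>) \<longleftrightarrow> P \<sigma> \<and> (\<forall>\<alpha>\<subset>\<sigma>. P \<alpha>)" for P
        by (metis subset_iff_psubset_eq)
      moreover have "is_open ?h \<alpha> \<longleftrightarrow> is_open f \<alpha>" if "\<alpha> \<subset> \<sigma>" for \<alpha>
        using op[of \<alpha>] sub[OF that] by simp
      ultimately show ?thesis using self by simp
    qed
    also have "(\<forall>\<alpha>\<subset>\<sigma>. is_open f \<alpha>) \<longleftrightarrow> (\<forall>\<alpha>. \<alpha> \<subset> \<sigma> \<and> \<alpha> \<noteq> {} \<longrightarrow> \<alpha> \<in> coin_complex k n f)"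
    proof
      assume L: "\<forall>\<alpha>\<subset>\<sigma>. is_open f \<alpha>"
      show "\<forall>\<alpha>. \<alpha> \<subset> \<sigma> \<and> \<alpha> \<noteq> {} \<longrightarrow> \<alpha> \<in> coin_complex k n f"
      proof (intro allI impI)
        fix \<alpha> assume \<alpha>: "\<alpha> \<subset> \<sigma> \<and> \<alpha> \<noteq> {}"
        have "is_open f \<beta>" if "\<beta> \<subseteq> \<alpha>" for \<beta> using L \<alpha> that by blast
        then show "\<alpha> \<in> coin_complex k n f" using \<alpha> sub[of \<alpha>] by (simp add: coin_complex_def)
      qed
    next
      assume R: "\<forall>\<alpha>. \<alpha> \<subset> \<sigma> \<and> \<alpha> \<noteq> {} \<longrightarrow> \<alpha> \<in> coin_complex k n f"
      show "\<forall>\<alpha>\<subset>\<sigma>. is_open f \<alpha>"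
      proof (intro allI impI)
        fix \<alpha> assume \<alpha>: "\<alpha> \<subset> \<sigma>"
        show "is_open f \<alpha>"
        proof (cases "\<alpha> = {}")
          case False
          then show ?thesis using R \<alpha> by (simp add: coin_complex_def)
        qed (simp add: is_open_def)
      qed
    qed
    finally show ?thesis using True ne c by (auto simp: coin_complex_def fillable_def)
  qed (simp add: coin_complex_def fillable_def)
  show ?thesis
  proof (intro set_eqI)
    fix \<sigma> :: "nat set"
    consider "card \<sigma> \<le> k + 1" | "card \<sigma> = k + 2" | "card \<sigma> > k + 2" by linarith
    then show "\<sigma> \<in> coin_complex (Suc k) n ?h \<longleftrightarrow> \<sigma> \<in> coin_complex k n f \<union> {\<sigma> \<in> fillable n (Suc k) (coin_complex k n f). g \<sigma>}"
    proof cases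
      case 1
      then show ?thesis using small[OF 1] by (auto simp: fillable_def)
    next
      case 2
      then show ?thesis using big[OF 2] by (auto simp: coin_complex_def)
    next
      case 3
      then show ?thesis by (auto simp: coin_complex_def fillable_def)
    qed
  qed
qed

text \<open>The recursion throws coins only for fillable sets; the superfluous coins are integrated out. This
turns presence of faces into events on independent coordinates.\<close>

lemma mrsc_eq_coins: "mrsc d n p = map_pmf (coin_complex d n) (coins d n p)"
proof (induction d)
  case 0
  have "slots 0 n = {}" by (auto simp: slots_def)
  moreover have "coin_complex 0 n b = (\<lambda>v. {v}) ` {1..n}" for b
  proof (intro set_eqI iffI)
    fix \<sigma> assume "\<sigma> \<in> coin_complex 0 n b"
    then have \<sigma>: "\<sigma> \<subseteq> {1..n}" "\<sigma> \<noteq> {}" "card \<sigma> \<le> 1" by (auto simp: coin_complex_def)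
    then have "finite \<sigma>" by (auto intro: finite_subset)
    then have "card \<sigma> = 1" using \<sigma> by (metis One_nat_def card_0_eq le_SucE le_zero_eq)
    then show "\<sigma> \<in> (\<lambda>v. {v}) ` {1..n}" using \<sigma>(1) by (auto simp: card_1_singleton_iff)
  next
    fix \<sigma> assume "\<sigma> \<in> (\<lambda>v. {v}) ` {1..n}"
    then obtain v where v: "\<sigma> = {v}" "v \<in> {1..n}" by blast
    then show "\<sigma> \<in> coin_complex 0 n b"
      by (auto simp: coin_complex_def is_open_def subset_singleton_iff)
  qed
  ultimately show ?case by (simp add: coins_def)
next
  case (Suc k)
  let ?L = "{\<alpha>. \<alpha> \<subseteq> {1..n} \<and> card \<alpha> = k + 2}"
  let ?Q = "Pi_pmf ?L False (\<lambda>_. bernoulli_pmf (p (Suc k)))"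
  have finL: "finite ?L" by (rule finite_subset[of _ "Pow {1..n}"]) auto
  have dis: "slots k n \<inter> ?L = {}" by (auto simp: slots_def)
  have "slots (Suc k) n = slots k n \<union> ?L" by (auto simp: slots_def)
  then have coins_Suc: "coins (Suc k) n p = map_pmf (\<lambda>(f, g) \<alpha>. if \<alpha> \<in> slots k n then f \<alpha> else g \<alpha>)
      (pair_pmf (coins k n p) (Pi_pmf ?L False (\<lambda>\<alpha>. bernoulli_pmf (p (card \<alpha> - 1)))))"
    unfolding coins_def by (simp only: Pi_pmf_union[OF finite_slots finL dis])
  have Q: "Pi_pmf ?L False (\<lambda>\<alpha>. bernoulli_pmf (p (card \<alpha> - 1))) = ?Q"
    using finL by (intro Pi_pmf_cong) auto
  have "coin_complex (Suc k) n (case x of (f, g) \<Rightarrow> \<lambda>\<alpha>. if \<alpha> \<in> slots k n then f \<alpha> else g \<alpha>) =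
     (case x of (f, g) \<Rightarrow> coin_complex k n f \<union> {\<sigma> \<in> fillable n (Suc k) (coin_complex k n f). g \<sigma>})" for x
    using dis by (cases x) (simp only: prod.case, rule coin_complex_Suc, auto)
  then have "map_pmf (coin_complex (Suc k) n) (coins (Suc k) n p) =
      map_pmf (\<lambda>(f, g). coin_complex k n f \<union> {\<sigma> \<in> fillable n (Suc k) (coin_complex k n f). g \<sigma>}) (pair_pmf (coins k n p) ?Q)"
    unfolding coins_Suc Q map_pmf_comp by simp
  also have "\<dots> = bind_pmf (coins k n p) (\<lambda>f. map_pmf (\<lambda>g. coin_complex k n f \<union> {\<sigma> \<in> fillable n (Suc k) (coin_complex k n f). g \<sigma>}) ?Q)"
    by (simp add: pair_pmf_def map_bind_pmf map_pmf_def bind_assoc_pmf bind_return_pmf)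
  also have "\<dots> = bind_pmf (coins k n p) (\<lambda>f. map_pmf (\<lambda>S. coin_complex k n f \<union> S)
      (random_subset (fillable n (Suc k) (coin_complex k n f)) (p (Suc k))))"
  proof (rule bind_pmf_cong[OF refl])
    fix f
    let ?F = "fillable n (Suc k) (coin_complex k n f)"
    have sub: "?F \<subseteq> ?L" by (auto simp: fillable_def)
    have "random_subset ?F (p (Suc k)) = map_pmf (\<lambda>b. {a \<in> ?F. b a}) (map_pmf (\<lambda>f x. if x \<in> ?F then f x else False) ?Q)"
      unfolding random_subset_def by (simp only: Pi_pmf_subset[OF finL sub])
    also have "\<dots> = map_pmf (\<lambda>g. {a \<in> ?F. g a}) ?Q"
      unfolding map_pmf_comp by (intro map_pmf_cong refl) auto
    finally show "map_pmf (\<lambda>g. coin_complex k n f \<union> {\<sigma> \<in> ?F. g \<sigma>}) ?Q =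
      map_pmf (\<lambda>S. coin_complex k n f \<union> S) (random_subset ?F (p (Suc k)))"
      by (simp add: map_pmf_comp)
  qed
  also have "\<dots> = mrsc (Suc k) n p" by (simp add: Suc bind_map_pmf)
  finally show ?case by simp
qed

definition depends_on :: "'a set \<Rightarrow> ('a \<Rightarrow> bool) set \<Rightarrow> bool" where
  "depends_on C E \<longleftrightarrow> (\<forall>b b'. (\<forall>\<alpha>\<in>C. b \<alpha> = b' \<alpha>) \<longrightarrow> (b \<in> E \<longleftrightarrow> b' \<in> E))"

lemma prob_pair_pmf_Times:
  "measure_pmf.prob (pair_pmf M N) (E \<times> F) = measure_pmf.prob M E * measure_pmf.prob N F"
proof -
  have "emeasure (pair_pmf M N) (E \<times> F) = (\<integral>\<^sup>+x. indicator (E \<times> F) x \<partial>pair_pmf M N)"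
    by simp
  also have "\<dots> = (\<integral>\<^sup>+a. \<integral>\<^sup>+b. indicator E a * indicator F b \<partial>N \<partial>M)"
    by (subst nn_integral_pair_pmf') (simp add: indicator_times)
  also have "\<dots> = emeasure M E * emeasure N F"
    by (simp add: nn_integral_cmult nn_integral_multc)
  finally show ?thesis
    by (simp add: measure_pmf.emeasure_eq_measure ennreal_mult[symmetric])
qed

lemma prob_Pi_pmf_indep:
  assumes A: "finite A" and CD: "C \<subseteq> A" "D \<subseteq> A" "C \<inter> D = {}"
    and E: "depends_on C E" and F: "depends_on D F"
  shows "measure_pmf.prob (Pi_pmf A dflt q) (E \<inter> F) =
    measure_pmf.prob (Pi_pmf A dflt q) E * measure_pmf.prob (Pi_pmf A dflt q) F"
proof -
  let ?P = "pair_pmf (Pi_pmf C dflt q) (Pi_pmf (A - C) dflt q)"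
  let ?h = "\<lambda>(f, g) x. if x \<in> C then f x else g x"
  have fin: "finite C" "finite (A - C)" using A CD by (auto intro: finite_subset)
  have "C \<union> (A - C) = A" using CD by blast
  then have eq: "Pi_pmf A dflt q = map_pmf ?h ?P"
    using Pi_pmf_union[OF fin, of dflt q] by simp
  have *: "?h x \<in> E \<longleftrightarrow> fst x \<in> E" "?h x \<in> F \<longleftrightarrow> snd x \<in> F" for x
  proof -
    have "\<forall>y\<in>C. ?h x y = fst x y" "\<forall>y\<in>D. ?h x y = snd x y" using CD by (auto split: prod.split)
    then show "?h x \<in> E \<longleftrightarrow> fst x \<in> E" "?h x \<in> F \<longleftrightarrow> snd x \<in> F"
      using E[unfolded depends_on_def, rule_format, of "?h x" "fst x"]
        F[unfolded depends_on_def, rule_format, of "?h x" "snd x"] by blast+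
  qed
  have "?h -` (E \<inter> F) = E \<times> F" "?h -` E = E \<times> UNIV" "?h -` F = UNIV \<times> F"
    by (simp_all only: set_eq_iff vimage_eq Int_iff mem_Times_iff * UNIV_I simp_thms)
  then show ?thesis unfolding eq measure_map_pmf by (simp add: prob_pair_pmf_Times)
qed

lemma prod_Pow_card:
  fixes f :: "nat \<Rightarrow> real"
  assumes "finite Y"
  shows "(\<Prod>\<alpha>\<in>Pow Y. f (card \<alpha>)) = (\<Prod>k\<le>card Y. f k ^ (card Y choose k))"
proof -
  have "(\<Prod>\<alpha>\<in>Pow Y. f (card \<alpha>)) = (\<Prod>k\<le>card Y. \<Prod>\<alpha>\<in>{\<alpha>\<in>Pow Y. card \<alpha> = k}. f (card \<alpha>))"
    using assms by (intro prod.group[symmetric]) (auto simp: card_mono)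
  also have "\<dots> = (\<Prod>k\<le>card Y. f k ^ (card Y choose k))"
  proof (rule prod.cong[OF refl])
    fix k
    have "(\<Prod>\<alpha>\<in>{\<alpha>\<in>Pow Y. card \<alpha> = k}. f (card \<alpha>)) = (\<Prod>\<alpha>\<in>{\<alpha>\<in>Pow Y. card \<alpha> = k}. f k)"
      by (intro prod.cong) auto
    then show "(\<Prod>\<alpha>\<in>{\<alpha>\<in>Pow Y. card \<alpha> = k}. f (card \<alpha>)) = f k ^ (card Y choose k)"
      using n_subsets[OF assms, of k] by simp
  qed
  finally show ?thesis .
qed

text \<open>The product of the face weights over all faces of a \<open>d\<close>-simplex that contain a given edge. It is the
price of joining two vertices that are not yet adjacent.\<close>

definition s_param :: "nat \<Rightarrow> (nat \<Rightarrow> real) \<Rightarrow> real" where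
  "s_param d p = (\<Prod>k=1..d. p k ^ (d - 1 choose (k - 1)))"

lemma prod_Pow_r_param:
  assumes "finite Y" "card Y = d"
  shows "(\<Prod>\<beta>\<in>Pow Y. face_weight p (Suc (card \<beta>))) = r_param d p"
proof -
  have "(\<Prod>\<beta>\<in>Pow Y. face_weight p (Suc (card \<beta>))) = (\<Prod>k\<le>d. face_weight p (Suc k) ^ (d choose k))"
    using prod_Pow_card[OF assms(1), of "\<lambda>k. face_weight p (Suc k)"] assms(2) by simp
  also have "{..d} = insert 0 {1..d}" by auto
  also have "(\<Prod>k\<in>insert 0 {1..d}. face_weight p (Suc k) ^ (d choose k)) = (\<Prod>k=1..d. face_weight p (Suc k) ^ (d choose k))"
    by (simp add: face_weight_def)
  also have "\<dots> = r_param d p"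
    unfolding r_param_def by (intro prod.cong) (auto simp: face_weight_def)
  finally show ?thesis .
qed

lemma prod_Pow_s_param:
  assumes "d \<ge> 1" "finite Y" "card Y = d - 1"
  shows "(\<Prod>\<beta>\<in>Pow Y. face_weight p (Suc (Suc (card \<beta>)))) = s_param d p"
proof -
  have "(\<Prod>\<beta>\<in>Pow Y. face_weight p (Suc (Suc (card \<beta>)))) = (\<Prod>k\<le>d-1. p (Suc k) ^ (d - 1 choose k))"
    using prod_Pow_card[OF assms(2), of "\<lambda>k. face_weight p (Suc (Suc k))"] assms(3) by (simp add: face_weight_def)
  also have "\<dots> = (\<Prod>k\<in>Suc ` {..d-1}. p k ^ (d - 1 choose (k - 1)))"
    by (simp add: prod.reindex)
  also have "Suc ` {..d-1} = {1..d}" using assms(1) by (simp add: image_Suc_atMost)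
  finally show ?thesis by (simp add: s_param_def)
qed

lemma prod_faces_q_param:
  assumes "d \<ge> 1" "finite \<sigma>" "card \<sigma> = d"
  shows "(\<Prod>\<alpha>\<in>faces \<sigma>. face_weight p (card \<alpha>)) = q_param d p"
proof -
  have "Pow \<sigma> = insert {} (faces \<sigma>)" "{} \<notin> faces \<sigma>" by (auto simp: faces_def)
  then have "(\<Prod>\<alpha>\<in>faces \<sigma>. face_weight p (card \<alpha>)) = (\<Prod>\<alpha>\<in>Pow \<sigma>. face_weight p (card \<alpha>))"
    using assms(2) by (simp add: finite_faces face_weight_def)
  also have "\<dots> = (\<Prod>k\<le>d. face_weight p k ^ (d choose k))"
    using prod_Pow_card[OF assms(2)] assms(3) by simp
  also have "\<dots> = (\<Prod>k\<in>{2..d}. face_weight p k ^ (d choose k))"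
    by (intro prod.mono_neutral_right) (auto simp: face_weight_def)
  also have "{2..d} = Suc ` {1..d-1}" using assms(1) by (simp add: image_Suc_atLeastAtMost numeral_2_eq_2)
  also have "(\<Prod>k\<in>Suc ` {1..d-1}. face_weight p k ^ (d choose k)) = q_param d p"
    unfolding q_param_def by (subst prod.reindex) (auto simp: face_weight_def intro!: prod.cong)
  finally show ?thesis .
qed

lemma prod_subset_le:
  fixes f :: "'a \<Rightarrow> real"
  assumes "finite A" "B \<subseteq> A" "\<And>x. x \<in> A \<Longrightarrow> f x \<in> {0..1}"
  shows "prod f A \<le> prod f B"
proof -
  have "prod f A = prod f (A - B) * prod f B" using assms by (intro prod.subset_diff) auto
  also have "\<dots> \<le> 1 * prod f B"
    using assms(2,3) by (intro mult_right_mono prod_le_1 prod_nonneg) auto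
  finally show ?thesis by simp
qed

text \<open>The second Bonferroni inequality, with the crude count \<open>card I\<close> squared for the number of pairs.\<close>

lemma (in prob_space) bonferroni_lower:
  assumes "finite I" "\<And>i. i \<in> I \<Longrightarrow> A i \<in> events" "\<And>i. i \<in> I \<Longrightarrow> prob (A i) = a"
    and "\<And>i j. i \<in> I \<Longrightarrow> j \<in> I \<Longrightarrow> i \<noteq> j \<Longrightarrow> prob (A i \<inter> A j) \<le> c" and "c \<ge> 0"
  shows "prob (\<Union>i\<in>I. A i) \<ge> real (card I) * a - (real (card I))\<^sup>2 * c"
  using assms
proof (induction I rule: finite_induct)
  case empty
  then show ?case by simp
next
  case (insert x I)
  let ?U = "\<Union>i\<in>I. A i"
  have U: "?U \<in> events" "A x \<in> events" using insert.prems(1) insert.hyps(1) by auto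
  have "prob (\<Union>i\<in>I. A x \<inter> A i) \<le> (\<Sum>i\<in>I. prob (A x \<inter> A i))"
    using insert.hyps insert.prems(1) by (intro finite_measure_subadditive_finite) auto
  also have "\<dots> \<le> (\<Sum>i\<in>I. c)"
    using insert.hyps insert.prems(3) by (intro sum_mono) auto
  finally have "prob (A x \<inter> ?U) \<le> real (card I) * c" by simp
  moreover have "prob (A x \<union> ?U) = prob (A x) + prob ?U - prob (A x \<inter> ?U)"
    using U by (intro measure_Un3) (auto simp: fmeasurable_eq_sets)
  moreover have "real (card I) * a - (real (card I))\<^sup>2 * c \<le> prob ?U"
    using insert by simp
  moreover have "prob (A x) = a" using insert.prems(2) by simp
  ultimately have "real (card I) * a + a - ((real (card I))\<^sup>2 * c + real (card I) * c) \<le> prob (A x \<union> ?U)"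
    by linarith
  moreover have "(real (card I))\<^sup>2 * c + real (card I) * c \<le> (real (card I) + 1)\<^sup>2 * c"
  proof -
    have "(real (card I))\<^sup>2 + real (card I) \<le> (real (card I) + 1)\<^sup>2" by (simp add: power2_eq_square algebra_simps)
    then show ?thesis using mult_right_mono[OF _ \<open>c \<ge> 0\<close>] by (metis distrib_right)
  qed
  ultimately show ?case using insert.hyps by (simp add: algebra_simps)
qed

text \<open>Given that \<open>\<tau>\<close> is a simplex, this says that \<open>insert w \<tau>\<close> is a simplex. Only coins of sets
containing \<open>w\<close> are involved, whence the independence for different \<open>w\<close>.\<close>

definition attach :: "(nat set \<Rightarrow> bool) \<Rightarrow> nat \<Rightarrow> nat set \<Rightarrow> bool" where
  "attach b w \<tau> \<longleftrightarrow> (\<forall>\<beta>\<subseteq>\<tau>. is_open b (insert w \<beta>))"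

locale face_model =
  fixes d n :: nat and p :: "nat \<Rightarrow> real"
  assumes d: "d \<ge> 1" and p: "\<And>k. k \<in> {1..d} \<Longrightarrow> p k \<in> {0..1}"
begin

abbreviation PR :: "((nat set \<Rightarrow> bool) \<Rightarrow> bool) \<Rightarrow> real" where
  "PR E \<equiv> measure_pmf.prob (coins d n p) {b. E b}"

abbreviation "wt \<alpha> \<equiv> face_weight p (card \<alpha>)"

lemma face_weight_01: "k \<le> d + 1 \<Longrightarrow> face_weight p k \<in> {0..1}"
proof (cases "k \<le> 1")
  case False
  moreover assume "k \<le> d + 1"
  ultimately have "k - 1 \<in> {1..d}" by auto
  then show ?thesis using p[of "k - 1"] False by (simp add: face_weight_def)
qed (simp add: face_weight_def)

text \<open>Coins of different sets are independent, and sets with at most one element have weight \<open>1\<close>.\<close>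

lemma prob_open:
  assumes F: "\<And>\<alpha>. \<alpha> \<in> F \<Longrightarrow> \<alpha> \<subseteq> {1..n} \<and> card \<alpha> \<le> d + 1"
  shows "PR (\<lambda>b. \<forall>\<alpha>\<in>F. is_open b \<alpha>) = (\<Prod>\<alpha>\<in>F. wt \<alpha>)"
proof -
  have finF: "finite F" by (rule finite_subset[of _ "Pow {1..n}"]) (use F in auto)
  have "{b. \<forall>\<alpha>\<in>F. is_open b \<alpha>} = Pi (slots d n) (\<lambda>\<alpha>. if \<alpha> \<in> F then {True} else UNIV)"
    using F by (auto simp: is_open_def slots_def Pi_def)
  then have "PR (\<lambda>b. \<forall>\<alpha>\<in>F. is_open b \<alpha>) =
      (\<Prod>\<alpha>\<in>slots d n. measure_pmf.prob (bernoulli_pmf (p (card \<alpha> - 1))) (if \<alpha> \<in> F then {True} else UNIV))"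
    unfolding coins_def by (simp add: measure_Pi_pmf_Pi finite_slots)
  also have "\<dots> = (\<Prod>\<alpha>\<in>slots d n. if \<alpha> \<in> F then wt \<alpha> else 1)"
  proof (rule prod.cong[OF refl])
    fix \<alpha> assume "\<alpha> \<in> slots d n"
    then have "card \<alpha> - 1 \<in> {1..d}" "2 \<le> card \<alpha>" by (auto simp: slots_def)
    then show "measure_pmf.prob (bernoulli_pmf (p (card \<alpha> - 1))) (if \<alpha> \<in> F then {True} else UNIV) =
        (if \<alpha> \<in> F then wt \<alpha> else 1)"
      using p[of "card \<alpha> - 1"] by (simp add: measure_pmf_single face_weight_def)
  qed
  also have "\<dots> = (\<Prod>\<alpha>\<in>slots d n \<inter> F. wt \<alpha>)"
    by (simp add: prod.inter_restrict finite_slots)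
  also have "\<dots> = (\<Prod>\<alpha>\<in>F. wt \<alpha>)"
    using F finF by (intro prod.mono_neutral_left) (auto simp: slots_def face_weight_def)
  finally show ?thesis .
qed

lemma open_prod_le:
  assumes "finite A" "B \<subseteq> A" "\<And>\<alpha>. \<alpha> \<in> A \<Longrightarrow> card \<alpha> \<le> d + 1"
  shows "(\<Prod>\<alpha>\<in>A. wt \<alpha>) \<le> (\<Prod>\<alpha>\<in>B. wt \<alpha>)"
  using assms face_weight_01 by (intro prod_subset_le) auto

lemma wt_prod_nonneg: "(\<And>\<alpha>. \<alpha> \<in> A \<Longrightarrow> card \<alpha> \<le> d + 1) \<Longrightarrow> (\<Prod>\<alpha>\<in>A. wt \<alpha>) \<ge> 0"
  using face_weight_01 by (intro prod_nonneg) auto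

lemma prod_wt_insert:
  assumes "w \<notin> \<Union>B" "\<And>\<beta>. \<beta> \<in> B \<Longrightarrow> finite \<beta>"
  shows "(\<Prod>\<alpha>\<in>insert w ` B. wt \<alpha>) = (\<Prod>\<beta>\<in>B. face_weight p (Suc (card \<beta>)))"
proof -
  have "inj_on (insert w) B"
  proof (rule inj_onI)
    fix x y assume "x \<in> B" "y \<in> B" "insert w x = insert w y"
    then show "x = y" using assms(1) by (metis UnionI insert_ident)
  qed
  then have "(\<Prod>\<alpha>\<in>insert w ` B. wt \<alpha>) = (\<Prod>\<beta>\<in>B. wt (insert w \<beta>))" by (simp add: prod.reindex)
  also have "\<dots> = (\<Prod>\<beta>\<in>B. face_weight p (Suc (card \<beta>)))"
  proof (rule prod.cong[OF refl])
    fix \<beta> assume "\<beta> \<in> B"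
    then have "w \<notin> \<beta>" "finite \<beta>" using assms by auto
    then show "wt (insert w \<beta>) = face_weight p (Suc (card \<beta>))" by simp
  qed
  finally show ?thesis .
qed

lemma prob_attach:
  assumes \<tau>: "\<tau> \<subseteq> {1..n}" "card \<tau> = d" and w: "w \<in> {1..n}" "w \<notin> \<tau>"
  shows "PR (\<lambda>b. attach b w \<tau>) = r_param d p"
proof -
  have fin: "finite \<tau>" using \<tau>(1) by (rule finite_subset) simp
  have "{b. attach b w \<tau>} = {b. \<forall>\<alpha>\<in>insert w ` Pow \<tau>. is_open b \<alpha>}"
    by (auto simp: attach_def)
  then have "PR (\<lambda>b. attach b w \<tau>) = PR (\<lambda>b. \<forall>\<alpha>\<in>insert w ` Pow \<tau>. is_open b \<alpha>)" by simp
  also have "\<dots> = (\<Prod>\<alpha>\<in>insert w ` Pow \<tau>. wt \<alpha>)"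
  proof (rule prob_open)
    fix \<alpha> assume "\<alpha> \<in> insert w ` Pow \<tau>"
    then obtain \<beta> where "\<beta> \<subseteq> \<tau>" "\<alpha> = insert w \<beta>" by auto
    moreover have "card (insert w \<beta>) \<le> Suc (card \<beta>)" by (rule card_insert_le_m1) auto
    ultimately show "\<alpha> \<subseteq> {1..n} \<and> card \<alpha> \<le> d + 1" using \<tau> w card_mono[OF fin, of \<beta>] by auto
  qed
  also have "\<dots> = (\<Prod>\<beta>\<in>Pow \<tau>. face_weight p (Suc (card \<beta>)))"
    by (rule prod_wt_insert) (use w fin in \<open>auto intro: finite_subset\<close>)
  also have "\<dots> = r_param d p" by (rule prod_Pow_r_param) (use fin \<tau> in auto)
  finally show ?thesis .
qed

text \<open>A second simplex \<open>\<tau>'\<close> contains a vertex \<open>u\<close> outside of \<open>\<tau>\<close>. Besides the faces over \<open>\<tau>\<close>, at least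
all faces of \<open>insert w \<tau>'\<close> over the edge between \<open>w\<close> and \<open>u\<close> have to be present.\<close>

lemma prob_attach_two:
  assumes \<tau>: "\<tau> \<subseteq> {1..n}" "card \<tau> = d" and \<tau>': "\<tau>' \<subseteq> {1..n}" "card \<tau>' = d" "\<tau> \<noteq> \<tau>'"
    and w: "w \<in> {1..n}" "w \<notin> \<tau>" "w \<notin> \<tau>'"
  shows "PR (\<lambda>b. attach b w \<tau> \<and> attach b w \<tau>') \<le> r_param d p * s_param d p"
proof -
  have fin: "finite \<tau>" "finite \<tau>'" using \<tau>(1) \<tau>'(1) by (auto intro: finite_subset)
  obtain u where u: "u \<in> \<tau>'" "u \<notin> \<tau>"
    using card_subset_eq[OF fin(1), of \<tau>'] \<tau>(2) \<tau>'(2,3) by blast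
  let ?B = "Pow \<tau> \<union> insert u ` Pow (\<tau>' - {u})"
  have BP: "?B \<subseteq> Pow \<tau> \<union> Pow \<tau>'" using u(1) by auto
  have fB: "finite \<beta>" "card \<beta> \<le> d" "\<beta> \<subseteq> {1..n}" "w \<notin> \<beta>" if h: "\<beta> \<in> ?B" for \<beta>
  proof -
    consider "\<beta> \<subseteq> \<tau>" | "\<beta> \<subseteq> \<tau>'" using h BP by blast
    then show "finite \<beta>" "card \<beta> \<le> d" "\<beta> \<subseteq> {1..n}" "w \<notin> \<beta>"
      using \<tau> \<tau>' fin w card_mono[of \<tau> \<beta>] card_mono[of \<tau>' \<beta>] finite_subset by (cases; auto)+
  qed
  have cB: "\<alpha> \<subseteq> {1..n} \<and> card \<alpha> \<le> d + 1" if h: "\<alpha> \<in> insert w ` ?B" for \<alpha>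
  proof -
    obtain \<beta> where "\<beta> \<in> ?B" "\<alpha> = insert w \<beta>" using h by blast
    then show ?thesis using fB[of \<beta>] w(1) by auto
  qed
  have "PR (\<lambda>b. attach b w \<tau> \<and> attach b w \<tau>') \<le> PR (\<lambda>b. \<forall>\<alpha>\<in>insert w ` ?B. is_open b \<alpha>)"
  proof (rule measure_pmf.finite_measure_mono)
    show "{b. attach b w \<tau> \<and> attach b w \<tau>'} \<subseteq> {b. \<forall>\<alpha>\<in>insert w ` ?B. is_open b \<alpha>}"
    proof (intro subsetI CollectI ballI)
      fix b \<alpha> assume h: "b \<in> {b. attach b w \<tau> \<and> attach b w \<tau>'}" "\<alpha> \<in> insert w ` ?B"
      then obtain \<beta> where "\<beta> \<in> ?B" "\<alpha> = insert w \<beta>" by blast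
      then show "is_open b \<alpha>" using h(1) subsetD[OF BP, of \<beta>] unfolding attach_def by blast
    qed
  qed simp
  also have "\<dots> = (\<Prod>\<alpha>\<in>insert w ` ?B. wt \<alpha>)"
    by (rule prob_open) (use cB in blast)
  also have "\<dots> = (\<Prod>\<beta>\<in>?B. face_weight p (Suc (card \<beta>)))"
  proof (rule prod_wt_insert)
    show "w \<notin> \<Union>?B" using fB(4) by (meson UnionE)
  qed (rule fB(1))
  also have "\<dots> = (\<Prod>\<beta>\<in>Pow \<tau>. face_weight p (Suc (card \<beta>))) *
      (\<Prod>\<beta>\<in>insert u ` Pow (\<tau>' - {u}). face_weight p (Suc (card \<beta>)))"
    using fin u(2) by (intro prod.union_disjoint) auto
  also have "(\<Prod>\<beta>\<in>Pow \<tau>. face_weight p (Suc (card \<beta>))) = r_param d p"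
    by (rule prod_Pow_r_param) (use fin \<tau> in auto)
  also have "(\<Prod>\<beta>\<in>insert u ` Pow (\<tau>' - {u}). face_weight p (Suc (card \<beta>))) =
      (\<Prod>\<gamma>\<in>Pow (\<tau>' - {u}). face_weight p (Suc (card (insert u \<gamma>))))"
    by (subst prod.reindex) (auto simp: inj_on_def)
  also have "\<dots> = (\<Prod>\<gamma>\<in>Pow (\<tau>' - {u}). face_weight p (Suc (Suc (card \<gamma>))))"
  proof (rule prod.cong[OF refl])
    fix \<gamma> assume "\<gamma> \<in> Pow (\<tau>' - {u})"
    then have "u \<notin> \<gamma>" "finite \<gamma>" using fin by (auto intro: finite_subset)
    then show "face_weight p (Suc (card (insert u \<gamma>))) = face_weight p (Suc (Suc (card \<gamma>)))" by simp
  qed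
  also have "\<dots> = s_param d p"
    by (rule prod_Pow_s_param) (use d fin \<tau>' u in auto)
  finally show ?thesis .
qed

lemma params_01: "r_param d p \<in> {0..1}" "s_param d p \<in> {0..1}"
proof -
  have "p k ^ m \<in> {0..1}" if "k \<in> {1..d}" for k m using p[OF that] by (auto intro: power_le_one)
  then show "r_param d p \<in> {0..1}" "s_param d p \<in> {0..1}"
    unfolding r_param_def s_param_def by (auto intro!: prod_nonneg prod_le_1)
qed

text \<open>A vertex outside is attached to one of the simplices of \<open>I\<close> with probability about \<open>card I\<close> times
\<open>r_param\<close>: the union bound gives one inequality, Bonferroni the other one, as attachments to two
simplices at once are rarer by a factor \<open>s_param\<close>.\<close>

lemma prob_isolated:
  assumes U: "U \<subseteq> {1..n}" and I: "\<And>\<tau>. \<tau> \<in> I \<Longrightarrow> \<tau> \<subseteq> U \<and> card \<tau> = d"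
    and w: "w \<in> {1..n}" "w \<notin> U"
  shows "PR (\<lambda>b. \<forall>\<tau>\<in>I. \<not> attach b w \<tau>) \<ge> 1 - real (card I) * r_param d p"
    "PR (\<lambda>b. \<forall>\<tau>\<in>I. \<not> attach b w \<tau>) \<le>
       1 - (real (card I) * r_param d p - (real (card I))\<^sup>2 * (r_param d p * s_param d p))"
proof -
  have finI: "finite I" by (rule finite_subset[of _ "Pow {1..n}"]) (use I U in blast)+
  let ?A = "\<lambda>\<tau>. {b. attach b w \<tau>}"
  have A: "measure_pmf.prob (coins d n p) (?A \<tau>) = r_param d p" if "\<tau> \<in> I" for \<tau>
    by (rule prob_attach) (use I[OF that] U w in auto)
  have "measure_pmf.prob (coins d n p) (\<Union>\<tau>\<in>I. ?A \<tau>) \<ge>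
     real (card I) * r_param d p - (real (card I))\<^sup>2 * (r_param d p * s_param d p)"
  proof (rule measure_pmf.bonferroni_lower[OF finI _ A])
    fix \<tau> \<tau>' assume h: "\<tau> \<in> I" "\<tau>' \<in> I" "\<tau> \<noteq> \<tau>'"
    have "{b. attach b w \<tau>} \<inter> {b. attach b w \<tau>'} = {b. attach b w \<tau> \<and> attach b w \<tau>'}" by blast
    then show "measure_pmf.prob (coins d n p) ({b. attach b w \<tau>} \<inter> {b. attach b w \<tau>'}) \<le> r_param d p * s_param d p"
      using prob_attach_two[of \<tau> \<tau>' w] I[OF h(1)] I[OF h(2)] U w h(3) by auto
  qed (use params_01 in auto)
  moreover have "measure_pmf.prob (coins d n p) (\<Union>\<tau>\<in>I. ?A \<tau>) \<le> (\<Sum>\<tau>\<in>I. measure_pmf.prob (coins d n p) (?A \<tau>))"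
    using finI by (intro measure_pmf.finite_measure_subadditive_finite) auto
  moreover have "(\<Sum>\<tau>\<in>I. measure_pmf.prob (coins d n p) (?A \<tau>)) = real (card I) * r_param d p"
    using A by simp
  moreover have "PR (\<lambda>b. \<forall>\<tau>\<in>I. \<not> attach b w \<tau>) = 1 - measure_pmf.prob (coins d n p) (\<Union>\<tau>\<in>I. ?A \<tau>)"
  proof -
    have "{b. \<forall>\<tau>\<in>I. \<not> attach b w \<tau>} = UNIV - (\<Union>\<tau>\<in>I. ?A \<tau>)" by auto
    then show ?thesis using measure_pmf.prob_compl[of "\<Union>\<tau>\<in>I. ?A \<tau>" "coins d n p"] by simp
  qed
  ultimately show "PR (\<lambda>b. \<forall>\<tau>\<in>I. \<not> attach b w \<tau>) \<ge> 1 - real (card I) * r_param d p"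
    "PR (\<lambda>b. \<forall>\<tau>\<in>I. \<not> attach b w \<tau>) \<le>
       1 - (real (card I) * r_param d p - (real (card I))\<^sup>2 * (r_param d p * s_param d p))" by linarith+
qed

text \<open>The faces in \<open>F\<close> lie inside \<open>U\<close>, and the attachments of \<open>w\<close> depend on coins of sets that meet the
complement of \<open>U\<close> exactly in \<open>w\<close>. These are disjoint groups of coins.\<close>

lemma prob_open_isolated:
  assumes U: "U \<subseteq> {1..n}" and F: "\<And>\<alpha>. \<alpha> \<in> F \<Longrightarrow> \<alpha> \<subseteq> U \<and> card \<alpha> \<le> d + 1"
    and I: "\<And>\<tau>. \<tau> \<in> I \<Longrightarrow> \<tau> \<subseteq> U \<and> card \<tau> = d" and W: "finite W" "W \<subseteq> {1..n} - U"
  shows "PR (\<lambda>b. (\<forall>\<alpha>\<in>F. is_open b \<alpha>) \<and> (\<forall>w\<in>W. \<forall>\<tau>\<in>I. \<not> attach b w \<tau>)) =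
    (\<Prod>\<alpha>\<in>F. wt \<alpha>) * (\<Prod>w\<in>W. PR (\<lambda>b. \<forall>\<tau>\<in>I. \<not> attach b w \<tau>))"
  using W
proof (induction W rule: finite_induct)
  case empty
  have "PR (\<lambda>b. \<forall>\<alpha>\<in>F. is_open b \<alpha>) = (\<Prod>\<alpha>\<in>F. wt \<alpha>)" by (rule prob_open) (use F U in blast)
  then show ?case by simp
next
  case (insert w W)
  let ?E = "{b. (\<forall>\<alpha>\<in>F. is_open b \<alpha>) \<and> (\<forall>w\<in>W. \<forall>\<tau>\<in>I. \<not> attach b w \<tau>)}"
  let ?G = "{b. \<forall>\<tau>\<in>I. \<not> attach b w \<tau>}"
  let ?C = "{\<alpha> \<in> slots d n. \<alpha> \<subseteq> U \<union> W}"
  let ?D = "{\<alpha> \<in> slots d n. w \<in> \<alpha> \<and> \<alpha> \<subseteq> insert w U}"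
  have W: "W \<subseteq> {1..n} - U" "w \<in> {1..n}" "w \<notin> U" using insert.prems by auto
  have eqo: "is_open b \<alpha> \<longleftrightarrow> is_open b' \<alpha>" if "2 \<le> card \<alpha> \<Longrightarrow> b \<alpha> = b' \<alpha>" for b b' \<alpha>
    using that by (auto simp: is_open_def)
  have att: "attach b v \<tau> \<longleftrightarrow> attach b' v \<tau>"
    if h: "\<tau> \<in> I" "v \<in> {1..n} - U" "\<forall>\<alpha>\<in>slots d n. v \<in> \<alpha> \<and> \<alpha> \<subseteq> insert v U \<longrightarrow> b \<alpha> = b' \<alpha>" for b b' v \<tau>
  proof -
    have "is_open b (insert v \<beta>) \<longleftrightarrow> is_open b' (insert v \<beta>)" if "\<beta> \<subseteq> \<tau>" for \<beta>
    proof (rule eqo)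
      assume c: "2 \<le> card (insert v \<beta>)"
      have fin: "finite \<tau>" using I[OF h(1)] U finite_subset by (meson finite_atLeastAtMost)
      have "card \<beta> \<le> d" using card_mono[OF fin that] I[OF h(1)] by simp
      then have "card (insert v \<beta>) \<le> d + 1" by (metis Suc_eq_plus1 Suc_le_mono card_insert_le_m1 diff_Suc_1 le_trans le_SucI zero_less_Suc)
      then have "insert v \<beta> \<in> slots d n" using c h(2) I[OF h(1)] U that by (auto simp: slots_def)
      then show "b (insert v \<beta>) = b' (insert v \<beta>)" using h(3) I[OF h(1)] that by blast
    qed
    then show ?thesis by (simp add: attach_def)
  qed
  have "depends_on ?C ?E"
    unfolding depends_on_def
  proof (intro allI impI)
    fix b b' :: "nat set \<Rightarrow> bool" assume eq: "\<forall>\<alpha>\<in>?C. b \<alpha> = b' \<alpha>"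
    have "is_open b \<alpha> \<longleftrightarrow> is_open b' \<alpha>" if "\<alpha> \<in> F" for \<alpha>
    proof (rule eqo)
      assume "2 \<le> card \<alpha>"
      then have "\<alpha> \<in> ?C" using F[OF that] U by (auto simp: slots_def)
      then show "b \<alpha> = b' \<alpha>" using eq by blast
    qed
    moreover have "attach b v \<tau> \<longleftrightarrow> attach b' v \<tau>" if "v \<in> W" "\<tau> \<in> I" for v \<tau>
      by (rule att[OF that(2)]) (use W(1) that(1) eq in auto)
    ultimately show "b \<in> ?E \<longleftrightarrow> b' \<in> ?E" by simp
  qed
  moreover have "depends_on ?D ?G"
    unfolding depends_on_def
  proof (intro allI impI)
    fix b b' :: "nat set \<Rightarrow> bool" assume eq: "\<forall>\<alpha>\<in>?D. b \<alpha> = b' \<alpha>"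
    have "attach b w \<tau> \<longleftrightarrow> attach b' w \<tau>" if "\<tau> \<in> I" for \<tau>
      by (rule att[OF that]) (use W eq in auto)
    then show "b \<in> ?G \<longleftrightarrow> b' \<in> ?G" by simp
  qed
  moreover have "?C \<inter> ?D = {}" using W insert.hyps by blast
  ultimately have "measure_pmf.prob (coins d n p) (?E \<inter> ?G) =
      measure_pmf.prob (coins d n p) ?E * measure_pmf.prob (coins d n p) ?G"
    unfolding coins_def using prob_Pi_pmf_indep[OF finite_slots, of ?C d n ?D ?E ?G] by blast
  moreover have "?E \<inter> ?G = {b. (\<forall>\<alpha>\<in>F. is_open b \<alpha>) \<and> (\<forall>v\<in>insert w W. \<forall>\<tau>\<in>I. \<not> attach b v \<tau>)}" by auto
  ultimately show ?case using insert.IH[OF W(1)] insert.hyps by (simp add: mult.commute mult.left_commute)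
qed

lemma prob_open_isolated_bounds:
  assumes U: "U \<subseteq> {1..n}" and F: "\<And>\<alpha>. \<alpha> \<in> F \<Longrightarrow> \<alpha> \<subseteq> U \<and> card \<alpha> \<le> d + 1"
    and I: "\<And>\<tau>. \<tau> \<in> I \<Longrightarrow> \<tau> \<subseteq> U \<and> card \<tau> = d"
  shows "real (card I) * r_param d p \<le> 1 \<Longrightarrow> 
    PR (\<lambda>b. (\<forall>\<alpha>\<in>F. is_open b \<alpha>) \<and> (\<forall>w\<in>{1..n} - U. \<forall>\<tau>\<in>I. \<not> attach b w \<tau>)) \<ge>
      (\<Prod>\<alpha>\<in>F. wt \<alpha>) * (1 - real (card I) * r_param d p) ^ (n - card U)"
    "PR (\<lambda>b. (\<forall>\<alpha>\<in>F. is_open b \<alpha>) \<and> (\<forall>w\<in>{1..n} - U. \<forall>\<tau>\<in>I. \<not> attach b w \<tau>)) \<le>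
      (\<Prod>\<alpha>\<in>F. wt \<alpha>) * exp (- (real (card I) * r_param d p -
          (real (card I))\<^sup>2 * (r_param d p * s_param d p)) * real (n - card U))"
proof -
  let ?x = "real (card I) * r_param d p - (real (card I))\<^sup>2 * (r_param d p * s_param d p)"
  have c: "card ({1..n} - U) = n - card U" using U by (simp add: card_Diff_subset finite_subset)
  have eq: "PR (\<lambda>b. (\<forall>\<alpha>\<in>F. is_open b \<alpha>) \<and> (\<forall>w\<in>{1..n} - U. \<forall>\<tau>\<in>I. \<not> attach b w \<tau>)) =
    (\<Prod>\<alpha>\<in>F. wt \<alpha>) * (\<Prod>w\<in>{1..n} - U. PR (\<lambda>b. \<forall>\<tau>\<in>I. \<not> attach b w \<tau>))"
    by (rule prob_open_isolated[OF U F I]) auto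
  have nn: "(\<Prod>\<alpha>\<in>F. wt \<alpha>) \<ge> 0" by (rule wt_prod_nonneg) (use F in blast)
  {
    assume le: "real (card I) * r_param d p \<le> 1"
    have "(1 - real (card I) * r_param d p) ^ (n - card U) = (\<Prod>w\<in>{1..n} - U. 1 - real (card I) * r_param d p)"
      using c by simp
    also have "\<dots> \<le> (\<Prod>w\<in>{1..n} - U. PR (\<lambda>b. \<forall>\<tau>\<in>I. \<not> attach b w \<tau>))"
      using prob_isolated(1)[OF U I] le by (intro prod_mono) auto
    finally show "PR (\<lambda>b. (\<forall>\<alpha>\<in>F. is_open b \<alpha>) \<and> (\<forall>w\<in>{1..n} - U. \<forall>\<tau>\<in>I. \<not> attach b w \<tau>)) \<ge>
      (\<Prod>\<alpha>\<in>F. wt \<alpha>) * (1 - real (card I) * r_param d p) ^ (n - card U)"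
      unfolding eq using nn by (rule mult_left_mono)
  }
  have "(\<Prod>w\<in>{1..n} - U. PR (\<lambda>b. \<forall>\<tau>\<in>I. \<not> attach b w \<tau>)) \<le> (\<Prod>w\<in>{1..n} - U. exp (- ?x))"
  proof (rule prod_mono, safe)
    fix w assume w: "w \<in> {1..n}" "w \<notin> U"
    have "PR (\<lambda>b. \<forall>\<tau>\<in>I. \<not> attach b w \<tau>) \<le> 1 - ?x" using prob_isolated(2)[OF U I w] .
    also have "\<dots> \<le> exp (- ?x)" using exp_ge_add_one_self[of "- ?x"] by linarith
    finally show "PR (\<lambda>b. \<forall>\<tau>\<in>I. \<not> attach b w \<tau>) \<le> exp (- ?x)" .
  qed auto
  also have "\<dots> = exp (- ?x * real (n - card U))" using c by (simp add: exp_of_nat2_mult)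
  finally show "PR (\<lambda>b. (\<forall>\<alpha>\<in>F. is_open b \<alpha>) \<and> (\<forall>w\<in>{1..n} - U. \<forall>\<tau>\<in>I. \<not> attach b w \<tau>)) \<le>
      (\<Prod>\<alpha>\<in>F. wt \<alpha>) * exp (- ?x * real (n - card U))"
    unfolding eq using nn by (rule mult_left_mono)
qed

end

section \<open>Copies of a tree in the random complex\<close>

definition embeddings :: "nat \<Rightarrow> (tree_vertex fset \<Rightarrow> nat) \<Rightarrow> nat \<Rightarrow> nat \<Rightarrow> (tree_vertex \<Rightarrow> nat) set" where
  "embeddings d N r n = {\<phi> \<in> vertices (grow d N r) \<rightarrow>\<^sub>E {1..n}. ordered_embedding d N r \<phi>}"

text \<open>The root has to be required as a simplex, because the ball of radius \<open>0\<close> around an arbitrary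
vertex set consists of the faces of this set.\<close>

definition found :: "nat \<Rightarrow> (tree_vertex fset \<Rightarrow> nat) \<Rightarrow> nat \<Rightarrow> nat set set \<Rightarrow> (tree_vertex \<Rightarrow> nat) \<Rightarrow> bool" where
  "found d N r X \<phi> \<longleftrightarrow> \<phi> ` tree_root d \<in> X \<and> nbhd d X (\<phi> ` tree_root d) r = (`) \<phi> ` grow d N r"

lemma nbhd_subset_complex:
  assumes X: "\<And>\<alpha> \<beta>. \<alpha> \<in> X \<Longrightarrow> \<beta> \<subseteq> \<alpha> \<Longrightarrow> \<beta> \<noteq> {} \<Longrightarrow> \<beta> \<in> X" and "\<sigma> \<in> X"
  shows "nbhd d X \<sigma> k \<subseteq> X"
proof (induction k)
  case 0
  then show ?case using assms by (auto simp: faces_def)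
next
  case (Suc k)
  have "faces \<rho> \<subseteq> X" if "\<rho> \<in> simplices d X" for \<rho>
    using that X by (auto simp: faces_def simplices_def)
  then show ?case using Suc unfolding nbhd.simps Let_def by blast
qed

lemma coin_complex_down: "\<alpha> \<in> coin_complex d n b \<Longrightarrow> \<beta> \<subseteq> \<alpha> \<Longrightarrow> \<beta> \<noteq> {} \<Longrightarrow> \<beta> \<in> coin_complex d n b"
proof -
  assume h: "\<alpha> \<in> coin_complex d n b" "\<beta> \<subseteq> \<alpha>" "\<beta> \<noteq> {}"
  then have "finite \<alpha>" by (auto simp: coin_complex_def intro: finite_subset)
  then have "card \<beta> \<le> card \<alpha>" using h(2) by (rule card_mono)
  then show "\<beta> \<in> coin_complex d n b" using h by (auto simp: coin_complex_def)
qed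

lemma coin_complex_subset: "\<alpha> \<in> coin_complex d n b \<Longrightarrow> \<alpha> \<subseteq> {1..n}"
  by (simp add: coin_complex_def)

lemma coin_complex_open: "\<alpha> \<in> coin_complex d n b \<Longrightarrow> \<beta> \<subseteq> \<alpha> \<Longrightarrow> is_open b \<beta>"
  by (simp add: coin_complex_def)

lemma is_open_empty [simp]: "is_open b {}"
  by (simp add: is_open_def)

lemma finite_embeddings: "d \<ge> 1 \<Longrightarrow> finite (embeddings d N r n)"
  by (rule finite_subset[of _ "vertices (grow d N r) \<rightarrow>\<^sub>E {1..n}"])
    (auto simp: embeddings_def intro!: finite_PiE finite_vertices_grow)

text \<open>Bounds the contribution of the pairs of embeddings with intersecting images. The set \<open>W\<close> runs over
the possible parts of the second tree that hit the first one; \<open>x\<close> stands for \<open>n\<close> times \<open>r_param\<close>.\<close>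

definition overlap_const :: "nat \<Rightarrow> (tree_vertex fset \<Rightarrow> nat) \<Rightarrow> nat \<Rightarrow> real \<Rightarrow> real" where
  "overlap_const d N r x = (\<Sum>W\<in>Pow (vertices (grow d N r)) - {{}}.
     real (card (vertices (grow d N r)) ^ card (vertices (grow d N r))) * (1 / x) ^ (card W - 1))"

text \<open>One fixed ball \<open>T\<close> of a tree, with vertex set \<open>V\<close> and \<open>m\<close> simplices \<open>I\<close> whose attached vertices
belong to the ball.\<close>

locale tree_model = face_model d n p for d n p +
  fixes N :: "tree_vertex fset \<Rightarrow> nat" and r :: nat
begin

abbreviation "T \<equiv> grow d N r"
abbreviation "V \<equiv> vertices T"
abbreviation "I \<equiv> parents d N r"
abbreviation "m \<equiv> card I"
abbreviation "hit \<phi> b \<equiv> found d N r (coin_complex d n b) \<phi>"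
abbreviation "r1 \<equiv> r_param d p"
abbreviation "s1 \<equiv> s_param d p"
abbreviation "wT \<equiv> \<Prod>\<alpha>\<in>T. wt \<alpha>"

lemma wT_eq: "wT = q_param d p * r1 ^ (\<Sum>t\<in>I. N t)"
proof -
  have "(\<Prod>t\<in>I. (\<Prod>\<beta>\<in>Pow (fset t). face_weight p (Suc (card \<beta>))) ^ N t) = (\<Prod>t\<in>I. r1 ^ N t)"
    using parents_grow(2)[OF d] by (intro prod.cong refl) (simp add: prod_Pow_r_param)
  also have "\<dots> = r1 ^ (\<Sum>t\<in>I. N t)" by (simp add: power_sum)
  finally show ?thesis
    using prod_grow[OF d, of "face_weight p" N r] prod_faces_q_param[OF d finite_tree_root] by simp
qed

lemma wT_nonneg: "wT \<ge> 0"
  using wt_prod_nonneg[of T] grow_card_le[OF d] by blast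

lemma finV: "finite V" by (rule finite_vertices_grow[OF d])

lemma TV: "\<alpha> \<in> T \<Longrightarrow> \<alpha> \<subseteq> V" by (rule vertices_grow_sub)

lemma embD:
  assumes "\<phi> \<in> embeddings d N r n"
  shows "inj_on \<phi> V" "\<phi> ` V \<subseteq> {1..n}" "card (\<phi> ` V) = card V"
    and "\<And>\<alpha>. \<alpha> \<subseteq> V \<Longrightarrow> card (\<phi> ` \<alpha>) = card \<alpha>" "\<And>\<alpha>. \<alpha> \<subseteq> V \<Longrightarrow> \<phi> ` \<alpha> \<subseteq> {1..n}"
proof -
  show i: "inj_on \<phi> V" and s: "\<phi> ` V \<subseteq> {1..n}"
    using assms by (auto simp: embeddings_def ordered_embedding_def)
  show "card (\<phi> ` V) = card V" using i by (rule card_image)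
  show "card (\<phi> ` \<alpha>) = card \<alpha>" if "\<alpha> \<subseteq> V" for \<alpha>
    using inj_on_subset[OF i that] by (rule card_image)
  show "\<phi> ` \<alpha> \<subseteq> {1..n}" if "\<alpha> \<subseteq> V" for \<alpha> using s that by blast
qed

lemma inj_image: "\<phi> \<in> embeddings d N r n \<Longrightarrow> inj_on ((`) \<phi>) (Pow V)"
  by (meson embD(1) inj_on_image_Pow)

lemma prod_image:
  assumes "\<phi> \<in> embeddings d N r n" "S \<subseteq> T"
  shows "(\<Prod>\<alpha>\<in>(`) \<phi> ` S. wt \<alpha>) = (\<Prod>\<alpha>\<in>S. wt \<alpha>)"
proof -
  have "S \<subseteq> Pow V" using assms(2) TV by blast
  then have "inj_on ((`) \<phi>) S" using inj_image[OF assms(1)] inj_on_subset by blast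
  then have "(\<Prod>\<alpha>\<in>(`) \<phi> ` S. wt \<alpha>) = (\<Prod>\<alpha>\<in>S. wt (\<phi> ` \<alpha>))" by (simp add: prod.reindex)
  also have "\<dots> = (\<Prod>\<alpha>\<in>S. wt \<alpha>)"
    using \<open>S \<subseteq> Pow V\<close> embD(4)[OF assms(1)] by (intro prod.cong) auto
  finally show ?thesis .
qed

lemma image_cell_card:
  assumes "\<phi> \<in> embeddings d N r n" "\<alpha> \<in> (`) \<phi> ` T"
  shows "\<alpha> \<subseteq> \<phi> ` V \<and> card \<alpha> \<le> d + 1" "\<alpha> \<subseteq> {1..n} \<and> card \<alpha> \<le> d + 1" "\<alpha> \<noteq> {}"
proof -
  obtain \<beta> where \<beta>: "\<beta> \<in> T" "\<alpha> = \<phi> ` \<beta>" using assms(2) by blast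
  show "\<alpha> \<subseteq> \<phi> ` V \<and> card \<alpha> \<le> d + 1" "\<alpha> \<subseteq> {1..n} \<and> card \<alpha> \<le> d + 1" "\<alpha> \<noteq> {}"
    using \<beta> TV[OF \<beta>(1)] embD(4,5)[OF assms(1) TV[OF \<beta>(1)]] grow_card_le[OF d \<beta>(1)] grow_complex[OF \<beta>(1)]
    by auto
qed

lemma image_parents:
  assumes "\<phi> \<in> embeddings d N r n" "\<tau> \<in> (\<lambda>t. \<phi> ` fset t) ` I"
  shows "\<tau> \<subseteq> \<phi> ` V \<and> card \<tau> = d" "\<tau> \<in> (`) \<phi> ` T"
proof -
  obtain t where t: "t \<in> I" "\<tau> = \<phi> ` fset t" using assms(2) by blast
  show "\<tau> \<in> (`) \<phi> ` T" using t parents_grow(1)[OF d t(1)] by blast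
  show "\<tau> \<subseteq> \<phi> ` V \<and> card \<tau> = d"
    using t parents_grow[OF d t(1)] TV[OF parents_grow(1)[OF d t(1)]] embD(4)[OF assms(1)] by auto
qed

lemma card_image_parents:
  assumes "\<phi> \<in> embeddings d N r n"
  shows "card ((\<lambda>t. \<phi> ` fset t) ` I) = m"
proof (rule card_image, rule inj_onI)
  fix t t' assume "t \<in> I" "t' \<in> I" "\<phi> ` fset t = \<phi> ` fset t'"
  then show "t = t'"
    using inj_on_image_eq_iff[OF embD(1)[OF assms], of "fset t" "fset t'"] TV parents_grow(1)[OF d]
    by (simp add: fset_inject)
qed

lemma image_subset_coin_complex_iff:
  assumes \<phi>: "\<phi> \<in> embeddings d N r n"
  shows "(`) \<phi> ` T \<subseteq> coin_complex d n b \<longleftrightarrow> (\<forall>\<alpha>\<in>(`) \<phi> ` T. is_open b \<alpha>)"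
proof
  assume "(`) \<phi> ` T \<subseteq> coin_complex d n b"
  then show "\<forall>\<alpha>\<in>(`) \<phi> ` T. is_open b \<alpha>" by (auto simp: coin_complex_def)
next
  assume o: "\<forall>\<alpha>\<in>(`) \<phi> ` T. is_open b \<alpha>"
  show "(`) \<phi> ` T \<subseteq> coin_complex d n b"
  proof
    fix \<alpha> assume \<alpha>: "\<alpha> \<in> (`) \<phi> ` T"
    have "is_open b \<beta>" if \<beta>: "\<beta> \<subseteq> \<alpha>" for \<beta>
    proof (cases "\<beta> = {}")
      case False
      obtain \<alpha>' where \<alpha>': "\<alpha>' \<in> T" "\<alpha> = \<phi> ` \<alpha>'" using \<alpha> by blast
      then obtain \<beta>' where \<beta>': "\<beta>' \<subseteq> \<alpha>'" "\<beta> = \<phi> ` \<beta>'" using \<beta> by (meson subset_imageE)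
      then have "\<beta>' \<in> T" using grow_complex[OF \<alpha>'(1)] False by auto
      then show ?thesis using o \<beta>'(2) by blast
    qed simp
    then show "\<alpha> \<in> coin_complex d n b" using image_cell_card[OF \<phi> \<alpha>] by (simp add: coin_complex_def)
  qed
qed

lemma insert_in_coin_complex:
  assumes \<tau>: "\<tau> \<in> coin_complex d n b" "card \<tau> = d" and w: "w \<in> {1..n}" "attach b w \<tau>"
  shows "insert w \<tau> \<in> coin_complex d n b"
proof -
  have fin: "finite \<tau>" using \<tau>(1) by (auto simp: coin_complex_def intro: finite_subset)
  have "is_open b \<alpha>" if "\<alpha> \<subseteq> insert w \<tau>" for \<alpha>
  proof (cases "w \<in> \<alpha>")
    case True
    then have "\<alpha> = insert w (\<alpha> - {w})" "\<alpha> - {w} \<subseteq> \<tau>" using that by auto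
    then show ?thesis using w(2) unfolding attach_def by metis
  next
    case False
    then have "\<alpha> \<subseteq> \<tau>" using that by blast
    then show ?thesis using \<tau>(1) by (simp add: coin_complex_def)
  qed
  moreover have "card (insert w \<tau>) \<le> d + 1" using fin \<tau>(2) by (simp add: card_insert_if)
  ultimately show ?thesis using \<tau>(1) w(1) by (simp add: coin_complex_def)
qed

lemma hit_imp:
  assumes \<phi>: "\<phi> \<in> embeddings d N r n" and hit: "hit \<phi> b"
  shows "\<forall>\<alpha>\<in>(`) \<phi> ` T. is_open b \<alpha>"
    and "\<forall>w\<in>{1..n} - \<phi> ` V. \<forall>\<tau>\<in>(\<lambda>t. \<phi> ` fset t) ` I. \<not> attach b w \<tau>"
proof -
  let ?X = "coin_complex d n b"
  have sub: "(`) \<phi> ` T \<subseteq> ?X"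
  proof -
    have "\<phi> ` tree_root d \<in> ?X" using hit by (simp add: found_def)
    from nbhd_subset_complex[OF _ this] have "nbhd d ?X (\<phi> ` tree_root d) r \<subseteq> ?X"
      by (meson coin_complex_down)
    then show ?thesis using hit by (simp add: found_def)
  qed
  then show "\<forall>\<alpha>\<in>(`) \<phi> ` T. is_open b \<alpha>" by (simp add: image_subset_coin_complex_iff[OF \<phi>])
  have R: "\<forall>\<rho>\<in>simplices d ?X. \<forall>t\<in>I. \<phi> ` fset t \<subseteq> \<rho> \<longrightarrow> \<rho> \<in> (`) \<phi> ` T"
    using nbhd_eq_image_iff[OF d embD(1)[OF \<phi>] sub] hit by (simp add: found_def)
  show "\<forall>w\<in>{1..n} - \<phi> ` V. \<forall>\<tau>\<in>(\<lambda>t. \<phi> ` fset t) ` I. \<not> attach b w \<tau>"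
  proof (intro ballI notI)
    fix w \<tau> assume w: "w \<in> {1..n} - \<phi> ` V" and \<tau>: "\<tau> \<in> (\<lambda>t. \<phi> ` fset t) ` I" and a: "attach b w \<tau>"
    have c: "card \<tau> = d" "\<tau> \<subseteq> \<phi> ` V" "\<tau> \<in> ?X" using image_parents[OF \<phi> \<tau>] sub by blast+
    have "insert w \<tau> \<in> ?X" by (rule insert_in_coin_complex[OF c(3,1) _ a]) (use w in simp)
    moreover have "card (insert w \<tau>) = d + 1"
      using c w finite_subset[OF c(2)] finV by (subst card_insert_disjoint) auto
    ultimately have "insert w \<tau> \<in> (`) \<phi> ` T" using R \<tau> by (auto simp: simplices_def)
    then show False using image_cell_card(1)[OF \<phi>] w by blast
  qed
qed

lemma hit_intro:
  assumes \<phi>: "\<phi> \<in> embeddings d N r n"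
    and o: "\<forall>\<alpha>\<in>(`) \<phi> ` T. is_open b \<alpha>"
    and iso: "\<forall>w\<in>{1..n} - \<phi> ` V. \<forall>\<tau>\<in>(\<lambda>t. \<phi> ` fset t) ` I. \<not> attach b w \<tau>"
    and none: "\<And>\<rho>. \<rho> \<subseteq> \<phi> ` V \<Longrightarrow> card \<rho> = d + 1 \<Longrightarrow> \<rho> \<notin> (`) \<phi> ` T \<Longrightarrow> \<rho> \<notin> coin_complex d n b"
  shows "hit \<phi> b"
proof -
  let ?X = "coin_complex d n b"
  have sub: "(`) \<phi> ` T \<subseteq> ?X" using o by (simp add: image_subset_coin_complex_iff[OF \<phi>])
  have "\<rho> \<in> (`) \<phi> ` T" if \<rho>: "\<rho> \<in> simplices d ?X" and t: "t \<in> I" "\<phi> ` fset t \<subseteq> \<rho>" for \<rho> t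
  proof -
    have \<rho>X: "\<rho> \<in> ?X" "card \<rho> = d + 1" using \<rho> by (auto simp: simplices_def)
    have c: "card (\<phi> ` fset t) = d" "\<phi> ` fset t \<subseteq> \<phi> ` V" using image_parents[OF \<phi>] t(1) by auto
    have fin: "finite \<rho>" using \<rho>X(2) by (intro card_ge_0_finite) simp
    have "\<rho> \<subseteq> \<phi> ` V"
    proof (rule ccontr)
      assume "\<not> \<rho> \<subseteq> \<phi> ` V"
      then obtain w where w: "w \<in> \<rho>" "w \<notin> \<phi> ` V" by blast
      then have wn: "w \<in> {1..n} - \<phi> ` V" using coin_complex_subset[OF \<rho>X(1)] by blast
      have "attach b w (\<phi> ` fset t)"
        unfolding attach_def
      proof (intro allI impI)
        fix \<beta> assume "\<beta> \<subseteq> \<phi> ` fset t"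
        then have "\<beta> \<subseteq> \<rho>" using t(2) by (rule subset_trans)
        then show "is_open b (insert w \<beta>)" using w(1) by (intro coin_complex_open[OF \<rho>X(1)]) simp
      qed
      then show False using iso wn t(1) by blast
    qed
    then show ?thesis using none[of \<rho>] \<rho>X by blast
  qed
  then have "nbhd d ?X (\<phi> ` tree_root d) r = (`) \<phi> ` T"
    using nbhd_eq_image_iff[OF d embD(1)[OF \<phi>] sub] by blast
  moreover have "tree_root d \<in> T"
    using grow_mono[of 0 r d N] finite_tree_root[of d] d by (auto simp: faces_def)
  ultimately show ?thesis using sub by (auto simp: found_def)
qed

text \<open>By the missing edge, the faces of \<open>\<rho>\<close> over this edge are all outside of the copy of the tree, and
they contribute the independent factor \<open>s_param\<close>.\<close>

lemma prob_extra_face: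
  assumes \<phi>: "\<phi> \<in> embeddings d N r n" and \<rho>: "\<rho> \<subseteq> \<phi> ` V" "card \<rho> = d + 1" "\<rho> \<notin> (`) \<phi> ` T"
  shows "PR (\<lambda>b. (\<forall>\<alpha>\<in>(`) \<phi> ` T. is_open b \<alpha>) \<and> \<rho> \<in> coin_complex d n b) \<le> wT * s1"
proof -
  obtain \<rho>' where \<rho>': "\<rho>' \<subseteq> V" "\<rho> = \<phi> ` \<rho>'" using \<rho>(1) by (meson subset_imageE)
  have "card \<rho>' = d + 1" "\<rho>' \<notin> T" using \<rho>' \<rho>(2,3) embD(4)[OF \<phi>] by auto
  then obtain x u where xu: "x \<in> \<rho>'" "u \<in> \<rho>'" "x \<noteq> u" "\<And>\<alpha>. \<alpha> \<in> T \<Longrightarrow> x \<in> \<alpha> \<Longrightarrow> u \<notin> \<alpha>"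
    using grow_missing_pair[OF d \<rho>'(1)] by metis
  have inj: "inj_on \<phi> V" using embD(1)[OF \<phi>] .
  have ne: "\<phi> x \<noteq> \<phi> u" using inj xu \<rho>'(1) by (auto simp: inj_on_def)
  have fin: "finite \<rho>" using \<rho>(2) by (intro card_ge_0_finite) simp
  let ?R = "\<rho> - {\<phi> x, \<phi> u}"
  \<comment> \<open>The faces of \<open>\<rho>\<close> that contain the edge between the images of \<open>x\<close> and \<open>u\<close>.\<close>
  let ?G = "insert (\<phi> x) ` insert (\<phi> u) ` Pow ?R"
  have cR: "card ?R = d - 1" using \<rho>(2) xu \<rho>'(2) ne fin by (simp add: card_Diff_subset)
  have G: "\<gamma> \<subseteq> \<rho>" "\<phi> x \<in> \<gamma>" "\<phi> u \<in> \<gamma>" if "\<gamma> \<in> ?G" for \<gamma>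
    using that xu(1,2) \<rho>'(2) by auto
  have disj: "((`) \<phi> ` T) \<inter> ?G = {}"
  proof (rule ccontr)
    assume "((`) \<phi> ` T) \<inter> ?G \<noteq> {}"
    then obtain \<alpha> where \<alpha>: "\<alpha> \<in> T" "\<phi> ` \<alpha> \<in> ?G" by blast
    have "\<phi> x \<in> \<phi> ` \<alpha>" "\<phi> u \<in> \<phi> ` \<alpha>" using G[OF \<alpha>(2)] by auto
    then have "x \<in> \<alpha>" "u \<in> \<alpha>"
      using inj_on_image_mem_iff[OF inj _ TV[OF \<alpha>(1)]] xu(1,2) \<rho>'(1) by auto
    then show False using xu(4)[OF \<alpha>(1)] by blast
  qed
  have "PR (\<lambda>b. (\<forall>\<alpha>\<in>(`) \<phi> ` T. is_open b \<alpha>) \<and> \<rho> \<in> coin_complex d n b) \<le>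
      PR (\<lambda>b. \<forall>\<alpha>\<in>((`) \<phi> ` T) \<union> ?G. is_open b \<alpha>)"
  proof (rule measure_pmf.finite_measure_mono)
    show "{b. (\<forall>\<alpha>\<in>(`) \<phi> ` T. is_open b \<alpha>) \<and> \<rho> \<in> coin_complex d n b} \<subseteq> {b. \<forall>\<alpha>\<in>((`) \<phi> ` T) \<union> ?G. is_open b \<alpha>}"
    proof (intro subsetI CollectI ballI)
      fix b \<alpha> assume b: "b \<in> {b. (\<forall>\<alpha>\<in>(`) \<phi> ` T. is_open b \<alpha>) \<and> \<rho> \<in> coin_complex d n b}"
        and "\<alpha> \<in> ((`) \<phi> ` T) \<union> ?G"
      from this(2) show "is_open b \<alpha>"
      proof
        assume "\<alpha> \<in> ?G"
        then have "\<alpha> \<subseteq> \<rho>" by (rule G(1))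
        moreover have "\<rho> \<in> coin_complex d n b" using b by simp
        ultimately show ?thesis by (intro coin_complex_open)
      qed (use b in blast)
    qed
  qed simp
  also have "\<dots> = (\<Prod>\<alpha>\<in>((`) \<phi> ` T) \<union> ?G. wt \<alpha>)"
  proof (rule prob_open)
    fix \<alpha> assume "\<alpha> \<in> ((`) \<phi> ` T) \<union> ?G"
    then show "\<alpha> \<subseteq> {1..n} \<and> card \<alpha> \<le> d + 1"
    proof
      assume "\<alpha> \<in> ?G"
      then have "\<alpha> \<subseteq> \<rho>" by (rule G(1))
      then show ?thesis using card_mono[OF fin, of \<alpha>] \<rho>(1,2) embD(2)[OF \<phi>] by auto
    qed (use image_cell_card(2)[OF \<phi>] in blast)
  qed
  also have "\<dots> = (\<Prod>\<alpha>\<in>(`) \<phi> ` T. wt \<alpha>) * (\<Prod>\<alpha>\<in>?G. wt \<alpha>)"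
    using disj fin by (intro prod.union_disjoint) (auto simp: finite_grow)
  also have "(\<Prod>\<alpha>\<in>(`) \<phi> ` T. wt \<alpha>) = wT" by (rule prod_image[OF \<phi>]) simp
  also have "(\<Prod>\<alpha>\<in>?G. wt \<alpha>) = (\<Prod>\<beta>\<in>insert (\<phi> u) ` Pow ?R. face_weight p (Suc (card \<beta>)))"
    by (rule prod_wt_insert) (use fin ne in \<open>auto intro: finite_subset\<close>)
  also have "\<dots> = (\<Prod>\<gamma>\<in>Pow ?R. face_weight p (Suc (card (insert (\<phi> u) \<gamma>))))"
    by (subst prod.reindex) (auto simp: inj_on_def)
  also have "\<dots> = (\<Prod>\<gamma>\<in>Pow ?R. face_weight p (Suc (Suc (card \<gamma>))))"
  proof (rule prod.cong[OF refl])
    fix \<gamma> assume "\<gamma> \<in> Pow ?R"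
    then have "\<phi> u \<notin> \<gamma>" "finite \<gamma>" using fin by (auto intro: finite_subset)
    then show "face_weight p (Suc (card (insert (\<phi> u) \<gamma>))) = face_weight p (Suc (Suc (card \<gamma>)))" by simp
  qed
  also have "\<dots> = s1" by (rule prod_Pow_s_param[OF d _ cR]) (use fin in simp)
  finally show ?thesis .
qed

text \<open>The event contains the one that the copy is present and no vertex outside is attached to it, apart
from the cases in which the vertices of the copy span an additional \<open>d\<close>-simplex. There are at most
\<open>2 ^ card V\<close> candidates for the latter.\<close>

lemma prob_hit_lower:
  assumes \<phi>: "\<phi> \<in> embeddings d N r n" and le: "real m * r1 \<le> 1"
  shows "PR (hit \<phi>) \<ge> wT * ((1 - real m * r1) ^ n - 2 ^ card V * s1)"
proof -
  let ?J = "(\<lambda>t. \<phi> ` fset t) ` I"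
  let ?A = "{b. (\<forall>\<alpha>\<in>(`) \<phi> ` T. is_open b \<alpha>) \<and> (\<forall>w\<in>{1..n} - \<phi> ` V. \<forall>\<tau>\<in>?J. \<not> attach b w \<tau>)}"
  let ?P = "{\<rho>. \<rho> \<subseteq> \<phi> ` V \<and> card \<rho> = d + 1 \<and> \<rho> \<notin> (`) \<phi> ` T}"
  let ?B = "\<lambda>\<rho>. {b. (\<forall>\<alpha>\<in>(`) \<phi> ` T. is_open b \<alpha>) \<and> \<rho> \<in> coin_complex d n b}"
  let ?pr = "measure_pmf.prob (coins d n p)"
  have finP: "finite ?P" by (rule finite_subset[of _ "Pow (\<phi> ` V)"]) (use finV in auto)
  have "card ?P \<le> card (Pow (\<phi> ` V))" by (rule card_mono) (use finV in auto)
  then have "card ?P \<le> 2 ^ card V" using finV embD(3)[OF \<phi>] by (simp add: card_Pow)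
  then have "real (card ?P) \<le> real (2 ^ card V)" by (rule of_nat_mono)
  then have cP: "real (card ?P) \<le> 2 ^ card V" by simp
  have "?A \<subseteq> {b. hit \<phi> b} \<union> (\<Union>\<rho>\<in>?P. ?B \<rho>)"
  proof
    fix b assume b: "b \<in> ?A"
    show "b \<in> {b. hit \<phi> b} \<union> (\<Union>\<rho>\<in>?P. ?B \<rho>)"
    proof (cases "\<exists>\<rho>\<in>?P. \<rho> \<in> coin_complex d n b")
      case True
      then obtain \<rho> where \<rho>: "\<rho> \<in> ?P" "\<rho> \<in> coin_complex d n b" by blast
      moreover have "\<forall>\<alpha>\<in>(`) \<phi> ` T. is_open b \<alpha>" using b by simp
      ultimately have "b \<in> ?B \<rho>" by simp
      then show ?thesis using \<rho>(1) by (intro UnI2 UN_I)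
    next
      case False
      then have "hit \<phi> b" using b by (intro hit_intro[OF \<phi>]) auto
      then show ?thesis by blast
    qed
  qed
  then have "?pr ?A \<le> ?pr ({b. hit \<phi> b} \<union> (\<Union>\<rho>\<in>?P. ?B \<rho>))"
    by (rule measure_pmf.finite_measure_mono) simp
  also have "\<dots> \<le> ?pr {b. hit \<phi> b} + ?pr (\<Union>\<rho>\<in>?P. ?B \<rho>)"
    by (rule measure_Un_le) auto
  also have "?pr (\<Union>\<rho>\<in>?P. ?B \<rho>) \<le> (\<Sum>\<rho>\<in>?P. ?pr (?B \<rho>))"
    using finP by (intro measure_pmf.finite_measure_subadditive_finite) auto
  also have "\<dots> \<le> (\<Sum>\<rho>\<in>?P. wT * s1)"
    by (intro sum_mono prob_extra_face[OF \<phi>]) auto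
  also have "\<dots> \<le> 2 ^ card V * (wT * s1)"
    using cP wT_nonneg params_01(2) by (simp add: mult_right_mono)
  finally have up: "?pr ?A \<le> ?pr {b. hit \<phi> b} + 2 ^ card V * (wT * s1)" by simp
  have "?pr ?A \<ge> (\<Prod>\<alpha>\<in>(`) \<phi> ` T. wt \<alpha>) * (1 - real (card ?J) * r1) ^ (n - card (\<phi> ` V))"
    by (rule prob_open_isolated_bounds(1)[OF embD(2)[OF \<phi>]])
      (use image_cell_card(1)[OF \<phi>] image_parents(1)[OF \<phi>] le card_image_parents[OF \<phi>] in auto)
  then have "?pr ?A \<ge> wT * (1 - real m * r1) ^ (n - card V)"
    by (simp add: prod_image[OF \<phi>] card_image_parents[OF \<phi>] embD(3)[OF \<phi>])
  moreover have "(1 - real m * r1) ^ n \<le> (1 - real m * r1) ^ (n - card V)"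
    using le params_01(1) by (intro power_decreasing) auto
  then have "wT * (1 - real m * r1) ^ n \<le> wT * (1 - real m * r1) ^ (n - card V)"
    using wT_nonneg by (rule mult_left_mono)
  ultimately show ?thesis using up by (simp add: algebra_simps)
qed

text \<open>Two disjoint copies behave like one copy of a forest with twice as many faces and simplices to be
avoided, hence the square of the weight and the doubled exponent.\<close>

lemma prob_pair_disjoint:
  assumes \<phi>: "\<phi> \<in> embeddings d N r n" and \<psi>: "\<psi> \<in> embeddings d N r n" and disj: "\<phi> ` V \<inter> \<psi> ` V = {}"
  shows "PR (\<lambda>b. hit \<phi> b \<and> hit \<psi> b) \<le> wT\<^sup>2 *
    exp (- (2 * real m * r1 - (2 * real m)\<^sup>2 * (r1 * s1)) * real (n - 2 * card V))"
proof -
  let ?J = "\<lambda>\<phi>. (\<lambda>t. \<phi> ` fset t) ` I"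
  let ?F = "(`) \<phi> ` T \<union> (`) \<psi> ` T" and ?U = "\<phi> ` V \<union> \<psi> ` V" and ?K = "?J \<phi> \<union> ?J \<psi>"
  have "PR (\<lambda>b. hit \<phi> b \<and> hit \<psi> b) \<le>
     PR (\<lambda>b. (\<forall>\<alpha>\<in>?F. is_open b \<alpha>) \<and> (\<forall>w\<in>{1..n} - ?U. \<forall>\<tau>\<in>?K. \<not> attach b w \<tau>))"
  proof (rule measure_pmf.finite_measure_mono)
    show "{b. hit \<phi> b \<and> hit \<psi> b} \<subseteq>
      {b. (\<forall>\<alpha>\<in>?F. is_open b \<alpha>) \<and> (\<forall>w\<in>{1..n} - ?U. \<forall>\<tau>\<in>?K. \<not> attach b w \<tau>)}"
    proof (intro subsetI CollectI conjI ballI)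
      fix b \<alpha> assume b: "b \<in> {b. hit \<phi> b \<and> hit \<psi> b}" and \<alpha>: "\<alpha> \<in> ?F"
      show "is_open b \<alpha>" using \<alpha> hit_imp(1)[OF \<phi>, of b] hit_imp(1)[OF \<psi>, of b] b by (elim UnE) auto
    next
      fix b w \<tau> assume b: "b \<in> {b. hit \<phi> b \<and> hit \<psi> b}" and w: "w \<in> {1..n} - ?U" and \<tau>: "\<tau> \<in> ?K"
      show "\<not> attach b w \<tau>"
        using \<tau> hit_imp(2)[OF \<phi>, of b] hit_imp(2)[OF \<psi>, of b] b w by (elim UnE) auto
    qed
  qed simp
  also have "\<dots> \<le> (\<Prod>\<alpha>\<in>?F. wt \<alpha>) * exp (- (real (card ?K) * r1 -
          (real (card ?K))\<^sup>2 * (r1 * s1)) * real (n - card ?U))"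
  proof (rule prob_open_isolated_bounds(2))
    show "?U \<subseteq> {1..n}" using embD(2)[OF \<phi>] embD(2)[OF \<psi>] by blast
    show "\<alpha> \<subseteq> ?U \<and> card \<alpha> \<le> d + 1" if "\<alpha> \<in> ?F" for \<alpha>
      using that image_cell_card(1)[OF \<phi>] image_cell_card(1)[OF \<psi>] by blast
    show "\<tau> \<subseteq> ?U \<and> card \<tau> = d" if "\<tau> \<in> ?K" for \<tau>
      using that image_parents(1)[OF \<phi>] image_parents(1)[OF \<psi>] by blast
  qed
  also have "(\<Prod>\<alpha>\<in>?F. wt \<alpha>) = (\<Prod>\<alpha>\<in>(`) \<phi> ` T. wt \<alpha>) * (\<Prod>\<alpha>\<in>(`) \<psi> ` T. wt \<alpha>)"
  proof (rule prod.union_disjoint)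
    show "(`) \<phi> ` T \<inter> (`) \<psi> ` T = {}"
    proof (rule ccontr)
      assume "(`) \<phi> ` T \<inter> (`) \<psi> ` T \<noteq> {}"
      then obtain \<alpha> where "\<alpha> \<in> (`) \<phi> ` T" "\<alpha> \<in> (`) \<psi> ` T" by blast
      then show False
        using image_cell_card(1,3)[OF \<phi>, of \<alpha>] image_cell_card(1)[OF \<psi>, of \<alpha>] disj by blast
    qed
  qed (simp_all add: finite_grow)
  also have "\<dots> = wT\<^sup>2" by (simp add: prod_image[OF \<phi>] prod_image[OF \<psi>] power2_eq_square)
  also have "card ?K = 2 * m"
  proof -
    have "?J \<phi> \<inter> ?J \<psi> = {}"
    proof (rule ccontr)
      assume "?J \<phi> \<inter> ?J \<psi> \<noteq> {}"
      then obtain \<tau> where \<tau>: "\<tau> \<in> ?J \<phi>" "\<tau> \<in> ?J \<psi>" by blast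
      then have "\<tau> \<subseteq> \<phi> ` V \<inter> \<psi> ` V" "card \<tau> = d"
        using image_parents(1)[OF \<phi> \<tau>(1)] image_parents(1)[OF \<psi> \<tau>(2)] by simp_all
      then show False using disj d by auto
    qed
    then show ?thesis
      using card_image_parents[OF \<phi>] card_image_parents[OF \<psi>] by (simp add: card_Un_disjoint finite_parents)
  qed
  also have "card ?U = 2 * card V"
    using disj embD(3)[OF \<phi>] embD(3)[OF \<psi>] finV by (simp add: card_Un_disjoint)
  finally show ?thesis by simp
qed

lemma prod_Pow_ge_r1:
  assumes "finite Y" "card Y \<le> d"
  shows "(\<Prod>\<beta>\<in>Pow Y. face_weight p (Suc (card \<beta>))) \<ge> r1"
proof -
  have "r1 = (\<Prod>\<beta>\<in>Pow {..<d}. face_weight p (Suc (card \<beta>)))"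
    by (rule prod_Pow_r_param[symmetric]) auto
  also have "\<dots> \<le> (\<Prod>\<beta>\<in>Pow {..<card Y}. face_weight p (Suc (card \<beta>)))"
  proof (rule prod_subset_le)
    fix \<beta> :: "nat set" assume "\<beta> \<in> Pow {..<d}"
    then have "card \<beta> \<le> d" using card_mono[of "{..<d}" \<beta>] by auto
    then show "face_weight p (Suc (card \<beta>)) \<in> {0..1}" using face_weight_01 by simp
  qed (use assms in auto)
  also have "\<dots> = (\<Prod>\<beta>\<in>Pow Y. face_weight p (Suc (card \<beta>)))"
    using prod_Pow_card[of "{..<card Y}" "\<lambda>k. face_weight p (Suc k)"]
      prod_Pow_card[OF assms(1), of "\<lambda>k. face_weight p (Suc k)"] by simp
  finally show ?thesis .
qed

text \<open>Delete vertices as provided by degeneracy. Each deletion removes faces of weight at least \<open>r_param\<close>,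
since they are indexed by subsets of a set with at most \<open>d\<close> elements, and the last vertex has
weight \<open>1\<close>.\<close>

lemma sub_weight_ge:
  assumes "W \<subseteq> V" "W \<noteq> {}"
  shows "(\<Prod>\<alpha>\<in>{\<alpha>\<in>T. \<alpha> \<subseteq> W}. wt \<alpha>) \<ge> r1 ^ (card W - 1)"
  using assms
proof (induction "card W" arbitrary: W rule: less_induct)
  case less
  have finW: "finite W" using less.prems(1) finV by (rule finite_subset)
  obtain x Y where x: "x \<in> W" "finite Y" "card Y \<le> d" "x \<notin> Y"
    "\<And>\<alpha>. \<alpha> \<in> T \<Longrightarrow> x \<in> \<alpha> \<Longrightarrow> \<alpha> \<subseteq> W \<Longrightarrow> \<alpha> - {x} \<subseteq> Y"
    using grow_degenerate[OF d less.prems] by metis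
  show ?case
  proof (cases "W = {x}")
    case True
    have "wt \<alpha> = 1" if "\<alpha> \<in> {\<alpha>\<in>T. \<alpha> \<subseteq> W}" for \<alpha>
    proof -
      have "\<alpha> = {x}" using that True grow_complex[of \<alpha> d N r] by blast
      then show ?thesis by (simp add: face_weight_def)
    qed
    then have "(\<Prod>\<alpha>\<in>{\<alpha>\<in>T. \<alpha> \<subseteq> W}. wt \<alpha>) = 1" by (intro prod.neutral) blast
    then show ?thesis using True by simp
  next
    case False
    let ?W = "W - {x}"
    have W': "?W \<noteq> {}" "?W \<subseteq> V" "card ?W < card W" "card W - 1 = Suc (card ?W - 1)"
    proof -
      show ne: "?W \<noteq> {}" using False x(1) by blast
      show "?W \<subseteq> V" using less.prems(1) by blast
      show lt: "card ?W < card W" by (rule card_Diff1_less[OF finW x(1)])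
      have "card ?W > 0" using ne finW by (simp add: card_gt_0_iff)
      then show "card W - 1 = Suc (card ?W - 1)" using card_Suc_Diff1[OF finW x(1)] by linarith
    qed
    let ?A = "{\<alpha>\<in>T. \<alpha> \<subseteq> ?W}" and ?B = "{\<alpha>\<in>T. \<alpha> \<subseteq> W \<and> x \<in> \<alpha>}"
    have "{\<alpha>\<in>T. \<alpha> \<subseteq> W} = ?A \<union> ?B" "?A \<inter> ?B = {}" by blast+
    then have "(\<Prod>\<alpha>\<in>{\<alpha>\<in>T. \<alpha> \<subseteq> W}. wt \<alpha>) = (\<Prod>\<alpha>\<in>?A. wt \<alpha>) * (\<Prod>\<alpha>\<in>?B. wt \<alpha>)"
      by (simp add: prod.union_disjoint finite_grow)
    moreover have IH: "r1 ^ (card ?W - 1) \<le> (\<Prod>\<alpha>\<in>?A. wt \<alpha>)"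
      by (rule less.hyps[OF W'(3,2,1)])
    moreover have "0 \<le> (\<Prod>\<alpha>\<in>?A. wt \<alpha>)"
      by (rule order_trans[OF _ IH]) (use params_01(1) in simp)
    moreover have "r1 \<le> (\<Prod>\<alpha>\<in>?B. wt \<alpha>)"
    proof -
      have "r1 \<le> (\<Prod>\<beta>\<in>Pow Y. face_weight p (Suc (card \<beta>)))" by (rule prod_Pow_ge_r1[OF x(2,3)])
      also have "\<dots> = (\<Prod>\<alpha>\<in>insert x ` Pow Y. wt \<alpha>)"
      proof -
        have "inj_on (insert x) (Pow Y)"
        proof (rule inj_onI)
          fix a b assume "a \<in> Pow Y" "b \<in> Pow Y" "insert x a = insert x b"
          then show "a = b" using x(4) by (metis PowD insert_ident subsetD)
        qed
        then have "(\<Prod>\<alpha>\<in>insert x ` Pow Y. wt \<alpha>) = (\<Prod>\<beta>\<in>Pow Y. wt (insert x \<beta>))" by (simp add: prod.reindex)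
        also have "\<dots> = (\<Prod>\<beta>\<in>Pow Y. face_weight p (Suc (card \<beta>)))"
        proof (rule prod.cong[OF refl])
          fix \<beta> assume "\<beta> \<in> Pow Y"
          then have "x \<notin> \<beta>" "finite \<beta>" using x(2,4) by (auto intro: finite_subset)
          then show "wt (insert x \<beta>) = face_weight p (Suc (card \<beta>))" by simp
        qed
        finally show ?thesis by simp
      qed
      also have "\<dots> \<le> (\<Prod>\<alpha>\<in>?B. wt \<alpha>)"
      proof (rule open_prod_le)
        show "?B \<subseteq> insert x ` Pow Y"
        proof
          fix \<alpha> assume \<alpha>: "\<alpha> \<in> ?B"
          then have "\<alpha> - {x} \<in> Pow Y" "\<alpha> = insert x (\<alpha> - {x})" using x(5)[of \<alpha>] by auto
          then show "\<alpha> \<in> insert x ` Pow Y" by blast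
        qed
        fix \<alpha> assume "\<alpha> \<in> insert x ` Pow Y"
        then obtain \<beta> where \<beta>: "\<beta> \<subseteq> Y" "\<alpha> = insert x \<beta>" by blast
        have "card \<beta> \<le> d" using card_mono[OF x(2) \<beta>(1)] x(3) by simp
        moreover have "finite \<beta>" using \<beta>(1) x(2) by (rule finite_subset)
        ultimately show "card \<alpha> \<le> d + 1" using \<beta>(2) by (simp add: card_insert_if)
      qed (use x(2) in simp)
      finally show ?thesis .
    qed
    ultimately show ?thesis unfolding W'(4) power_Suc2
      using params_01(1) by (simp add: mult_mono)
  qed
qed

text \<open>The part of the second copy that can coincide with the first one is spanned by \<open>W\<close>, so only its
weight is counted once instead of twice. By the previous bound this weight is at least
\<open>r_param ^ (card W - 1)\<close>.\<close>

lemma prob_pair_overlap: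
  assumes \<phi>: "\<phi> \<in> embeddings d N r n" and \<psi>: "\<psi> \<in> embeddings d N r n"
    and W: "W = {v \<in> V. \<psi> v \<in> \<phi> ` V}" "W \<noteq> {}"
  shows "PR (\<lambda>b. hit \<phi> b \<and> hit \<psi> b) * r1 ^ (card W - 1) \<le> wT\<^sup>2"
proof -
  \<comment> \<open>The faces of the second copy that cannot lie in the first one.\<close>
  let ?S = "{\<alpha>\<in>T. \<not> \<alpha> \<subseteq> W}"
  let ?F = "(`) \<phi> ` T \<union> (`) \<psi> ` ?S"
  have "PR (\<lambda>b. hit \<phi> b \<and> hit \<psi> b) \<le> PR (\<lambda>b. \<forall>\<alpha>\<in>?F. is_open b \<alpha>)"
  proof (rule measure_pmf.finite_measure_mono)
    show "{b. hit \<phi> b \<and> hit \<psi> b} \<subseteq> {b. \<forall>\<alpha>\<in>?F. is_open b \<alpha>}"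
    proof (intro subsetI CollectI ballI)
      fix b \<alpha> assume b: "b \<in> {b. hit \<phi> b \<and> hit \<psi> b}" and \<alpha>: "\<alpha> \<in> ?F"
      show "is_open b \<alpha>"
        using \<alpha> hit_imp(1)[OF \<phi>, of b] hit_imp(1)[OF \<psi>, of b] b by (elim UnE) auto
    qed
  qed simp
  also have "\<dots> = (\<Prod>\<alpha>\<in>?F. wt \<alpha>)"
    by (rule prob_open) (use image_cell_card(2)[OF \<phi>] image_cell_card(2)[OF \<psi>] in blast)
  also have "\<dots> = (\<Prod>\<alpha>\<in>(`) \<phi> ` T. wt \<alpha>) * (\<Prod>\<alpha>\<in>(`) \<psi> ` ?S. wt \<alpha>)"
  proof (rule prod.union_disjoint)
    show "(`) \<phi> ` T \<inter> (`) \<psi> ` ?S = {}"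
    proof (rule ccontr)
      assume "(`) \<phi> ` T \<inter> (`) \<psi> ` ?S \<noteq> {}"
      then obtain \<alpha> where \<alpha>: "\<alpha> \<in> ?S" "\<psi> ` \<alpha> \<in> (`) \<phi> ` T" by blast
      then have "\<psi> ` \<alpha> \<subseteq> \<phi> ` V" using image_cell_card(1)[OF \<phi>] by blast
      then have "\<alpha> \<subseteq> W" unfolding W(1) using TV \<alpha>(1) by blast
      then show False using \<alpha>(1) by blast
    qed
  qed (simp_all add: finite_grow)
  also have "\<dots> = wT * (\<Prod>\<alpha>\<in>?S. wt \<alpha>)"
    using prod_image[OF \<psi>, of ?S] by (simp add: prod_image[OF \<phi>])
  finally have le: "PR (\<lambda>b. hit \<phi> b \<and> hit \<psi> b) \<le> wT * (\<Prod>\<alpha>\<in>?S. wt \<alpha>)" .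
  have S0: "(\<Prod>\<alpha>\<in>?S. wt \<alpha>) \<ge> 0" using wt_prod_nonneg[of ?S] grow_card_le[OF d] by blast
  have "PR (\<lambda>b. hit \<phi> b \<and> hit \<psi> b) * r1 ^ (card W - 1) \<le>
      (wT * (\<Prod>\<alpha>\<in>?S. wt \<alpha>)) * (\<Prod>\<alpha>\<in>{\<alpha>\<in>T. \<alpha> \<subseteq> W}. wt \<alpha>)"
    using le sub_weight_ge[of W] W S0 wT_nonneg params_01(1) by (intro mult_mono) auto
  also have "\<dots> = wT * ((\<Prod>\<alpha>\<in>?S. wt \<alpha>) * (\<Prod>\<alpha>\<in>{\<alpha>\<in>T. \<alpha> \<subseteq> W}. wt \<alpha>))" by simp
  also have "(\<Prod>\<alpha>\<in>?S. wt \<alpha>) * (\<Prod>\<alpha>\<in>{\<alpha>\<in>T. \<alpha> \<subseteq> W}. wt \<alpha>) = (\<Prod>\<alpha>\<in>?S \<union> {\<alpha>\<in>T. \<alpha> \<subseteq> W}. wt \<alpha>)"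
    by (rule prod.union_disjoint[symmetric]) (auto simp: finite_grow)
  also have "?S \<union> {\<alpha>\<in>T. \<alpha> \<subseteq> W} = T" by blast
  finally show ?thesis by (simp add: power2_eq_square)
qed

text \<open>The vertices of \<open>W\<close> are mapped into a fixed finite set, only the remaining ones are free.\<close>

lemma card_overlap:
  assumes \<phi>: "\<phi> \<in> embeddings d N r n" and W: "W \<subseteq> V"
  shows "card {\<psi> \<in> embeddings d N r n. {v \<in> V. \<psi> v \<in> \<phi> ` V} = W} \<le> card V ^ card V * n ^ (card V - card W)"
proof -
  let ?P = "Pi\<^sub>E V (\<lambda>v. if v \<in> W then \<phi> ` V else {1..n})"
  have finW: "finite W" using W finV by (rule finite_subset)
  have "card {\<psi> \<in> embeddings d N r n. {v \<in> V. \<psi> v \<in> \<phi> ` V} = W} \<le> card ?P"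
  proof (rule card_mono)
    show "finite ?P" using finV by (intro finite_PiE) auto
    show "{\<psi> \<in> embeddings d N r n. {v \<in> V. \<psi> v \<in> \<phi> ` V} = W} \<subseteq> ?P"
      by (auto simp: embeddings_def PiE_def Pi_def)
  qed
  also have "\<dots> = (\<Prod>v\<in>V. if v \<in> W then card V else n)"
    using embD(3)[OF \<phi>] by (simp add: card_PiE finV if_distrib cong: if_cong)
  also have "\<dots> = card V ^ card W * n ^ card (V - W)"
  proof -
    have "V \<inter> {v. v \<in> W} = W" "V \<inter> - {v. v \<in> W} = V - W" using W by auto
    then show ?thesis by (simp add: prod.If_cases finV)
  qed
  also have "\<dots> \<le> card V ^ card V * n ^ (card V - card W)"
  proof -
    have "card V ^ card W \<le> card V ^ card V"
    proof (cases "card V = 0")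
      case True
      then have "W = {}" using W finV by auto
      then show ?thesis using True by simp
    qed (use card_mono[OF finV W] in \<open>auto intro: power_increasing\<close>)
    then show ?thesis using W finW by (simp add: card_Diff_subset)
  qed
  finally show ?thesis .
qed

text \<open>For overlap \<open>W\<close> the number of pairs loses a factor \<open>n ^ card W\<close> and the probability gains at most
\<open>r_param ^ (1 - card W)\<close>. As long as \<open>n * r_param\<close> stays away from \<open>0\<close>, what remains is a loss of
one factor \<open>n\<close>. This includes distinct root simplices that share some vertices, and also the
diagonal.\<close>

lemma second_moment:
  assumes n: "n \<ge> 1" and r1: "r1 > 0"
  shows "(\<Sum>\<phi>\<in>embeddings d N r n. \<Sum>\<psi>\<in>embeddings d N r n. PR (\<lambda>b. hit \<phi> b \<and> hit \<psi> b)) \<le>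
    (real (card (embeddings d N r n)))\<^sup>2 * wT\<^sup>2 *
       exp (- (2 * real m * r1 - (2 * real m)\<^sup>2 * (r1 * s1)) * real (n - 2 * card V)) +
    (real n ^ card V)\<^sup>2 * wT\<^sup>2 * overlap_const d N r (real n * r1) / real n"
proof -
  let ?E = "embeddings d N r n"
  let ?pp = "\<lambda>\<phi> \<psi>. PR (\<lambda>b. hit \<phi> b \<and> hit \<psi> b)"
  let ?W = "\<lambda>\<phi> \<psi>. {v \<in> V. \<psi> v \<in> \<phi> ` V}"
  let ?x = "wT\<^sup>2 * exp (- (2 * real m * r1 - (2 * real m)\<^sup>2 * (r1 * s1)) * real (n - 2 * card V))"
  let ?K = "real (card V ^ card V)"
  have finE: "finite ?E" by (rule finite_embeddings[OF d])
  have nz: "real n > 0" using n by simp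
  have cE: "real (card ?E) \<le> real n ^ card V"
  proof -
    have "card ?E \<le> card (V \<rightarrow>\<^sub>E {1..n})"
      by (rule card_mono) (auto simp: embeddings_def intro!: finite_PiE finV)
    also have "\<dots> = n ^ card V" by (simp add: card_PiE finV)
    finally show ?thesis by (metis of_nat_le_iff of_nat_power)
  qed
  have each: "(\<Sum>\<psi>\<in>?E. ?pp \<phi> \<psi>) \<le> real (card ?E) * ?x + real n ^ card V * wT\<^sup>2 * overlap_const d N r (real n * r1) / real n"
    if \<phi>: "\<phi> \<in> ?E" for \<phi>
  proof -
    have "(\<Sum>\<psi>\<in>?E. ?pp \<phi> \<psi>) = (\<Sum>W\<in>Pow V. \<Sum>\<psi>\<in>{\<psi>\<in>?E. ?W \<phi> \<psi> = W}. ?pp \<phi> \<psi>)"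
      by (rule sum.group[symmetric]) (use finE finV in auto)
    also have "\<dots> = (\<Sum>\<psi>\<in>{\<psi>\<in>?E. ?W \<phi> \<psi> = {}}. ?pp \<phi> \<psi>) +
        (\<Sum>W\<in>Pow V - {{}}. \<Sum>\<psi>\<in>{\<psi>\<in>?E. ?W \<phi> \<psi> = W}. ?pp \<phi> \<psi>)"
      by (rule sum.remove) (use finV in auto)
    finally have split: "(\<Sum>\<psi>\<in>?E. ?pp \<phi> \<psi>) = (\<Sum>\<psi>\<in>{\<psi>\<in>?E. ?W \<phi> \<psi> = {}}. ?pp \<phi> \<psi>) +
        (\<Sum>W\<in>Pow V - {{}}. \<Sum>\<psi>\<in>{\<psi>\<in>?E. ?W \<phi> \<psi> = W}. ?pp \<phi> \<psi>)" .
    have "(\<Sum>\<psi>\<in>{\<psi>\<in>?E. ?W \<phi> \<psi> = {}}. ?pp \<phi> \<psi>) \<le> (\<Sum>\<psi>\<in>{\<psi>\<in>?E. ?W \<phi> \<psi> = {}}. ?x)"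
    proof (rule sum_mono)
      fix \<psi> assume \<psi>: "\<psi> \<in> {\<psi>\<in>?E. ?W \<phi> \<psi> = {}}"
      then have "\<And>v. v \<in> V \<Longrightarrow> \<psi> v \<notin> \<phi> ` V" by simp
      then have "\<phi> ` V \<inter> \<psi> ` V = {}" by (simp add: disjoint_iff image_iff) metis
      then show "?pp \<phi> \<psi> \<le> ?x" using \<psi> by (intro prob_pair_disjoint \<phi>) auto
    qed
    also have "\<dots> \<le> real (card ?E) * ?x"
    proof -
      have "card {\<psi>\<in>?E. ?W \<phi> \<psi> = {}} \<le> card ?E" by (rule card_mono) (use finE in auto)
      then have "real (card {\<psi>\<in>?E. ?W \<phi> \<psi> = {}}) * ?x \<le> real (card ?E) * ?x"
        by (intro mult_right_mono) auto
      then show ?thesis by simp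
    qed
    finally have apart: "(\<Sum>\<psi>\<in>{\<psi>\<in>?E. ?W \<phi> \<psi> = {}}. ?pp \<phi> \<psi>) \<le> real (card ?E) * ?x" .
    have "(\<Sum>W\<in>Pow V - {{}}. \<Sum>\<psi>\<in>{\<psi>\<in>?E. ?W \<phi> \<psi> = W}. ?pp \<phi> \<psi>) \<le>
        (\<Sum>W\<in>Pow V - {{}}. real n ^ card V * wT\<^sup>2 / real n * (?K * (1 / (real n * r1)) ^ (card W - 1)))"
    proof (rule sum_mono)
      fix W assume W: "W \<in> Pow V - {{}}"
      let ?C = "{\<psi>\<in>?E. ?W \<phi> \<psi> = W}"
      have finW: "finite W" using W finV by (auto intro: finite_subset)
      have cW: "card W \<ge> 1" "card W \<le> card V"
        using W finW finV by (auto simp: card_gt_0_iff Suc_le_eq intro: card_mono)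
      have "(\<Sum>\<psi>\<in>?C. ?pp \<phi> \<psi>) \<le> (\<Sum>\<psi>\<in>?C. wT\<^sup>2 / r1 ^ (card W - 1))"
      proof (rule sum_mono)
        fix \<psi> assume \<psi>: "\<psi> \<in> ?C"
        have "?pp \<phi> \<psi> * r1 ^ (card W - 1) \<le> wT\<^sup>2"
          by (rule prob_pair_overlap[OF \<phi>]) (use \<psi> W in auto)
        then show "?pp \<phi> \<psi> \<le> wT\<^sup>2 / r1 ^ (card W - 1)" using r1 by (simp add: pos_le_divide_eq)
      qed
      also have "\<dots> = real (card ?C) * (wT\<^sup>2 / r1 ^ (card W - 1))" by simp
      also have "\<dots> \<le> (?K * real n ^ (card V - card W)) * (wT\<^sup>2 / r1 ^ (card W - 1))"
      proof (rule mult_right_mono)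
        have "card ?C \<le> card V ^ card V * n ^ (card V - card W)"
          by (rule card_overlap[OF \<phi>]) (use W in auto)
        then have "real (card ?C) \<le> real (card V ^ card V * n ^ (card V - card W))" by (rule of_nat_mono)
        then show "real (card ?C) \<le> ?K * real n ^ (card V - card W)" by simp
      qed (use r1 in auto)
      also have "real n ^ (card V - card W) = real n ^ card V / real n / real n ^ (card W - 1)"
      proof -
        have "real n ^ card V = real n ^ (card V - card W) * real n * real n ^ (card W - 1)"
        proof -
          have "real n ^ ((card V - card W) + 1 + (card W - 1)) =
              real n ^ (card V - card W) * real n * real n ^ (card W - 1)"
            by (simp only: power_add power_one_right)
          moreover have "(card V - card W) + 1 + (card W - 1) = card V" using cW by simp
          ultimately show ?thesis by simp
        qed
        then show ?thesis using nz by simp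
      qed
      also have "(?K * (real n ^ card V / real n / real n ^ (card W - 1))) * (wT\<^sup>2 / r1 ^ (card W - 1)) =
          real n ^ card V * wT\<^sup>2 / real n * (?K * (1 / (real n * r1)) ^ (card W - 1))"
        by (simp add: power_divide power_mult_distrib mult_ac)
      finally show "(\<Sum>\<psi>\<in>?C. ?pp \<phi> \<psi>) \<le> real n ^ card V * wT\<^sup>2 / real n * (?K * (1 / (real n * r1)) ^ (card W - 1))" .
    qed
    also have "\<dots> = real n ^ card V * wT\<^sup>2 * overlap_const d N r (real n * r1) / real n"
      by (simp add: overlap_const_def sum_distrib_left sum_divide_distrib)
    finally show ?thesis using apart unfolding split by (intro add_mono)
  qed
  have oc: "real n ^ card V * wT\<^sup>2 * overlap_const d N r (real n * r1) / real n \<ge> 0"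
    unfolding overlap_const_def using r1 nz by (intro divide_nonneg_nonneg mult_nonneg_nonneg sum_nonneg) auto
  have "(\<Sum>\<phi>\<in>?E. \<Sum>\<psi>\<in>?E. ?pp \<phi> \<psi>) \<le>
     (\<Sum>\<phi>\<in>?E. real (card ?E) * ?x + real n ^ card V * wT\<^sup>2 * overlap_const d N r (real n * r1) / real n)"
    by (rule sum_mono) (rule each)
  also have "\<dots> = (real (card ?E))\<^sup>2 * ?x + real (card ?E) * (real n ^ card V * wT\<^sup>2 * overlap_const d N r (real n * r1) / real n)"
    by (simp add: power2_eq_square algebra_simps)
  also have "\<dots> \<le> (real (card ?E))\<^sup>2 * ?x + real n ^ card V * (real n ^ card V * wT\<^sup>2 * overlap_const d N r (real n * r1) / real n)"
    using mult_right_mono[OF cE oc] by simp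
  finally show ?thesis by (simp add: power2_eq_square mult.assoc)
qed

end

section \<open>Concentration of the number of balls of a given shape\<close>

text \<open>Chebyshev around an arbitrary centre \<open>\<mu>\<close>. It suffices to bound the second moment from above and
the first moment from below in order to use it.\<close>

lemma prob_count_deviation:
  fixes A :: "'a \<Rightarrow> 'b \<Rightarrow> bool" and M :: "'b pmf"
  assumes fin: "finite E" and a: "a > 0" and \<epsilon>: "\<epsilon> > 0"
  shows "measure_pmf.prob M {b. \<bar>real (card {\<phi>\<in>E. A \<phi> b}) / a - \<mu>\<bar> > \<epsilon>} \<le>
    ((\<Sum>\<phi>\<in>E. \<Sum>\<psi>\<in>E. measure_pmf.prob M {b. A \<phi> b \<and> A \<psi> b}) / a\<^sup>2
      - 2 * \<mu> * ((\<Sum>\<phi>\<in>E. measure_pmf.prob M {b. A \<phi> b}) / a) + \<mu>\<^sup>2) / \<epsilon>\<^sup>2"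
proof -
  let ?I = "\<lambda>\<phi> b. indicator {b. A \<phi> b} b :: real"
  let ?f = "\<lambda>b. (\<Sum>\<phi>\<in>E. \<Sum>\<psi>\<in>E. indicator {b. A \<phi> b \<and> A \<psi> b} b) / a\<^sup>2 - 2 * \<mu> * ((\<Sum>\<phi>\<in>E. ?I \<phi> b) / a) + \<mu>\<^sup>2"
  let ?B = "{b. \<bar>real (card {\<phi>\<in>E. A \<phi> b}) / a - \<mu>\<bar> > \<epsilon>}"
  have card_eq: "real (card {\<phi>\<in>E. A \<phi> b}) = (\<Sum>\<phi>\<in>E. ?I \<phi> b)" for b
  proof -
    have "real (card {\<phi>\<in>E. A \<phi> b}) = (\<Sum>\<phi>\<in>{\<phi>\<in>E. A \<phi> b}. 1)" by simp
    also have "\<dots> = (\<Sum>\<phi>\<in>E. if A \<phi> b then 1 else 0)" by (rule sum.inter_filter[OF fin])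
    finally show ?thesis by (simp add: indicator_def of_bool_def)
  qed
  have f_eq: "?f b = (real (card {\<phi>\<in>E. A \<phi> b}) / a - \<mu>)\<^sup>2" for b
  proof -
    have "(\<Sum>\<phi>\<in>E. \<Sum>\<psi>\<in>E. indicator {b. A \<phi> b \<and> A \<psi> b} b :: real) = (\<Sum>\<phi>\<in>E. ?I \<phi> b)\<^sup>2"
      unfolding power2_eq_square sum_product by (intro sum.cong refl) (auto simp: indicator_def)
    then show ?thesis unfolding card_eq by (simp add: power2_diff power_divide)
  qed
  have int: "integrable (measure_pmf M) ?f"
    by (intro Bochner_Integration.integrable_add Bochner_Integration.integrable_diff integrable_divide
        integrable_mult_right Bochner_Integration.integrable_sum integrable_real_indicator integrable_const) (auto simp: measure_pmf.emeasure_eq_measure)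
  have "\<epsilon>\<^sup>2 * measure_pmf.prob M ?B = measure_pmf.expectation M (\<lambda>b. \<epsilon>\<^sup>2 * indicator ?B b)"
    by simp
  also have "\<dots> \<le> measure_pmf.expectation M ?f"
  proof (rule integral_mono)
    show "integrable (measure_pmf M) (\<lambda>b. \<epsilon>\<^sup>2 * indicator ?B b)"
      by (intro integrable_mult_right integrable_real_indicator) (auto simp: measure_pmf.emeasure_eq_measure)
    show "\<epsilon>\<^sup>2 * indicator ?B b \<le> ?f b" for b
    proof (cases "b \<in> ?B")
      case True
      then have "\<epsilon>\<^sup>2 \<le> \<bar>real (card {\<phi>\<in>E. A \<phi> b}) / a - \<mu>\<bar>\<^sup>2" using \<epsilon> by (intro power_mono) auto
      then show ?thesis using True f_eq[of b] by simp
    next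
      case False
      then show ?thesis unfolding f_eq by simp
    qed
  qed (rule int)
  also have "measure_pmf.expectation M ?f = (\<Sum>\<phi>\<in>E. \<Sum>\<psi>\<in>E. measure_pmf.prob M {b. A \<phi> b \<and> A \<psi> b}) / a\<^sup>2
      - 2 * \<mu> * ((\<Sum>\<phi>\<in>E. measure_pmf.prob M {b. A \<phi> b}) / a) + \<mu>\<^sup>2"
    by (simp add: Bochner_Integration.integral_add Bochner_Integration.integral_diff Bochner_Integration.integral_sum
        Bochner_Integration.integrable_sum integrable_real_indicator measure_pmf.emeasure_eq_measure)
  finally show ?thesis using \<epsilon> by (simp add: pos_le_divide_eq mult.commute)
qed

text \<open>Each exponent satisfies \<open>d * ((d - 1) choose (k - 1)) = k * (d choose k)\<close>, which is at least
\<open>d choose k\<close>. Hence \<open>s_param\<close> tends to \<open>0\<close> together with \<open>r_param\<close>.\<close>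

lemma s_param_power_le:
  assumes d: "d \<ge> 1" and p: "\<And>k. k \<in> {1..d} \<Longrightarrow> p k \<in> {0..1}"
  shows "s_param d p ^ d \<le> r_param d p"
proof -
  have "s_param d p ^ d = (\<Prod>k=1..d. p k ^ (d * (d - 1 choose (k - 1))))"
    unfolding s_param_def prod_power_distrib by (simp add: mult.commute flip: power_mult)
  also have "\<dots> \<le> (\<Prod>k=1..d. p k ^ (d choose k))"
  proof (rule prod_mono, intro conjI)
    fix k assume k: "k \<in> {1..d}"
    have "d * (d - 1 choose (k - 1)) = k * (d choose k)"
      using k d binomial_absorption[of "k - 1" d] by simp
    moreover have "d choose k \<le> k * (d choose k)" using k by simp
    ultimately show "p k ^ (d * (d - 1 choose (k - 1))) \<le> p k ^ (d choose k)"
      using p[OF k] by (intro power_decreasing) auto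
    show "0 \<le> p k ^ (d * (d - 1 choose (k - 1)))" using p[OF k] by simp
  qed
  finally show ?thesis by (simp add: r_param_def)
qed

definition tree_law :: "nat \<Rightarrow> real \<Rightarrow> (tree_vertex fset \<Rightarrow> nat) \<Rightarrow> nat \<Rightarrow> real" where
  "tree_law d lam N r = (\<Prod>t\<in>parents d N r. pmf (poisson_pmf lam) (N t))"

text \<open>Apply the count of block maps with one block for the root and one for each simplex with attached
vertices.\<close>

lemma embeddings_asymp:
  assumes d: "d \<ge> 1"
  shows "(\<lambda>n. real (card (embeddings d N r n)) / real n ^ card (vertices (grow d N r))) \<longlonglongrightarrow>
    1 / (fact d * (\<Prod>t\<in>parents d N r. fact (N t)))"
proof -
  let ?I = "parents d N r"
  let ?K = "insert None (Some ` ?I)"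
  let ?b = "\<lambda>k. case k of None \<Rightarrow> d | Some t \<Rightarrow> N t"
  let ?e = "\<lambda>k i. case k of None \<Rightarrow> Base i | Some t \<Rightarrow> Attached t i"
  have V: "vertices (grow d N r) = (\<Union>k\<in>?K. ?e k ` {..<?b k})"
    by (auto simp: vertices_grow[OF d] tree_root_def)
  have E: "embeddings d N r n = block_maps ?K ?b ?e n" for n
    unfolding embeddings_def block_maps_def ordered_embedding_def V by auto
  have "(\<lambda>n. real (card (block_maps ?K ?b ?e n)) / real n ^ (\<Sum>k\<in>?K. ?b k)) \<longlonglongrightarrow> (\<Prod>k\<in>?K. 1 / fact (?b k))"
    by (rule card_block_maps_asymp) (auto simp: finite_parents inj_on_def split: option.splits)
  moreover have "(\<Sum>k\<in>?K. ?b k) = card (vertices (grow d N r))"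
    by (simp add: card_vertices_grow[OF d] finite_parents sum.reindex)
  moreover have "(\<Prod>k\<in>?K. 1 / fact (?b k) :: real) = 1 / (fact d * (\<Prod>t\<in>?I. fact (N t)))"
    by (simp add: finite_parents prod.reindex prod_dividef)
  ultimately show ?thesis by (simp add: E)
qed

context tree_model
begin

abbreviation "hits b \<equiv> real (card {\<phi>\<in>embeddings d N r n. hit \<phi> b})"
abbreviation "norming \<equiv> real n ^ d * q_param d p / fact d"
abbreviation "dens \<equiv> real (card (embeddings d N r n)) / real n ^ card V"
abbreviation "kids \<equiv> \<Sum>t\<in>I. N t"
abbreviation "x1 \<equiv> real n * r1"

text \<open>Lower bound for the normalised first moment. The power \<open>(1 - m * r_param) ^ n\<close> is replaced by an
exponential function by means of \<open>ln (1 - y) \<ge> - y - 2 * y\<^sup>2\<close>, whose limit is immediate.\<close>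

definition hits_lower :: real where
  "hits_lower = dens * fact d * x1 ^ kids * (exp (- (real m * x1) - 2 * (real m)\<^sup>2 * (x1 * r1)) - 2 ^ card V * s1)"

definition hits_upper2 :: real where
  "hits_upper2 = (dens * fact d * x1 ^ kids)\<^sup>2 *
       exp (- (2 * real m - (2 * real m)\<^sup>2 * s1) * (r1 * real (n - 2 * card V))) +
     (fact d * x1 ^ kids)\<^sup>2 * overlap_const d N r x1 / real n"

lemma scale_wT:
  assumes n: "n \<ge> 1" and q: "q_param d p > 0"
  shows "real n ^ card V * wT / norming = fact d * x1 ^ kids"
proof -
  have "real n ^ card V * wT = (real n ^ d * q_param d p) * x1 ^ kids"
    by (simp add: card_vertices_grow[OF d] wT_eq power_add power_mult_distrib mult_ac)
  moreover have "real n ^ d * q_param d p > 0" using n q by simp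
  moreover have "a / (c / f) = f * y" if "a = c * y" "c > 0" for a c f y :: real
    using that by simp
  ultimately show ?thesis by blast
qed

lemma hits_deviation:
  assumes n: "n \<ge> 1" and r1: "r1 > 0" and q: "q_param d p > 0" and small: "real m * r1 \<le> 1 / 2"
    and \<mu>: "\<mu> \<ge> 0" and \<epsilon>: "\<epsilon> > 0"
  shows "PR (\<lambda>b. \<bar>hits b / norming - \<mu>\<bar> > \<epsilon>) \<le> (hits_upper2 - 2 * \<mu> * hits_lower + \<mu>\<^sup>2) / \<epsilon>\<^sup>2"
proof -
  let ?E = "embeddings d N r n"
  let ?S1 = "\<Sum>\<phi>\<in>?E. PR (hit \<phi>)"
  let ?S2 = "\<Sum>\<phi>\<in>?E. \<Sum>\<psi>\<in>?E. PR (\<lambda>b. hit \<phi> b \<and> hit \<psi> b)"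
  have nK: "real n ^ card V > 0" using n by simp
  have norming: "norming > 0" using n q by simp
  have cE: "real (card ?E) = dens * real n ^ card V" using nK by simp
  note sw = scale_wT[OF n q]
  have "hits_lower \<le> ?S1 / norming"
  proof -
    have y: "0 \<le> real m * r1" using r1 by simp
    have "exp (- (real m * x1) - 2 * (real m)\<^sup>2 * (x1 * r1)) = exp (real n * (- (real m * r1) - 2 * (real m * r1)\<^sup>2))"
      by (simp add: power2_eq_square algebra_simps)
    also have "\<dots> = exp (- (real m * r1) - 2 * (real m * r1)\<^sup>2) ^ n" by (simp add: exp_of_nat_mult)
    also have "\<dots> \<le> (1 - real m * r1) ^ n"
    proof (rule power_mono)
      have "exp (- (real m * r1) - 2 * (real m * r1)\<^sup>2) \<le> exp (ln (1 - real m * r1))"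
        using ln_one_minus_pos_lower_bound[OF y small] by simp
      then show "exp (- (real m * r1) - 2 * (real m * r1)\<^sup>2) \<le> 1 - real m * r1" using small by simp
    qed simp
    finally have "exp (- (real m * x1) - 2 * (real m)\<^sup>2 * (x1 * r1)) - 2 ^ card V * s1 \<le> (1 - real m * r1) ^ n - 2 ^ card V * s1"
      by simp
    then have le: "wT * (exp (- (real m * x1) - 2 * (real m)\<^sup>2 * (x1 * r1)) - 2 ^ card V * s1) \<le>
        wT * ((1 - real m * r1) ^ n - 2 ^ card V * s1)"
      using wT_nonneg by (rule mult_left_mono)
    have "real m * r1 \<le> 1" using small by linarith
    then have "wT * (exp (- (real m * x1) - 2 * (real m)\<^sup>2 * (x1 * r1)) - 2 ^ card V * s1) \<le> PR (hit \<phi>)" if "\<phi> \<in> ?E" for \<phi>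
      using order_trans[OF le prob_hit_lower[OF that]] by blast
    then have "(\<Sum>\<phi>\<in>?E. wT * (exp (- (real m * x1) - 2 * (real m)\<^sup>2 * (x1 * r1)) - 2 ^ card V * s1)) \<le> ?S1"
      by (rule sum_mono)
    then have "(dens * real n ^ card V * wT * (exp (- (real m * x1) - 2 * (real m)\<^sup>2 * (x1 * r1)) - 2 ^ card V * s1)) / norming \<le> ?S1 / norming"
      using norming unfolding cE[symmetric] by (intro divide_right_mono) (simp_all add: mult.assoc)
    moreover have "(dens * real n ^ card V * wT * (exp (- (real m * x1) - 2 * (real m)\<^sup>2 * (x1 * r1)) - 2 ^ card V * s1)) / norming
      = dens * (real n ^ card V * wT / norming) * (exp (- (real m * x1) - 2 * (real m)\<^sup>2 * (x1 * r1)) - 2 ^ card V * s1)"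
      by simp
    ultimately show ?thesis unfolding sw hits_lower_def by (simp add: mult.assoc)
  qed
  then have low: "2 * \<mu> * hits_lower \<le> 2 * \<mu> * (?S1 / norming)" using \<mu> by (intro mult_left_mono) auto
  have "?S2 / norming\<^sup>2 \<le> hits_upper2"
  proof -
    let ?e = "exp (- (2 * real m * r1 - (2 * real m)\<^sup>2 * (r1 * s1)) * real (n - 2 * card V))"
    have alg: "((u * k)\<^sup>2 * w\<^sup>2 * e + k\<^sup>2 * w\<^sup>2 * o' / z) / c\<^sup>2 =
        (u * (k * w / c))\<^sup>2 * e + (k * w / c)\<^sup>2 * o' / z" for u k w e o' z c :: real
      by (simp add: power_mult_distrib power_divide add_divide_distrib mult_ac)
    have "?S2 \<le> (dens * real n ^ card V)\<^sup>2 * wT\<^sup>2 * ?e +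
       (real n ^ card V)\<^sup>2 * wT\<^sup>2 * overlap_const d N r x1 / real n"
      using second_moment[OF n r1] unfolding cE[symmetric] .
    then have "?S2 / norming\<^sup>2 \<le> ((dens * real n ^ card V)\<^sup>2 * wT\<^sup>2 * ?e +
       (real n ^ card V)\<^sup>2 * wT\<^sup>2 * overlap_const d N r x1 / real n) / norming\<^sup>2"
      by (rule divide_right_mono) simp
    also have "\<dots> = (dens * (real n ^ card V * wT / norming))\<^sup>2 * ?e + (real n ^ card V * wT / norming)\<^sup>2 * overlap_const d N r x1 / real n"
      by (rule alg)
    also have "- (2 * real m * r1 - (2 * real m)\<^sup>2 * (r1 * s1)) * real (n - 2 * card V) =
        - (2 * real m - (2 * real m)\<^sup>2 * s1) * (r1 * real (n - 2 * card V))"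
      by (simp add: algebra_simps)
    finally show ?thesis unfolding sw hits_upper2_def by (simp add: mult.assoc)
  qed
  moreover have "PR (\<lambda>b. \<bar>hits b / norming - \<mu>\<bar> > \<epsilon>) \<le> (?S2 / norming\<^sup>2 - 2 * \<mu> * (?S1 / norming) + \<mu>\<^sup>2) / \<epsilon>\<^sup>2"
    using prob_count_deviation[where M = "coins d n p" and A = "\<lambda>\<phi> b. hit \<phi> b",
      OF finite_embeddings[OF d, of N r n] norming \<epsilon>, of \<mu>] .
  ultimately show ?thesis
    using low by (meson order_trans divide_right_mono add_right_mono diff_mono zero_le_power2)
qed

end

text \<open>After division by the expected number of \<open>(d-1)\<close>-simplices, asymptotically
\<open>n ^ d * q_param / d!\<close>, the first moment is at least \<open>\<mu> - o(1)\<close> and the second one at most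
\<open>\<mu>\<^sup>2 + o(1)\<close> for the Poisson weight \<open>\<mu>\<close> of the tree. So the variance around \<open>\<mu>\<close> vanishes.\<close>

lemma hits_concentrate:
  fixes p :: "nat \<Rightarrow> nat \<Rightarrow> real"
  assumes d: "d \<ge> 1" and lam: "lam > 0" and p: "\<And>n k. k \<in> {1..d} \<Longrightarrow> p n k \<in> {0..1}"
    and q: "\<forall>\<^sub>F n in sequentially. q_param d (p n) > 0"
    and r1: "(\<lambda>n. real n * r_param d (p n)) \<longlonglongrightarrow> lam" and \<epsilon>: "\<epsilon> > 0"
  shows "(\<lambda>n. measure_pmf.prob (coins d n (p n))
     {b. \<bar>real (card {\<phi>\<in>embeddings d N r n. found d N r (coin_complex d n b) \<phi>}) /
          (real n ^ d * q_param d (p n) / fact d) - tree_law d lam N r\<bar> > \<epsilon>}) \<longlonglongrightarrow> 0"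
proof -
  let ?V = "vertices (grow d N r)" and ?I = "parents d N r" and ?\<mu> = "tree_law d lam N r"
  let ?m = "real (card ?I)" and ?j = "\<Sum>t\<in>?I. N t"
  let ?r = "\<lambda>n. r_param d (p n)" and ?s = "\<lambda>n. s_param d (p n)"
  have model: "tree_model d (p n)" for n
    using d p by unfold_locales auto
  have fm: "face_model d (p n)" for n using d p by unfold_locales auto
  let ?L = "\<lambda>n. tree_model.hits_lower d n (p n) N r" and ?U = "\<lambda>n. tree_model.hits_upper2 d n (p n) N r"
  define \<kappa> where "\<kappa> = 1 / (fact d * (\<Prod>t\<in>?I. fact (N t)) :: real)"
  have dens: "(\<lambda>n. real (card (embeddings d N r n)) / real n ^ card ?V) \<longlonglongrightarrow> \<kappa>"
    unfolding \<kappa>_def by (rule embeddings_asymp[OF d])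
  have inv: "(\<lambda>n. 1 / real n) \<longlonglongrightarrow> 0" by (rule lim_1_over_n)
  have r0: "?r \<longlonglongrightarrow> 0"
  proof -
    have "(\<lambda>n. (real n * ?r n) * (1 / real n)) \<longlonglongrightarrow> lam * 0" by (intro tendsto_mult r1 inv)
    moreover have "\<forall>\<^sub>F n in sequentially. (real n * ?r n) * (1 / real n) = ?r n"
      using eventually_gt_at_top[of 0] by eventually_elim simp
    ultimately show ?thesis by (simp add: tendsto_cong)
  qed
  have s01: "?s n \<in> {0..1}" for n using face_model.params_01(2)[OF fm] .
  have s0: "?s \<longlonglongrightarrow> 0"
  proof (rule tendsto_sandwich[OF _ _ tendsto_const])
    show "\<forall>\<^sub>F n in sequentially. 0 \<le> ?s n" using s01 by simp
    show "(\<lambda>n. root d (?r n)) \<longlonglongrightarrow> 0" using tendsto_real_root[OF r0, of d] by simp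
    show "\<forall>\<^sub>F n in sequentially. ?s n \<le> root d (?r n)"
    proof (rule always_eventually, intro allI)
      fix n
      have "root d (?s n ^ d) \<le> root d (?r n)"
        using s_param_power_le[OF d p] d by (intro real_root_le_mono) auto
      moreover have "root d (?s n ^ d) = ?s n"
        by (rule real_root_power_cancel) (use d s01[of n] in auto)
      ultimately show "?s n \<le> root d (?r n)" by argo
    qed
  qed
  \<comment> \<open>The vertices of two copies of the tree are not available as outside vertices, which is negligible.\<close>
  have rn: "(\<lambda>n. ?r n * real (n - 2 * card ?V)) \<longlonglongrightarrow> lam"
  proof -
    have "(\<lambda>n. (real n * ?r n) - real (2 * card ?V) * ?r n) \<longlonglongrightarrow> lam - real (2 * card ?V) * 0"
      by (intro tendsto_intros r1 r0)
    moreover have "\<forall>\<^sub>F n in sequentially. (real n * ?r n) - real (2 * card ?V) * ?r n = ?r n * real (n - 2 * card ?V)"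
      using eventually_ge_at_top[of "2 * card ?V"] by eventually_elim (simp add: of_nat_diff algebra_simps)
    ultimately show ?thesis by (simp add: tendsto_cong)
  qed
  have \<mu>_eq: "?\<mu> = \<kappa> * fact d * lam ^ ?j * exp (- (?m * lam))"
  proof -
    have "?\<mu> = (\<Prod>t\<in>?I. lam ^ N t / fact (N t) * exp (- lam))"
      unfolding tree_law_def using lam by simp
    also have "\<dots> = lam ^ ?j / (\<Prod>t\<in>?I. fact (N t)) * exp (- lam) ^ card ?I"
      by (simp add: prod.distrib prod_dividef power_sum)
    also have "exp (- lam) ^ card ?I = exp (- (?m * lam))" by (simp flip: exp_of_nat_mult)
    finally show ?thesis unfolding \<kappa>_def by simp
  qed
  have Llim: "?L \<longlonglongrightarrow> \<kappa> * fact d * lam ^ ?j * (exp (- (?m * lam) - 2 * ?m\<^sup>2 * (lam * 0)) - 2 ^ card ?V * 0)"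
    unfolding tree_model.hits_lower_def[OF model] by (intro tendsto_intros dens r1 r0 s0)
  have Ulim: "?U \<longlonglongrightarrow> (\<kappa> * fact d * lam ^ ?j)\<^sup>2 * exp (- (2 * ?m - (2 * ?m)\<^sup>2 * 0) * lam) +
      (fact d * lam ^ ?j)\<^sup>2 * overlap_const d N r lam * 0"
  proof -
    have oc: "(\<lambda>n. overlap_const d N r (real n * ?r n)) \<longlonglongrightarrow> overlap_const d N r lam"
      unfolding overlap_const_def using lam by (intro tendsto_intros r1) auto
    have "(\<lambda>n. (real (card (embeddings d N r n)) / real n ^ card ?V * fact d * (real n * ?r n) ^ ?j)\<^sup>2 *
       exp (- (2 * ?m - (2 * ?m)\<^sup>2 * ?s n) * (?r n * real (n - 2 * card ?V))) +
      (fact d * (real n * ?r n) ^ ?j)\<^sup>2 * overlap_const d N r (real n * ?r n) * (1 / real n)) \<longlonglongrightarrow>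
      (\<kappa> * fact d * lam ^ ?j)\<^sup>2 * exp (- (2 * ?m - (2 * ?m)\<^sup>2 * 0) * lam) +
      (fact d * lam ^ ?j)\<^sup>2 * overlap_const d N r lam * 0"
      by (intro tendsto_intros dens r1 s0 rn oc inv)
    then show ?thesis unfolding tree_model.hits_upper2_def[OF model] by simp
  qed
  have "(\<lambda>n. (?U n - 2 * ?\<mu> * ?L n + ?\<mu>\<^sup>2) / \<epsilon>\<^sup>2) \<longlonglongrightarrow> (?\<mu>\<^sup>2 - 2 * ?\<mu> * ?\<mu> + ?\<mu>\<^sup>2) / \<epsilon>\<^sup>2"
  proof -
    have "?L \<longlonglongrightarrow> ?\<mu>" using Llim by (simp add: \<mu>_eq)
    moreover have "?U \<longlonglongrightarrow> ?\<mu>\<^sup>2"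
    proof -
      have "(exp (- (?m * lam)))\<^sup>2 = exp (- (2 * ?m * lam))" by (simp add: power2_eq_square flip: exp_add)
      then show ?thesis using Ulim by (simp add: \<mu>_eq power_mult_distrib mult.assoc)
    qed
    ultimately show ?thesis using \<epsilon> by (intro tendsto_intros) auto
  qed
  then have lim: "(\<lambda>n. (?U n - 2 * ?\<mu> * ?L n + ?\<mu>\<^sup>2) / \<epsilon>\<^sup>2) \<longlonglongrightarrow> 0" by (simp add: power2_eq_square)
  have \<mu>0: "?\<mu> \<ge> 0" unfolding tree_law_def by (intro prod_nonneg) simp
  have "\<forall>\<^sub>F n in sequentially. real n * ?r n > 0" using order_tendstoD(1)[OF r1 lam] .
  moreover have "\<forall>\<^sub>F n in sequentially. ?m * ?r n < 1 / 2"
    by (rule order_tendstoD(2)[OF tendsto_mult_right_zero[OF r0]]) simp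
  ultimately have "\<forall>\<^sub>F n in sequentially. measure_pmf.prob (coins d n (p n))
     {b. \<bar>real (card {\<phi>\<in>embeddings d N r n. found d N r (coin_complex d n b) \<phi>}) /
          (real n ^ d * q_param d (p n) / fact d) - ?\<mu>\<bar> > \<epsilon>} \<le> (?U n - 2 * ?\<mu> * ?L n + ?\<mu>\<^sup>2) / \<epsilon>\<^sup>2"
    using q eventually_ge_at_top[of 1]
  proof eventually_elim
    case (elim n)
    have "?r n > 0" using elim(1) by (simp add: zero_less_mult_iff)
    then show ?case
      using tree_model.hits_deviation[OF model[of n] _ _ _ _ \<mu>0 \<epsilon>, where N = N and r = r and n = n] elim by simp
  qed
  then show ?thesis by (intro tendsto_sandwich[OF _ _ tendsto_const lim]) auto
qed

section \<open>The law of the Poisson tree and the convergence\<close>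

text \<open>An injective numbering of the tree vertices. It serves to see that there are only countably many
balls, which makes the limiting events measurable and allows approximation by finite families.\<close>

primrec vertex_code :: "tree_vertex \<Rightarrow> nat" where
  "vertex_code (Base n) = 2 * n"
| "vertex_code (Attached s i) = Suc (2 * prod_encode (set_encode (fset (fimage vertex_code s)), i))"

lemma vertex_code_inject: "vertex_code x = vertex_code y \<Longrightarrow> x = y"
proof (induction x arbitrary: y)
  case (Base n)
  then show ?case by (cases y) (simp_all, presburger)
next
  case (Attached s i)
  obtain s' i' where y: "y = Attached s' i'"
    using Attached.prems by (cases y) (simp_all, presburger)
  have "set_encode (vertex_code ` fset s) = set_encode (vertex_code ` fset s')" and i: "i = i'"
    using Attached.prems by (auto simp: y)
  then have eq: "vertex_code ` fset s = vertex_code ` fset s'"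
    by (simp add: set_encode_eq)
  have "fset s = fset s'"
  proof (intro set_eqI iffI)
    fix v assume v: "v \<in> fset s"
    then obtain u where "u \<in> fset s'" "vertex_code v = vertex_code u" using eq by (metis image_iff)
    then show "v \<in> fset s'" using Attached.IH[OF v, of u] by simp
  next
    fix v assume v: "v \<in> fset s'"
    then obtain u where "u \<in> fset s" "vertex_code u = vertex_code v" using eq by (metis image_iff)
    then show "v \<in> fset s" using Attached.IH[of u v] by simp
  qed
  then show ?case using y i by (simp add: fset_inject)
qed

lemma countable_trees: "countable (range (\<lambda>N. grow d N r))"
proof -
  have "countable (UNIV :: tree_vertex set)"
    using countableI'[of vertex_code UNIV] vertex_code_inject by (auto simp: inj_on_def)
  then have "countable {\<alpha> :: tree_vertex set. finite \<alpha> \<and> \<alpha> \<subseteq> UNIV}"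
    by (rule countable_Collect_finite_subset)
  then have "countable {X. finite X \<and> X \<subseteq> {\<alpha> :: tree_vertex set. finite \<alpha> \<and> \<alpha> \<subseteq> UNIV}}"
    by (rule countable_Collect_finite_subset)
  then show ?thesis
    by (rule countable_subset[rotated]) (use finite_grow grow_complex in auto)
qed

lemma space_poisson_space: "space (poisson_space lam) = UNIV"
  by (simp add: poisson_space_def space_PiM)

lemma prob_space_poisson_space: "prob_space (poisson_space lam)"
  unfolding poisson_space_def by (intro prob_space_PiM measure_pmf.prob_space_axioms)

text \<open>Having a given ball of radius \<open>r\<close> prescribes the number of attached vertices at finitely many
simplices and nothing else.\<close>

lemma poisson_tree_law:
  assumes d: "d \<ge> 1"
  shows "{\<omega>. grow d \<omega> r = grow d N r} \<in> sets (poisson_space lam)"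
    and "measure (poisson_space lam) {\<omega>. grow d \<omega> r = grow d N r} = tree_law d lam N r"
proof -
  interpret P: product_prob_space "\<lambda>_ :: tree_vertex fset. measure_pmf (poisson_pmf lam)" UNIV
    by unfold_locales
  let ?J = "parents d N r"
  have eq: "{\<omega>. grow d \<omega> r = grow d N r} = {\<omega> \<in> space (poisson_space lam). \<forall>t\<in>?J. \<omega> t \<in> {N t}}"
  proof -
    have "grow d \<omega> r = grow d N r \<longleftrightarrow> (\<forall>t\<in>?J. \<omega> t = N t)" for \<omega>
      using grow_cong(1)[of d N r \<omega>] grow_eq_imp[OF d, of \<omega> r N] by blast
    then show ?thesis by (simp add: space_poisson_space)
  qed
  show "{\<omega>. grow d \<omega> r = grow d N r} \<in> sets (poisson_space lam)"
    unfolding eq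
  proof (rule sets.sets_Collect_finite_All[OF _ finite_parents])
    fix t
    have "(\<lambda>\<omega>. \<omega> t) -` {N t} \<inter> space (poisson_space lam) \<in> sets (poisson_space lam)"
      unfolding poisson_space_def
      by (rule measurable_sets[OF measurable_component_singleton]) simp_all
    then show "{\<omega> \<in> space (poisson_space lam). \<omega> t \<in> {N t}} \<in> sets (poisson_space lam)"
      by (simp add: vimage_def Int_def conj_commute)
  qed
  have "emeasure (poisson_space lam) {\<omega>. grow d \<omega> r = grow d N r} =
      (\<Prod>t\<in>?J. emeasure (measure_pmf (poisson_pmf lam)) {N t})"
    unfolding eq unfolding poisson_space_def by (rule P.emeasure_PiM_Collect) (auto simp: finite_parents)
  also have "\<dots> = ennreal (tree_law d lam N r)"
    unfolding tree_law_def by (simp add: emeasure_pmf_single prod_ennreal)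
  finally show "measure (poisson_space lam) {\<omega>. grow d \<omega> r = grow d N r} = tree_law d lam N r"
    by (simp add: measure_def tree_law_def prod_nonneg)
qed

text \<open>By uniqueness of the labelling, the pairs of a tree in \<open>F\<close> and an embedding that finds it are
mapped injectively to the root simplices.\<close>

lemma sum_found_le:
  assumes d: "d \<ge> 1" and fin: "finite F" and distinct: "inj_on (\<lambda>N. grow d N r) F" and X: "finite X"
    and iso: "\<And>N \<phi>. N \<in> F \<Longrightarrow> inj_on \<phi> (vertices (grow d N r)) \<Longrightarrow>
       R ((`) \<phi> ` grow d N r, \<phi> ` tree_root d)"
  shows "(\<Sum>N\<in>F. card {\<phi>\<in>embeddings d N r n. found d N r X \<phi>}) \<le>
    card {\<sigma> \<in> simplices (d - 1) X. R (rooted_nbhd d (X, \<sigma>) r)}"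
proof -
  let ?S = "SIGMA N:F. {\<phi>\<in>embeddings d N r n. found d N r X \<phi>}"
  let ?f = "\<lambda>(N, \<phi>). \<phi> ` tree_root d"
  have "(\<Sum>N\<in>F. card {\<phi>\<in>embeddings d N r n. found d N r X \<phi>}) = card ?S"
    using fin by (intro card_SigmaI[symmetric]) (auto simp: finite_embeddings[OF d])
  also have "\<dots> \<le> card {\<sigma> \<in> simplices (d - 1) X. R (rooted_nbhd d (X, \<sigma>) r)}"
  proof (rule card_inj_on_le)
    show "inj_on ?f ?S"
    proof (rule inj_onI, clarsimp)
      fix N \<phi> M \<psi>
      assume h: "N \<in> F" "\<phi> \<in> embeddings d N r n" "found d N r X \<phi>"
        "M \<in> F" "\<psi> \<in> embeddings d M r n" "found d M r X \<psi>" "\<phi> ` tree_root d = \<psi> ` tree_root d"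
      have o: "ordered_embedding d N r \<phi>" "ordered_embedding d M r \<psi>"
        using h(2,5) by (auto simp: embeddings_def)
      have e: "(`) \<phi> ` grow d N r = (`) \<psi> ` grow d M r" using h(3,6,7) by (simp add: found_def)
      note u = ordered_embedding_unique[OF d o e h(7)]
      have "N = M" using u(1) h(1,4) distinct by (simp add: inj_on_def)
      moreover have "\<phi> = \<psi>"
      proof (rule PiE_ext)
        show "\<phi> \<in> vertices (grow d N r) \<rightarrow>\<^sub>E {1..n}" "\<psi> \<in> vertices (grow d N r) \<rightarrow>\<^sub>E {1..n}"
          using h(2,5) \<open>N = M\<close> by (auto simp: embeddings_def)
      qed (rule u(2))
      ultimately show "N = M \<and> \<phi> = \<psi>" by simp
    qed
    show "?f ` ?S \<subseteq> {\<sigma> \<in> simplices (d - 1) X. R (rooted_nbhd d (X, \<sigma>) r)}"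
    proof (rule image_subsetI)
      fix y assume y: "y \<in> ?S"
      obtain N \<phi> where y_eq: "y = (N, \<phi>)" by (cases y)
      have h: "N \<in> F" "\<phi> \<in> embeddings d N r n" "found d N r X \<phi>" using y by (auto simp: y_eq)
      have inj: "inj_on \<phi> (vertices (grow d N r))"
        using h(2) by (simp add: embeddings_def ordered_embedding_def)
      have "tree_root d \<subseteq> vertices (grow d N r)" unfolding vertices_grow[OF d] by blast
      then have "card (\<phi> ` tree_root d) = d"
        using card_image[OF inj_on_subset[OF inj]] finite_tree_root(2)[of d] by simp
      then have "\<phi> ` tree_root d \<in> simplices (d - 1) X"
        using h(3) d by (simp add: simplices_pred found_def)
      moreover have "R (rooted_nbhd d (X, \<phi> ` tree_root d) r)"
        using iso[OF h(1) inj] h(3) by (simp add: rooted_nbhd_def found_def)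
      ultimately show "?f y \<in> {\<sigma> \<in> simplices (d - 1) X. R (rooted_nbhd d (X, \<sigma>) r)}"
        by (simp add: y_eq)
    qed
    show "finite {\<sigma> \<in> simplices (d - 1) X. R (rooted_nbhd d (X, \<sigma>) r)}"
      using X by (auto simp: simplices_def)
  qed
  finally show ?thesis .
qed

text \<open>For radius \<open>0\<close> the ball around every \<open>(d-1)\<close>-simplex is a copy of the root. So the
concentration of this count also controls the number of \<open>(d-1)\<close>-simplices.\<close>

lemma card_simplices_le_found:
  assumes d: "d \<ge> 1" and X: "\<And>\<sigma>. \<sigma> \<in> X \<Longrightarrow> \<sigma> \<subseteq> {1..n}"
  shows "card (simplices (d - 1) X) \<le> card {\<phi>\<in>embeddings d N 0 n. found d N 0 X \<phi>}"
proof (rule surj_card_le)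
  show "finite {\<phi>\<in>embeddings d N 0 n. found d N 0 X \<phi>}" using finite_embeddings[OF d] by simp
  show "simplices (d - 1) X \<subseteq> (\<lambda>\<phi>. \<phi> ` tree_root d) ` {\<phi>\<in>embeddings d N 0 n. found d N 0 X \<phi>}"
  proof
    fix \<sigma> assume "\<sigma> \<in> simplices (d - 1) X"
    then have \<sigma>: "\<sigma> \<in> X" "card \<sigma> = d" "\<sigma> \<subseteq> {1..n}" using d X by (auto simp: simplices_pred)
    then have "finite \<sigma>" by (auto intro: finite_subset)
    then obtain f where f: "\<And>i j. i < j \<Longrightarrow> j < d \<Longrightarrow> f i < f j" "f ` {..<d} = \<sigma>"
      using strict_enum_exists[of \<sigma>] \<sigma>(2) by metis
    \<comment> \<open>Outside of the root the value must be \<open>undefined\<close>, as embeddings are extensional functions.\<close>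
    define \<phi> where "\<phi> v = (case v of Base i \<Rightarrow> if i < d then f i else undefined | Attached t i \<Rightarrow> undefined)" for v
    have \<phi>B: "\<phi> (Base i) = f i" if "i < d" for i using that by (simp add: \<phi>_def)
    have img: "\<phi> ` tree_root d = \<sigma>" unfolding f(2)[symmetric] tree_root_def image_image
      using \<phi>B by (intro image_cong) auto
    have V: "vertices (grow d N 0) = tree_root d" unfolding vertices_grow[OF d] by (simp add: parents_def)
    have "inj_on f {..<d}" using f(2) \<sigma>(2) by (intro eq_card_imp_inj_on) auto
    then have inj: "inj_on \<phi> (tree_root d)"
      unfolding tree_root_def using \<phi>B by (auto simp: inj_on_def)
    have "\<phi> \<in> embeddings d N 0 n"
      unfolding embeddings_def ordered_embedding_def V
    proof (intro CollectI conjI)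
      show "\<phi> \<in> tree_root d \<rightarrow>\<^sub>E {1..n}"
      proof (rule PiE_I)
        show "\<phi> v \<in> {1..n}" if "v \<in> tree_root d" for v using that img \<sigma>(3) by blast
        show "\<phi> v = undefined" if "v \<notin> tree_root d" for v
          using that by (cases v) (auto simp: \<phi>_def tree_root_def)
      qed
      show "\<forall>i j. i < j \<and> j < d \<longrightarrow> \<phi> (Base i) < \<phi> (Base j)" using f(1) \<phi>B by simp
    qed (use inj in \<open>auto simp: parents_def\<close>)
    moreover have "found d N 0 X \<phi>"
    proof -
      have "faces \<sigma> = (`) \<phi> ` faces (tree_root d)"
        unfolding img[symmetric] by (rule faces_image)
      then show ?thesis using \<sigma>(1) by (simp add: found_def img)
    qed
    ultimately show "\<sigma> \<in> (\<lambda>\<phi>. \<phi> ` tree_root d) ` {\<phi>\<in>embeddings d N 0 n. found d N 0 X \<phi>}"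
      using img by blast
  qed
qed

text \<open>The countably many possible balls exhaust the probability space, so finitely many of them already
have almost full probability.\<close>

lemma finite_tree_family:
  assumes d: "d \<ge> 1" and \<delta>: "\<delta> > 0"
  obtains F where "finite F" "inj_on (\<lambda>N. grow d N r) F"
    "measure (poisson_space lam) (\<Union>N\<in>F. {\<omega>. grow d \<omega> r = grow d N r}) > 1 - \<delta>"
proof -
  interpret P: prob_space "poisson_space lam" by (rule prob_space_poisson_space)
  let ?T = "range (\<lambda>N. grow d N r)"
  let ?S = "from_nat_into ?T"
  have S: "range ?S = ?T" by (rule range_from_nat_into) (auto simp: countable_trees)
  let ?A = "\<lambda>k. {\<omega>. grow d \<omega> r \<in> ?S ` {..<k}}"
  have A_eq: "?A k = (\<Union>i<k. {\<omega>. grow d \<omega> r = ?S i})" for k by auto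
  have meas: "{\<omega>. grow d \<omega> r = ?S i} \<in> P.events" for i
  proof -
    have "?S i \<in> ?T" by (rule from_nat_into) simp
    then obtain N where "?S i = grow d N r" by blast
    then show ?thesis using poisson_tree_law(1)[OF d] by simp
  qed
  have "(\<lambda>k. P.prob (?A k)) \<longlonglongrightarrow> P.prob (\<Union>k. ?A k)"
  proof (rule P.finite_Lim_measure_incseq)
    show "range ?A \<subseteq> P.events" unfolding A_eq using meas by auto
    show "incseq ?A" by (auto simp: incseq_def)
  qed
  moreover have "(\<Union>k. ?A k) = space (poisson_space lam)"
  proof -
    have "\<exists>k. grow d \<omega> r \<in> ?S ` {..<k}" for \<omega>
    proof -
      obtain i where "grow d \<omega> r = ?S i" using S by (metis rangeE rangeI)
      then show ?thesis by (intro exI[of _ "Suc i"]) auto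
    qed
    then show ?thesis by (auto simp: space_poisson_space)
  qed
  ultimately have "(\<lambda>k. P.prob (?A k)) \<longlonglongrightarrow> 1" by (simp add: P.prob_space)
  then have "\<forall>\<^sub>F k in sequentially. P.prob (?A k) > 1 - \<delta>"
    using \<delta> by (intro order_tendstoD(1)) auto
  then obtain k where k: "P.prob (?A k) > 1 - \<delta>" by (auto simp: eventually_sequentially)
  \<comment> \<open>Select one representative \<open>N\<close> for each of the first \<open>k\<close> balls.\<close>
  have "?S ` {..<k} \<subseteq> ?T" using S by blast
  then obtain F where F: "inj_on (\<lambda>N. grow d N r) F" "?S ` {..<k} = (\<lambda>N. grow d N r) ` F"
    unfolding subset_image_inj by blast
  have "finite ((\<lambda>N. grow d N r) ` F)" unfolding F(2)[symmetric] by simp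
  then have "finite F" using F(1) by (rule finite_imageD)
  moreover have "?A k = (\<Union>N\<in>F. {\<omega>. grow d \<omega> r = grow d N r})" unfolding F(2) by auto
  ultimately show ?thesis using that[of F] F(1) k by simp
qed

lemma frequency_close:
  fixes c :: "'i \<Rightarrow> real"
  assumes fin: "finite F" and \<eta>: "\<eta> > 0" and a: "a > 0" and c: "\<And>N. N \<in> F \<Longrightarrow> \<bar>c N / a - w N\<bar> \<le> \<eta>"
    and c0: "\<And>N. N \<in> F \<Longrightarrow> c N \<ge> 0"
    and s: "s / a \<le> 1 + \<eta>" "s > 0" and sub: "(\<Sum>N\<in>F. c N) \<le> h"
    and w: "(\<Sum>N\<in>F. w N) \<le> 1"
  shows "h / s \<ge> (\<Sum>N\<in>F. w N) - (real (card F) + 1) * \<eta>"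
proof -
  let ?W = "(\<Sum>N\<in>F. w N) - real (card F) * \<eta>"
  have "(\<Sum>N\<in>F. w N - \<eta>) \<le> (\<Sum>N\<in>F. c N / a)" using c by (intro sum_mono) (fastforce simp: abs_le_iff)
  then have W: "?W \<le> h / a"
    using divide_right_mono[OF sub, of a] a by (simp add: sum_subtractf sum_divide_distrib)
  have h0: "h \<ge> 0" using order_trans[OF sum_nonneg sub] c0 by blast
  note s0 = s(2)
  show ?thesis
  proof (cases "?W \<le> \<eta>")
    case True
    have "h / s \<ge> 0" using h0 s0 by simp
    then show ?thesis using True by (simp add: algebra_simps)
  next
    case False
    \<comment> \<open>Dividing by \<open>1 + \<eta>\<close> instead of \<open>1\<close> costs at most another \<open>\<eta>\<close>, because \<open>?W \<le> 1\<close>.\<close>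
    have "?W - \<eta> \<le> ?W * (1 - \<eta>)"
    proof -
      have "?W \<le> 1" using w \<eta> by (smt (verit) of_nat_0_le_iff mult_nonneg_nonneg)
      then have "?W * \<eta> \<le> 1 * \<eta>" using \<eta> by (intro mult_right_mono) auto
      then show ?thesis by (simp add: algebra_simps)
    qed
    also have "\<dots> \<le> ?W / (1 + \<eta>)"
    proof -
      have "(1 - \<eta>) * (1 + \<eta>) \<le> 1" by (simp add: algebra_simps)
      then have "?W * ((1 - \<eta>) * (1 + \<eta>)) \<le> ?W * 1" using False \<eta> by (intro mult_left_mono) auto
      then show ?thesis using \<eta> by (simp add: pos_le_divide_eq mult.assoc)
    qed
    also have "\<dots> \<le> (h / a) / (1 + \<eta>)" using W \<eta> by (intro divide_right_mono) auto
    also have "\<dots> \<le> (h / a) / (s / a)"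
      using s(1) s0 a h0 \<eta> by (intro divide_left_mono) auto
    also have "\<dots> = h / s" using a by simp
    finally show ?thesis by (simp add: algebra_simps)
  qed
qed

lemma nbhd_frequency_eq:
  assumes "finite X"
  shows "nbhd_frequency d X r H =
    real (card {\<sigma> \<in> simplices (d - 1) X. rooted_iso (rooted_nbhd d (X, \<sigma>) r) H}) / real (card (simplices (d - 1) X))"
proof -
  have fin: "finite (simplices (d - 1) X)" using assms by (simp add: simplices_def)
  have "real (card {\<sigma> \<in> simplices (d - 1) X. rooted_iso (rooted_nbhd d (X, \<sigma>) r) H}) =
      (\<Sum>\<sigma>\<in>{\<sigma> \<in> simplices (d - 1) X. rooted_iso (rooted_nbhd d (X, \<sigma>) r) H}. 1)" by simp
  also have "\<dots> = (\<Sum>\<sigma>\<in>simplices (d - 1) X. if rooted_iso (rooted_nbhd d (X, \<sigma>) r) H then 1 else 0)"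
    by (rule sum.inter_filter[OF fin])
  finally show ?thesis by (simp add: nbhd_frequency_def)
qed

text \<open>Lower bounds for the frequencies of all trees of a family that carries mass at least \<open>1 - e / 4\<close> give
bounds from both sides. The trees isomorphic to \<open>H\<close> bound the frequency of \<open>H\<close> from below, and
the other ones bound the frequency of the complementary event from below. This also disposes of
the complexes that are not trees.\<close>

lemma frequency_deterministic:
  fixes H :: "'v rooted" and w :: "(tree_vertex fset \<Rightarrow> nat) \<Rightarrow> real"
  assumes d: "d \<ge> 1" and fin: "finite F" and inj: "inj_on (\<lambda>N. grow d N r) F"
    and e: "0 < e" "e \<le> 1" and \<eta>_def: "\<eta> = e / (4 * (real (card F) + 1))"
    and w0: "\<And>N. N \<in> F \<Longrightarrow> w N \<ge> 0" and wF: "(\<Sum>N\<in>F. w N) > 1 - e / 4"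
    and good: "G = {N \<in> F. rooted_iso (grow d N r, tree_root d) H}"
    and m: "(\<Sum>N\<in>G. w N) \<le> \<mu>" "\<mu> \<le> 1 - (\<Sum>N\<in>F - G. w N)"
    and X: "finite X" "\<And>\<sigma>. \<sigma> \<in> X \<Longrightarrow> \<sigma> \<subseteq> {1..n}" and a: "a > 0"
    and c: "\<And>N. N \<in> F \<Longrightarrow> \<bar>real (card {\<phi>\<in>embeddings d N r n. found d N r X \<phi>}) / a - w N\<bar> \<le> \<eta>"
    and c0: "\<bar>real (card {\<phi>\<in>embeddings d N0 0 n. found d N0 0 X \<phi>}) / a - 1\<bar> \<le> \<eta>"
  shows "\<bar>nbhd_frequency d X r H - \<mu>\<bar> \<le> e"
proof -
  let ?c = "\<lambda>N. real (card {\<phi>\<in>embeddings d N r n. found d N r X \<phi>})"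
  let ?S = "simplices (d - 1) X"
  let ?Y = "{\<sigma> \<in> ?S. rooted_iso (rooted_nbhd d (X, \<sigma>) r) H}"
  let ?Z = "{\<sigma> \<in> ?S. \<not> rooted_iso (rooted_nbhd d (X, \<sigma>) r) H}"
  let ?s = "real (card ?S)" and ?h = "real (card ?Y)"
  let ?g = "\<Sum>N\<in>G. w N" and ?b = "\<Sum>N\<in>F - G. w N"
  have finS: "finite ?S" using X(1) by (simp add: simplices_def)
  have GF: "G \<subseteq> F" by (auto simp: good)
  have finG: "finite G" "finite (F - G)" using fin GF finite_subset by auto
  have injG: "inj_on (\<lambda>N. grow d N r) G" "inj_on (\<lambda>N. grow d N r) (F - G)"
    by (rule inj_on_subset[OF inj], use GF in blast)+
  have \<eta>: "\<eta> > 0" "(real (card F) + 1) * \<eta> = e / 4"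
    using e by (simp_all add: \<eta>_def field_simps add_pos_nonneg)
  have iso: "rooted_iso ((`) \<phi> ` grow d N r, \<phi> ` tree_root d) H \<longleftrightarrow> rooted_iso (grow d N r, tree_root d) H"
    if "inj_on \<phi> (vertices (grow d N r))" for \<phi> :: "tree_vertex \<Rightarrow> nat" and N
  proof (rule rooted_iso_image[OF that])
    show "\<alpha> \<subseteq> vertices (grow d N r) \<and> \<alpha> \<noteq> {}" if "\<alpha> \<in> grow d N r" for \<alpha>
      using vertices_grow_sub[OF that] grow_complex[OF that] by blast
    show "tree_root d \<subseteq> vertices (grow d N r)" unfolding vertices_grow[OF d] by blast
  qed
  have Y: "(\<Sum>N\<in>G. ?c N) \<le> ?h"
    using sum_found_le[OF d finG(1) injG(1) X(1), of "\<lambda>G. rooted_iso G H" n] iso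
    by (simp add: good flip: of_nat_sum)
  have Z: "(\<Sum>N\<in>F - G. ?c N) \<le> real (card ?Z)"
    using sum_found_le[OF d finG(2) injG(2) X(1), of "\<lambda>G. \<not> rooted_iso G H" n] iso
    by (simp add: good flip: of_nat_sum)
  have "card ?S = card ?Y + card ?Z"
    using finS by (subst card_Un_disjoint[symmetric]) (auto intro: arg_cong[where f = card])
  then have sYZ: "?s = ?h + real (card ?Z)" by simp
  have split: "(\<Sum>N\<in>F. f N) = (\<Sum>N\<in>G. f N) + (\<Sum>N\<in>F - G. f N)" for f :: "_ \<Rightarrow> real"
    using sum.subset_diff[OF GF fin] by (simp add: add.commute)
  have s1: "?s / a \<le> 1 + \<eta>"
  proof -
    have "?s \<le> real (card {\<phi>\<in>embeddings d N0 0 n. found d N0 0 X \<phi>})"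
      using card_simplices_le_found[OF d X(2)] by (intro of_nat_mono)
    then have "?s / a \<le> real (card {\<phi>\<in>embeddings d N0 0 n. found d N0 0 X \<phi>}) / a"
      using a by (intro divide_right_mono) auto
    then show ?thesis using c0 by linarith
  qed
  \<comment> \<open>Otherwise all counts vanish, although the weights of \<open>F\<close> sum up to nearly \<open>1\<close>.\<close>
  have s0: "?s > 0"
  proof (rule ccontr)
    assume "\<not> ?s > 0"
    then have s: "?s = 0" by simp
    have "?c N = 0" if "N \<in> F" for N
    proof -
      have "?c N \<le> (\<Sum>N\<in>F. ?c N)" using fin that by (intro member_le_sum) auto
      also have "\<dots> \<le> ?s" unfolding split sYZ using Y Z by simp
      finally show ?thesis using s by simp
    qed
    then have "w N \<le> \<eta>" if "N \<in> F" for N using c[OF that] that by simp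
    then have "(\<Sum>N\<in>F. w N) \<le> real (card F) * \<eta>" using sum_bounded_above[of F w \<eta>] by simp
    also have "\<dots> \<le> e / 4" using \<eta> by (simp add: algebra_simps)
    finally show False using wF e by simp
  qed
  have card_le: "real (card G) \<le> real (card F)" "real (card (F - G)) \<le> real (card F)"
    using fin GF by (auto intro: card_mono)
  then have small: "(real (card G) + 1) * \<eta> \<le> e / 4" "(real (card (F - G)) + 1) * \<eta> \<le> e / 4"
    unfolding \<eta>(2)[symmetric] using \<eta>(1) by (auto intro!: mult_right_mono)
  have gb: "?g \<ge> 0" "?b \<ge> 0" using w0 GF by (auto intro!: sum_nonneg)
  have "?h / ?s \<ge> ?g - (real (card G) + 1) * \<eta>"
    by (rule frequency_close[OF finG(1) \<eta>(1) a _ _ s1 s0 Y]) (use c GF m gb in auto)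
  moreover have "real (card ?Z) / ?s \<ge> ?b - (real (card (F - G)) + 1) * \<eta>"
    by (rule frequency_close[OF finG(2) \<eta>(1) a _ _ s1 s0 Z]) (use c m gb in auto)
  moreover have "?h / ?s + real (card ?Z) / ?s = 1"
    using s0 sYZ by (simp flip: add_divide_distrib)
  moreover have "?g + ?b > 1 - e / 4" using wF split[of w] by simp
  ultimately have "\<bar>?h / ?s - \<mu>\<bar> \<le> e" using small m e by linarith
  then show ?thesis by (simp add: nbhd_frequency_eq[OF X(1)])
qed

lemma finite_coin_complex: "finite (coin_complex d n b)"
  by (rule finite_subset[of _ "Pow {1..n}"]) (auto simp: coin_complex_def)

text \<open>The given random complex enters only through its distribution.\<close>

lemma measure_complex_eq_coins:
  assumes "X \<in> M \<rightarrow>\<^sub>M count_space UNIV" "distr M (count_space UNIV) X = measure_pmf (mrsc d n p)"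
  shows "measure M {\<omega> \<in> space M. Q (X \<omega>)} = measure_pmf.prob (coins d n p) {b. Q (coin_complex d n b)}"
proof -
  have "measure M {\<omega> \<in> space M. Q (X \<omega>)} = measure M (X -` {x. Q x} \<inter> space M)"
    by (intro arg_cong[where f = "measure M"]) auto
  also have "\<dots> = measure (distr M (count_space UNIV) X) {x. Q x}"
    using assms(1) by (subst measure_distr) auto
  also have "\<dots> = measure_pmf.prob (coins d n p) {b. Q (coin_complex d n b)}"
    unfolding assms(2) mrsc_eq_coins by (simp add: vimage_def)
  finally show ?thesis .
qed

theorem theorem3p6:
  fixes d :: nat and lam :: real and p :: "nat \<Rightarrow> nat \<Rightarrow> real"
    and M :: "nat \<Rightarrow> 'w measure" and X :: "nat \<Rightarrow> 'w \<Rightarrow> nat set set"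
  assumes "d \<ge> 1" and "lam > 0"
    and "\<And>n k. k \<in> {1..d} \<Longrightarrow> p n k \<in> {0..1}"
    and "\<And>n. prob_space (M n)"
    and "\<And>n. X n \<in> M n \<rightarrow>\<^sub>M count_space UNIV"
    and "\<And>n. distr (M n) (count_space UNIV) (X n) = measure_pmf (mrsc d n (p n))"
    and "filterlim (\<lambda>n. real n ^ d * q_param d (p n)) at_top sequentially"
    and "(\<lambda>n. real n * r_param d (p n)) \<longlonglongrightarrow> lam"
  shows "converges_locally_weakly_in_prob TYPE('v) d M X (poisson_space lam) (poisson_tree d)"
  unfolding converges_locally_weakly_in_prob_def Let_def
proof (intro allI ballI conjI impI)
  note d = assms(1)
  interpret P: prob_space "poisson_space lam" by (rule prob_space_poisson_space)
  fix r :: nat and H :: "'v rooted"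
  let ?A = "\<lambda>N. {\<omega>. grow d \<omega> r = grow d N r}"
  let ?w = "\<lambda>N. tree_law d lam N r"
  let ?E = "{\<omega> \<in> space (poisson_space lam). rooted_iso (rooted_nbhd d (poisson_tree d \<omega>) r) H}"
  have E_eq: "?E = {\<omega>. rooted_iso (grow d \<omega> r, tree_root d) H}"
    by (simp add: space_poisson_space rooted_nbhd_poisson_tree[OF d])
  show E_sets: "?E \<in> sets (poisson_space lam)"
  proof -
    let ?T = "{Y \<in> range (\<lambda>N. grow d N r). rooted_iso (Y, tree_root d) H}"
    have "(\<Union>Y\<in>?T. {\<omega>. grow d \<omega> r = Y}) \<in> sets (poisson_space lam)"
    proof (rule sets.countable_UN'')
      show "countable ?T" by (rule countable_subset[OF _ countable_trees]) blast
      show "{\<omega>. grow d \<omega> r = Y} \<in> sets (poisson_space lam)" if "Y \<in> ?T" for Y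
        using that poisson_tree_law(1)[OF d] by blast
    qed
    moreover have "(\<Union>Y\<in>?T. {\<omega>. grow d \<omega> r = Y}) = ?E" unfolding E_eq by auto
    ultimately show ?thesis by simp
  qed
  fix \<epsilon> :: real assume \<epsilon>: "\<epsilon> > 0"
  define e where "e = min \<epsilon> 1"
  have e: "0 < e" "e \<le> 1" "e \<le> \<epsilon>" using \<epsilon> by (auto simp: e_def)
  obtain F where F: "finite F" "inj_on (\<lambda>N. grow d N r) F" "P.prob (\<Union>N\<in>F. ?A N) > 1 - e / 4"
    using finite_tree_family[OF d, of "e / 4" r lam] e(1) by auto
  \<comment> \<open>Small enough that the errors of all trees in \<open>F\<close> together add up to at most \<open>e / 4\<close>.\<close>
  define \<eta> where "\<eta> = e / (4 * (real (card F) + 1))"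
  have \<eta>: "\<eta> > 0" using e by (simp add: \<eta>_def add_nonneg_pos)
  define G where "G = {N \<in> F. rooted_iso (grow d N r, tree_root d) H}"
  have prob_family: "P.prob (\<Union>N\<in>F'. ?A N) = (\<Sum>N\<in>F'. ?w N)" if "F' \<subseteq> F" for F'
  proof -
    have "P.prob (\<Union>N\<in>F'. ?A N) = (\<Sum>N\<in>F'. P.prob (?A N))"
    proof (rule P.finite_measure_finite_Union)
      show "finite F'" using that F(1) by (rule finite_subset)
      show "disjoint_family_on ?A F'"
        unfolding disjoint_family_on_def
      proof (intro ballI impI)
        fix N N' assume "N \<in> F'" "N' \<in> F'" "N \<noteq> N'"
        then have "grow d N r \<noteq> grow d N' r" using inj_onD[OF F(2), of N N'] that by blast
        then show "?A N \<inter> ?A N' = {}" by auto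
      qed
    qed (use poisson_tree_law(1)[OF d] in auto)
    then show ?thesis by (simp add: poisson_tree_law(2)[OF d])
  qed
  have A_sets: "(\<Union>N\<in>F'. ?A N) \<in> P.events" if "F' \<subseteq> F" for F'
    using finite_subset[OF that F(1)] poisson_tree_law(1)[OF d] by (intro sets.finite_UN) auto
  have \<mu>: "(\<Sum>N\<in>G. ?w N) \<le> P.prob ?E" "P.prob ?E \<le> 1 - (\<Sum>N\<in>F - G. ?w N)"
  proof -
    have GF: "G \<subseteq> F" "F - G \<subseteq> F" by (auto simp: G_def)
    have "(\<Union>N\<in>G. ?A N) \<subseteq> ?E" unfolding E_eq G_def by auto
    then show "(\<Sum>N\<in>G. ?w N) \<le> P.prob ?E"
      unfolding prob_family[OF GF(1), symmetric] by (rule P.finite_measure_mono[OF _ E_sets])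
    have "?E \<inter> (\<Union>N\<in>F - G. ?A N) = {}" unfolding E_eq G_def by auto
    then have "P.prob ?E + P.prob (\<Union>N\<in>F - G. ?A N) = P.prob (?E \<union> (\<Union>N\<in>F - G. ?A N))"
      using E_sets A_sets[OF GF(2)] by (intro P.finite_measure_Union[symmetric])
    also have "\<dots> \<le> 1" by (rule P.prob_le_1)
    finally show "P.prob ?E \<le> 1 - (\<Sum>N\<in>F - G. ?w N)" using prob_family[OF GF(2)] by simp
  qed
  have wF: "(\<Sum>N\<in>F. ?w N) > 1 - e / 4" using F(3) prob_family[of F] by simp
  have w0: "?w N \<ge> 0" for N unfolding tree_law_def by (intro prod_nonneg) simp
  let ?a = "\<lambda>n. real n ^ d * q_param d (p n) / fact d"
  \<comment> \<open>The frequency deviates only if the count of a tree in \<open>F\<close> deviates, or the number of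
      \<open>(d-1)\<close>-simplices, which is the count for radius \<open>0\<close> with limit \<open>1\<close>.\<close>
  let ?dev = "\<lambda>N r n. {b. \<bar>real (card {\<phi>\<in>embeddings d N r n. found d N r (coin_complex d n b) \<phi>}) / ?a n - tree_law d lam N r\<bar> > \<eta>}"
  let ?pr = "\<lambda>n. measure_pmf.prob (coins d n (p n))"
  have a_pos: "\<forall>\<^sub>F n in sequentially. real n ^ d * q_param d (p n) > 0"
    using assms(7) by (simp add: filterlim_at_top_dense)
  have q_pos: "\<forall>\<^sub>F n in sequentially. q_param d (p n) > 0"
    using a_pos by eventually_elim (simp add: zero_less_mult_iff)
  have conc: "(\<lambda>n. ?pr n (?dev N r n)) \<longlonglongrightarrow> 0" for N r
    by (rule hits_concentrate[OF d assms(2,3) q_pos assms(8) \<eta>])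
  have lim: "(\<lambda>n. (\<Sum>N\<in>F. ?pr n (?dev N r n)) + ?pr n (?dev (\<lambda>_. 0) 0 n)) \<longlonglongrightarrow> 0"
  proof -
    have "(\<lambda>n. \<Sum>N\<in>F. ?pr n (?dev N r n)) \<longlonglongrightarrow> (\<Sum>N\<in>F. 0)" by (intro tendsto_sum conc)
    from tendsto_add[OF this conc] show ?thesis by simp
  qed
  show "(\<lambda>n. measure (M n) {\<omega> \<in> space (M n). \<bar>nbhd_frequency d (X n \<omega>) r H - P.prob ?E\<bar> > \<epsilon>}) \<longlonglongrightarrow> 0"
  proof (rule tendsto_sandwich[OF _ _ tendsto_const lim])
    show "\<forall>\<^sub>F n in sequentially. 0 \<le> measure (M n) {\<omega> \<in> space (M n). \<bar>nbhd_frequency d (X n \<omega>) r H - P.prob ?E\<bar> > \<epsilon>}"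
      by simp
    show "\<forall>\<^sub>F n in sequentially. measure (M n) {\<omega> \<in> space (M n). \<bar>nbhd_frequency d (X n \<omega>) r H - P.prob ?E\<bar> > \<epsilon>}
        \<le> (\<Sum>N\<in>F. ?pr n (?dev N r n)) + ?pr n (?dev (\<lambda>_. 0) 0 n)"
      using a_pos
    proof eventually_elim
      case (elim n)
      have a: "?a n > 0" using elim by simp
      let ?bad = "{b. \<bar>nbhd_frequency d (coin_complex d n b) r H - P.prob ?E\<bar> > \<epsilon>}"
      have "b \<in> (\<Union>N\<in>F. ?dev N r n) \<union> ?dev (\<lambda>_. 0) 0 n" if b: "b \<in> ?bad" for b
      proof (rule ccontr)
        assume nb: "b \<notin> (\<Union>N\<in>F. ?dev N r n) \<union> ?dev (\<lambda>_. 0) 0 n"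
        have "\<bar>nbhd_frequency d (coin_complex d n b) r H - P.prob ?E\<bar> \<le> e"
        proof (rule frequency_deterministic[OF d F(1,2) e(1,2) \<eta>_def w0 wF G_def \<mu> finite_coin_complex coin_complex_subset a])
          show "\<bar>real (card {\<phi>\<in>embeddings d N r n. found d N r (coin_complex d n b) \<phi>}) / ?a n - ?w N\<bar> \<le> \<eta>"
            if "N \<in> F" for N using nb that by (auto simp: not_less)
          show "\<bar>real (card {\<phi>\<in>embeddings d (\<lambda>_. 0) 0 n. found d (\<lambda>_. 0) 0 (coin_complex d n b) \<phi>}) / ?a n - 1\<bar> \<le> \<eta>"
            using nb by (auto simp: not_less tree_law_def parents_def)
        qed
        then show False using b e(3) by simp
      qed
      then have "?bad \<subseteq> (\<Union>N\<in>F. ?dev N r n) \<union> ?dev (\<lambda>_. 0) 0 n" by blast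
      then have "?pr n ?bad \<le> ?pr n ((\<Union>N\<in>F. ?dev N r n) \<union> ?dev (\<lambda>_. 0) 0 n)"
        by (rule measure_pmf.finite_measure_mono) simp
      also have "\<dots> \<le> ?pr n (\<Union>N\<in>F. ?dev N r n) + ?pr n (?dev (\<lambda>_. 0) 0 n)"
        by (rule measure_Un_le) auto
      also have "\<dots> \<le> (\<Sum>N\<in>F. ?pr n (?dev N r n)) + ?pr n (?dev (\<lambda>_. 0) 0 n)"
        using F(1) by (intro add_right_mono measure_pmf.finite_measure_subadditive_finite) auto
      also have "?pr n ?bad = measure (M n) {\<omega> \<in> space (M n). \<bar>nbhd_frequency d (X n \<omega>) r H - P.prob ?E\<bar> > \<epsilon>}"
        by (rule measure_complex_eq_coins[OF assms(5,6), symmetric])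
      finally show ?case .
    qed
  qed
qed

end
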